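(* Let $d\ge2$ and let $\{H_j\}_{j=1}^d$ be a family of self-adjoint extensions of the respective partials $\frac1i\frac{\partial}{\partial x_j}$ ($j=1,\dots,d$, on $C_c^\infty(I^d)\subset L^2(I^d)$), which is assumed quasi-commutative with eigenvalue functions $v_j(n_1,\dots,\hat{\jmath},\dots,n_d)$ from $\mathbb{Z}^{d-1}$ to $\mathbb{T}$. Then the extensions are commutative if and only if the following pair of cocycle conditions is satisfied for all $j,k$ such that $1\le j<k\le d$, all $n_1,\dots,n_d\in\mathbb{Z}$, and all $l,m\in\mathbb{Z}\setminus\{0\}$: $$\big(v_j(n_1,\dots,\hat{\jmath},\dots,n_k+l,\dots,n_d)-v_j(n_1,\dots,\hat{\jmath},\dots,n_d)\big)\,\big(1-v_k(n_1,\dots,\hat{k},\dots,n_d)\big)=0$$ and $$\big(v_k(n_1,\dots,n_j+m,\dots,\hat{k},\dots,n_d)-v_k(n_1,\dots,\hat{k},\dots,n_d)\big)\,\big(1-v_j(n_1,\dots,\hat{\jmath},\dots,n_d)\big)=0.$$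
   Context: $I=(0,1)$ and $\mathbb{T}$ is the unit circle in $\mathbb{C}$. The notation $(n_1,\dots,\hat{\jmath},\dots,n_d)$ means that the $j$'th place is omitted. $e_\xi^{(r)}$ denotes the function $x_r\mapsto e^{i2\pi\xi x_r}$ of the $r$'th variable, restricted to $I$. Each self-adjoint extension $H_j$ of $\frac1i\frac{\partial}{\partial x_j}$ has a unitary boundary operator $V_j$ acting in the remaining variables $(x_1,\dots,x_{j-1},x_{j+1},\dots,x_d)$: the domain of $H_j$ is given by the boundary condition $$f(x_1,\dots,x_{j-1},1,x_{j+1},\dots,x_d)=V_j\big(f(x_1,\dots,x_{j-1},0,x_{j+1},\dots,x_d)\big),$$ and the unitary one-parameter group generated by $H_j$ is the representation of $\mathbb{R}$ induced from $\mathbb{Z}$ by $V_j$. The family $\{H_j\}$ is quasi-commuting (quasi-commutative) if there are phase angles $\alpha_j\in[0,1)$, $j=1,\dots,d$, such that each $V_j$ is diagonalized by the vectors $$e^{(1)}_{\alpha_1+n_1}\otimes\dots\otimes e^{(j-1)}_{\alpha_{j-1}+n_{j-1}}\otimes e^{(j+1)}_{\alpha_{j+1}+n_{j+1}}\otimes\dots\otimes e^{(d)}_{\alpha_d+n_d}$$ as $(n_1,\dots,\hat{\jmath},\dots,n_d)$ varies over $\mathbb{Z}^{d-1}$. The eigenvalue function $v_j\colon\mathbb{Z}^{d-1}\to\mathbb{T}$ is defined by letting $v_j(n_1,\dots,\hat{\jmath},\dots,n_d)$ be the eigenvalue of $V_j$ corresponding to this eigenvector. The extensions are commutative if they commute in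 the strong sense that all their spectral projections commute; equivalently, the unitary one-parameter groups generated by $H_1,\dots,H_d$ commute with each other.
   Formalization: For nonzero phase angles the displayed equivalence fails; the theorem replaces the 1 in the factors 1−v_k and 1−v_j by e^{2πiα_k} and e^{2πiα_j}, and proves the conditions exactly as displayed when all α_j=0. *)

theory Defs
  imports "HOL-Analysis.Analysis"
begin

section \<open>Square-integrable functions and operators on them\<close>

text \<open>
  Elements of $L^2(M)$ are represented by functions; equality of elements is equality almost
  everywhere. An unbounded operator is represented by its graph, a set of pairs of functions.
  A bounded everywhere defined operator is represented by a map on functions that respects
  equality almost everywhere.
\<close>

definition L2 :: "'a measure \<Rightarrow> ('a \<Rightarrow> complex) set" where
  "L2 M = {f. f \<in> borel_measurable M \<and> integrable M (\<lambda>x. (cmod (f x))\<^sup>2)}"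

definition l2_inner :: "'a measure \<Rightarrow> ('a \<Rightarrow> complex) \<Rightarrow> ('a \<Rightarrow> complex) \<Rightarrow> complex" where
  "l2_inner M f g = (LINT x|M. f x * cnj (g x))"

definition l2_norm :: "'a measure \<Rightarrow> ('a \<Rightarrow> complex) \<Rightarrow> real" where
  "l2_norm M f = sqrt (LINT x|M. (cmod (f x))\<^sup>2)"

definition ae_eq :: "'a measure \<Rightarrow> ('a \<Rightarrow> complex) \<Rightarrow> ('a \<Rightarrow> complex) \<Rightarrow> bool" where
  "ae_eq M f g \<longleftrightarrow> (AE x in M. f x = g x)"

definition L2_operator ::
  "'a measure \<Rightarrow> (('a \<Rightarrow> complex) \<Rightarrow> ('a \<Rightarrow> complex)) \<Rightarrow> bool" where
  "L2_operator M T \<longleftrightarrow>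
     (\<forall>f\<in>L2 M. T f \<in> L2 M) \<and>
     (\<forall>f\<in>L2 M. \<forall>g\<in>L2 M. ae_eq M f g \<longrightarrow> ae_eq M (T f) (T g)) \<and>
     (\<forall>f\<in>L2 M. \<forall>g\<in>L2 M. ae_eq M (T (\<lambda>x. f x + g x)) (\<lambda>x. T f x + T g x)) \<and>
     (\<forall>f\<in>L2 M. \<forall>c. ae_eq M (T (\<lambda>x. c * f x)) (\<lambda>x. c * T f x))"

definition unitary_operator ::
  "'a measure \<Rightarrow> (('a \<Rightarrow> complex) \<Rightarrow> ('a \<Rightarrow> complex)) \<Rightarrow> bool" where
  "unitary_operator M V \<longleftrightarrow>
     L2_operator M V \<and>
     (\<forall>f\<in>L2 M. \<forall>g\<in>L2 M. l2_inner M (V f) (V g) = l2_inner M f g) \<and>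
     (\<forall>g\<in>L2 M. \<exists>f\<in>L2 M. ae_eq M (V f) g)"

definition orthogonal_projection ::
  "'a measure \<Rightarrow> (('a \<Rightarrow> complex) \<Rightarrow> ('a \<Rightarrow> complex)) \<Rightarrow> bool" where
  "orthogonal_projection M P \<longleftrightarrow>
     L2_operator M P \<and>
     (\<forall>f\<in>L2 M. ae_eq M (P (P f)) (P f)) \<and>
     (\<forall>f\<in>L2 M. \<forall>g\<in>L2 M. l2_inner M (P f) g = l2_inner M f (P g))"

definition densely_defined :: "'a measure \<Rightarrow> ('a \<Rightarrow> complex) rel \<Rightarrow> bool" where
  "densely_defined M A \<longleftrightarrow>
     (\<forall>f\<in>L2 M. \<forall>\<epsilon>>0. \<exists>u\<in>Domain A. l2_norm M (\<lambda>x. f x - u x) < \<epsilon>)"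

definition adjoint_graph :: "'a measure \<Rightarrow> ('a \<Rightarrow> complex) rel \<Rightarrow> ('a \<Rightarrow> complex) rel" where
  "adjoint_graph M A =
     {(g, h). g \<in> L2 M \<and> h \<in> L2 M \<and> (\<forall>(f, f')\<in>A. l2_inner M f' g = l2_inner M f h)}"

text \<open>
  Since an adjoint graph is a linear subspace, closed under changes on null sets, and the adjoint
  of a densely defined graph is single-valued up to null sets, the equation below makes \<open>A\<close> the
  graph of a linear operator.
\<close>

definition self_adjoint :: "'a measure \<Rightarrow> ('a \<Rightarrow> complex) rel \<Rightarrow> bool" where
  "self_adjoint M A \<longleftrightarrow> densely_defined M A \<and> adjoint_graph M A = A"

definition self_adjoint_extension ::
  "'a measure \<Rightarrow> ('a \<Rightarrow> complex) rel \<Rightarrow> ('a \<Rightarrow> complex) rel \<Rightarrow> bool" where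
  "self_adjoint_extension M D H \<longleftrightarrow> D \<subseteq> H \<and> self_adjoint M H"


section \<open>Spectral projections and strong commutativity\<close>

definition projection_valued_measure ::
  "'a measure \<Rightarrow> (real set \<Rightarrow> ('a \<Rightarrow> complex) \<Rightarrow> ('a \<Rightarrow> complex)) \<Rightarrow> bool" where
  "projection_valued_measure M E \<longleftrightarrow>
     (\<forall>A\<in>sets borel. orthogonal_projection M (E A)) \<and>
     (\<forall>f\<in>L2 M. ae_eq M (E UNIV f) f) \<and>
     (\<forall>f\<in>L2 M. \<forall>A. range A \<subseteq> sets borel \<longrightarrow> disjoint_family A \<longrightarrow>
        (\<lambda>n::nat. l2_inner M (E (A n) f) f) sums l2_inner M (E (\<Union>n. A n) f) f)"

definition spectral_distribution ::
  "'a measure \<Rightarrow> (real set \<Rightarrow> ('a \<Rightarrow> complex) \<Rightarrow> ('a \<Rightarrow> complex)) \<Rightarrow> ('a \<Rightarrow> complex) \<Rightarrow> real measure"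
  where
  "spectral_distribution M E f =
     measure_of UNIV (sets borel) (\<lambda>A. ennreal (Re (l2_inner M (E A f) f)))"

text \<open>
  \<open>E\<close> is the spectral measure of \<open>H\<close>, that is, $H = \int \lambda \, dE(\lambda)$. Prescribing the
  domain and the quadratic form determines the linear operator, by polarization and density.
\<close>

definition spectral_resolution ::
  "'a measure \<Rightarrow> ('a \<Rightarrow> complex) rel \<Rightarrow> (real set \<Rightarrow> ('a \<Rightarrow> complex) \<Rightarrow> ('a \<Rightarrow> complex)) \<Rightarrow> bool" where
  "spectral_resolution M H E \<longleftrightarrow>
     projection_valued_measure M E \<and>
     Domain H = {f \<in> L2 M. integrable (spectral_distribution M E f) (\<lambda>t. t\<^sup>2)} \<and>
     (\<forall>(f, g)\<in>H. l2_inner M g f = complex_of_real (LINT t|spectral_distribution M E f. t))"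

definition strongly_commuting :: "'a measure \<Rightarrow> nat set \<Rightarrow> (nat \<Rightarrow> ('a \<Rightarrow> complex) rel) \<Rightarrow> bool" where
  "strongly_commuting M J H \<longleftrightarrow>
     (\<exists>E. (\<forall>j\<in>J. spectral_resolution M (H j) (E j)) \<and>
          (\<forall>j\<in>J. \<forall>k\<in>J. \<forall>A\<in>sets borel. \<forall>B\<in>sets borel. \<forall>f\<in>L2 M.
             ae_eq M (E j A (E k B f)) (E k B (E j A f))))"


section \<open>The cube and the partial derivatives\<close>

text \<open>
  The cube $I^J$ has as points the extensional functions on the index set \<open>J\<close>. Thus
  $I^d$ is \<open>cube {1..d}\<close>, and the space of the variables $(x_1,\dots,x_{j-1},x_{j+1},\dots,x_d)$ is
  \<open>cube ({1..d} - {j})\<close>.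
\<close>

definition cube :: "nat set \<Rightarrow> (nat \<Rightarrow> real) set" where
  "cube J = J \<rightarrow>\<^sub>E {0<..<1}"

definition cube_measure :: "nat set \<Rightarrow> (nat \<Rightarrow> real) measure" where
  "cube_measure J = PiM J (\<lambda>_. restrict_space lborel {0<..<1})"

definition pderiv_at :: "nat \<Rightarrow> ((nat \<Rightarrow> real) \<Rightarrow> complex) \<Rightarrow> (nat \<Rightarrow> real) \<Rightarrow> complex" where
  "pderiv_at j f x = vector_derivative (\<lambda>t. f (x(j := t))) (at (x j))"

primrec C_k_on_cube :: "nat \<Rightarrow> nat set \<Rightarrow> ((nat \<Rightarrow> real) \<Rightarrow> complex) \<Rightarrow> bool" where
  "C_k_on_cube 0 J f \<longleftrightarrow> continuous_on (cube J) f"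
| "C_k_on_cube (Suc k) J f \<longleftrightarrow> continuous_on (cube J) f \<and>
     (\<forall>j\<in>J. (\<forall>x\<in>cube J. (\<lambda>t. f (x(j := t))) differentiable (at (x j))) \<and>
            C_k_on_cube k J (pderiv_at j f))"

definition test_functions :: "nat set \<Rightarrow> ((nat \<Rightarrow> real) \<Rightarrow> complex) set" where
  "test_functions J = {\<phi>. (\<forall>k. C_k_on_cube k J \<phi>) \<and>
     (\<exists>K. compact K \<and> K \<subseteq> cube J \<and> (\<forall>x\<in>cube J - K. \<phi> x = 0))}"

definition minimal_partial :: "nat \<Rightarrow> nat \<Rightarrow> ((nat \<Rightarrow> real) \<Rightarrow> complex) rel" where
  "minimal_partial d j = {(\<phi>, \<lambda>x. (1 / \<i>) * pderiv_at j \<phi> x) |\<phi>. \<phi> \<in> test_functions {1..d}}"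


section \<open>Boundary operators\<close>

text \<open>
  \<open>face_value d j t f a\<close>: the function \<open>a\<close> of the remaining variables is the value of \<open>f\<close> on the
  face $x_j = t$. As \<open>f\<close> is only given up to null sets, the value is read off from a version \<open>F\<close> of
  \<open>f\<close> that is continuous in $x_j \in [0,1]$ for almost all values of the remaining variables; by
  Fubini's theorem \<open>a\<close> is then unique up to null sets. Such a version exists for every \<open>f\<close> in the
  domain of the adjoint of \<open>minimal_partial d j\<close>.
\<close>

definition face_value ::
  "nat \<Rightarrow> nat \<Rightarrow> real \<Rightarrow> ((nat \<Rightarrow> real) \<Rightarrow> complex) \<Rightarrow> ((nat \<Rightarrow> real) \<Rightarrow> complex) \<Rightarrow> bool" where
  "face_value d j t f a \<longleftrightarrow>
     (\<exists>F. ae_eq (cube_measure {1..d}) F f \<and>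
        (AE y in cube_measure ({1..d} - {j}).
           continuous_on {0..1} (\<lambda>s. F (y(j := s))) \<and> F (y(j := t)) = a y))"

text \<open>
  The domain of a self-adjoint extension \<open>H\<close> of $\frac1i\frac{\partial}{\partial x_j}$ is cut out of
  the domain of the adjoint by the condition $f|_{x_j=1} = V(f|_{x_j=0})$.
\<close>

definition boundary_operator ::
  "nat \<Rightarrow> nat \<Rightarrow> ((nat \<Rightarrow> real) \<Rightarrow> complex) rel \<Rightarrow>
   (((nat \<Rightarrow> real) \<Rightarrow> complex) \<Rightarrow> ((nat \<Rightarrow> real) \<Rightarrow> complex)) \<Rightarrow> bool" where
  "boundary_operator d j H V \<longleftrightarrow>
     unitary_operator (cube_measure ({1..d} - {j})) V \<and>
     Domain H = {f \<in> Domain (adjoint_graph (cube_measure {1..d}) (minimal_partial d j)).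
       \<exists>a\<in>L2 (cube_measure ({1..d} - {j})). \<exists>b\<in>L2 (cube_measure ({1..d} - {j})).
         face_value d j 0 f a \<and> face_value d j 1 f b \<and>
         ae_eq (cube_measure ({1..d} - {j})) b (V a)}"


section \<open>Quasi-commuting families\<close>

definition tensor_exp :: "nat set \<Rightarrow> (nat \<Rightarrow> real) \<Rightarrow> (nat \<Rightarrow> real) \<Rightarrow> complex" where
  "tensor_exp J \<xi> x = (\<Prod>r\<in>J. exp (\<i> * of_real (2 * pi * \<xi> r * x r)))"

text \<open>
  Points of $\mathbb{Z}^{d-1}$ with the place \<open>j\<close> omitted are the extensional functions
  on \<open>{1..d} - {j}\<close>.
\<close>

definition omit :: "nat \<Rightarrow> nat \<Rightarrow> (nat \<Rightarrow> int) \<Rightarrow> (nat \<Rightarrow> int)" where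
  "omit d j n = restrict n ({1..d} - {j})"

text \<open>
  The family \<open>H\<close> is quasi-commuting with phase angles \<open>\<alpha>\<close>, and \<open>v j\<close> is the eigenvalue function of
  the boundary operator of \<open>H j\<close>. The boundary operator is determined by \<open>H j\<close>, and the
  eigenvectors form an orthogonal basis, so that they diagonalize it.
\<close>

definition quasi_commuting_with ::
  "nat \<Rightarrow> (nat \<Rightarrow> ((nat \<Rightarrow> real) \<Rightarrow> complex) rel) \<Rightarrow> (nat \<Rightarrow> real) \<Rightarrow>
   (nat \<Rightarrow> (nat \<Rightarrow> int) \<Rightarrow> complex) \<Rightarrow> bool" where
  "quasi_commuting_with d H \<alpha> v \<longleftrightarrow>
     (\<forall>j\<in>{1..d}. \<alpha> j \<in> {0..<1} \<and>
       (\<exists>V. boundary_operator d j (H j) V \<and>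
         (\<forall>n \<in> ({1..d} - {j}) \<rightarrow>\<^sub>E UNIV. v j n \<in> sphere 0 1 \<and>
            ae_eq (cube_measure ({1..d} - {j}))
              (V (tensor_exp ({1..d} - {j}) (\<lambda>r. \<alpha> r + of_int (n r))))
              (\<lambda>y. v j n * tensor_exp ({1..d} - {j}) (\<lambda>r. \<alpha> r + of_int (n r)) y))))"

end

theory Submission
  imports Defs
begin

text \<open>
  Let $e(t) = e^{2\pi it}$ and let $\theta_j(n) \in [0,1)$ be the phase with
  $e(\theta_j(n)) = v_j(n)$. Integration by parts and the density of the test functions show that
  the functions
  $e((\theta_j(n) + n_j) x_j) \prod_{r \neq j} e((\alpha_r + n_r) x_r)$, $n \in \mathbb{Z}^d$, form an
  orthonormal basis of eigenvectors of $H_j$, with eigenvalues $2\pi(\theta_j(n) + n_j)$. Hence the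
  spectral projections of $H_j$ are explicit.

  If the spectral projections commute and $v_j$ takes different values at $n$ and $n' = n + l e_k$,
  a spectral projection of $H_j$ fixes $f = \prod_r e((\alpha_r + n_r) x_r)$ and annihilates the
  analogous $f'$ for $n'$. Therefore $\langle Pf, f' \rangle = 0$ for the projection $P$ onto an
  eigenspace of $H_k$. Only one basis vector of $H_k$ contributes, and this forces
  $v_k(n) = e(\alpha_k)$.

  Conversely, under the cocycle conditions, the functions with frequencies $\theta_j(n) + n_j$ in
  $x_j$, $\theta_k(n) + n_k$ in $x_k$ and $\alpha_r + n_r$ in the other variables are joint
  eigenvectors of $H_j$ and $H_k$: either $\theta_k$ does not depend on $n_j$, or
  $\theta_j(n) = \alpha_j$; and vice versa. They are total, since orthogonality to $e((\beta + m)t)$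
  for all $m \in \mathbb{Z}$ in one variable implies orthogonality to all functions of that variable.
\<close>

section \<open>Square-integrable functions\<close>

text \<open>The function with frequencies \<alpha>_r + n_r in all variables satisfies the boundary
  condition of H_k exactly when v_k(n) = e(\<alpha>_k). This is the origin of the constant in the
  general cocycle conditions; it equals 1 exactly when \<alpha>_k = 0.
  \<open>strongly_commuting\<close> only provides some family of spectral resolutions, so the
  necessity proof has to deal with an arbitrary one. Such a resolution is tied to its operator by
  the domain and the quadratic form alone, and its action on eigenvectors must be derived from
  these. The eigenbasis of H_j is not a tensor product basis, since its frequency in x_j depends on
  the other indices. Totality is therefore proved one variable at a time: a single factor of the
  integrand is replaced while all others are absorbed into an arbitrary integrable function. That
  test functions and their derivatives are square integrable is read off from a self-adjoint graph
  that contains them.\<close>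

lemma borel_measurable_cnj [measurable (raw)]:
  "f \<in> borel_measurable M \<Longrightarrow> (\<lambda>x. cnj (f x)) \<in> borel_measurable M"
  by (rule measurable_compose[OF _ borel_measurable_continuous_onI]) (auto intro: continuous_intros)

lemma L2_measurable [measurable_dest]: "f \<in> L2 M \<Longrightarrow> f \<in> borel_measurable M"
  and L2_integrable_square: "f \<in> L2 M \<Longrightarrow> integrable M (\<lambda>x. (cmod (f x))\<^sup>2)"
  by (auto simp: L2_def)

lemma L2_integrable_mult_cnj:
  assumes "f \<in> L2 M" "g \<in> L2 M"
  shows "integrable M (\<lambda>x. f x * cnj (g x))"
proof (rule Bochner_Integration.integrable_bound)
  show "integrable M (\<lambda>x. (cmod (f x))\<^sup>2 + (cmod (g x))\<^sup>2)"
    using assms by (intro Bochner_Integration.integrable_add L2_integrable_square)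
  show "(\<lambda>x. f x * cnj (g x)) \<in> borel_measurable M"
    using assms by (auto simp: L2_def)
  have "a * b \<le> a\<^sup>2 + b\<^sup>2" if "a \<ge> 0" "b \<ge> 0" for a b :: real
    using sum_squares_bound[of a b] mult_nonneg_nonneg[OF that] by linarith
  then show "AE x in M. norm (f x * cnj (g x)) \<le> norm ((cmod (f x))\<^sup>2 + (cmod (g x))\<^sup>2)"
    by (auto simp: norm_mult)
qed

lemma L2_add [intro]:
  assumes "f \<in> L2 M" "g \<in> L2 M"
  shows "(\<lambda>x. f x + g x) \<in> L2 M"
proof -
  have "integrable M (\<lambda>x. (cmod (f x + g x))\<^sup>2)"
  proof (rule Bochner_Integration.integrable_bound)
    show "integrable M (\<lambda>x. 2 * (cmod (f x))\<^sup>2 + 2 * (cmod (g x))\<^sup>2)"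
      using assms by (intro Bochner_Integration.integrable_add integrable_mult_right L2_integrable_square)
    show "(\<lambda>x. (cmod (f x + g x))\<^sup>2) \<in> borel_measurable M"
      using assms by (auto simp: L2_def)
    have "(cmod (a + b))\<^sup>2 \<le> 2 * (cmod a)\<^sup>2 + 2 * (cmod b)\<^sup>2" for a b
    proof -
      have "(cmod (a + b))\<^sup>2 \<le> (cmod a + cmod b)\<^sup>2"
        by (intro power_mono norm_triangle_ineq norm_ge_zero)
      also have "\<dots> \<le> 2 * (cmod a)\<^sup>2 + 2 * (cmod b)\<^sup>2"
        using sum_squares_bound[of "cmod a" "cmod b"] by (simp add: power2_sum)
      finally show ?thesis .
    qed
    then show "AE x in M. norm ((cmod (f x + g x))\<^sup>2)
        \<le> norm (2 * (cmod (f x))\<^sup>2 + 2 * (cmod (g x))\<^sup>2)"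
      by auto
  qed
  then show ?thesis using assms by (auto simp: L2_def)
qed

lemma L2_cmult [intro]: "f \<in> L2 M \<Longrightarrow> (\<lambda>x. c * f x) \<in> L2 M"
  by (auto simp: L2_def norm_mult power_mult_distrib)

lemma L2_zero [simp, intro]: "(\<lambda>x. 0) \<in> L2 M"
  by (auto simp: L2_def)

lemma L2_diff [intro]: "f \<in> L2 M \<Longrightarrow> g \<in> L2 M \<Longrightarrow> (\<lambda>x. f x - g x) \<in> L2 M"
  using L2_add[of f M "\<lambda>x. (-1) * g x"] L2_cmult[of g M "-1"] by simp

lemma L2_sum [intro]: "(\<And>i. i \<in> I \<Longrightarrow> f i \<in> L2 M) \<Longrightarrow> (\<lambda>x. \<Sum>i\<in>I. f i x) \<in> L2 M"
  by (induction I rule: infinite_finite_induct) (auto intro!: L2_add)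

section \<open>Inner product and norm\<close>

lemma l2_inner_add_left:
  "f \<in> L2 M \<Longrightarrow> g \<in> L2 M \<Longrightarrow> h \<in> L2 M \<Longrightarrow>
    l2_inner M (\<lambda>x. f x + g x) h = l2_inner M f h + l2_inner M g h"
  by (simp add: l2_inner_def distrib_right L2_integrable_mult_cnj)

lemma l2_inner_cmult_left: "l2_inner M (\<lambda>x. c * f x) h = c * l2_inner M f h"
  by (simp add: l2_inner_def mult.assoc)

lemma l2_inner_commute: "l2_inner M g f = cnj (l2_inner M f g)"
  unfolding l2_inner_def
  using Bochner_Integration.integral_cnj[of M "\<lambda>x. f x * cnj (g x)"] by (simp add: mult.commute)

lemma l2_inner_diff_left:
  "f \<in> L2 M \<Longrightarrow> g \<in> L2 M \<Longrightarrow> h \<in> L2 M \<Longrightarrow>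
    l2_inner M (\<lambda>x. f x - g x) h = l2_inner M f h - l2_inner M g h"
  by (simp add: l2_inner_def left_diff_distrib L2_integrable_mult_cnj)

lemma l2_inner_sum_left:
  "(\<And>i. i \<in> I \<Longrightarrow> f i \<in> L2 M) \<Longrightarrow> h \<in> L2 M \<Longrightarrow>
    l2_inner M (\<lambda>x. \<Sum>i\<in>I. f i x) h = (\<Sum>i\<in>I. l2_inner M (f i) h)"
  by (simp add: l2_inner_def sum_distrib_right L2_integrable_mult_cnj)

lemma l2_inner_add_right:
  "f \<in> L2 M \<Longrightarrow> g \<in> L2 M \<Longrightarrow> h \<in> L2 M \<Longrightarrow>
    l2_inner M h (\<lambda>x. f x + g x) = l2_inner M h f + l2_inner M h g"
  by (simp add: l2_inner_def distrib_left L2_integrable_mult_cnj)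

lemma l2_inner_cmult_right: "l2_inner M h (\<lambda>x. c * f x) = cnj c * l2_inner M h f"
  by (simp add: l2_inner_commute[of M h] l2_inner_cmult_left)

lemma l2_inner_diff_right:
  "f \<in> L2 M \<Longrightarrow> g \<in> L2 M \<Longrightarrow> h \<in> L2 M \<Longrightarrow>
    l2_inner M h (\<lambda>x. f x - g x) = l2_inner M h f - l2_inner M h g"
  by (simp add: l2_inner_def right_diff_distrib L2_integrable_mult_cnj)

lemma l2_inner_sum_right:
  "(\<And>i. i \<in> I \<Longrightarrow> f i \<in> L2 M) \<Longrightarrow> h \<in> L2 M \<Longrightarrow>
    l2_inner M h (\<lambda>x. \<Sum>i\<in>I. f i x) = (\<Sum>i\<in>I. l2_inner M h (f i))"
  by (simp add: l2_inner_def sum_distrib_left L2_integrable_mult_cnj)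

lemmas l2_sesquilinear =
  l2_inner_add_left l2_inner_add_right l2_inner_diff_left l2_inner_diff_right
  l2_inner_cmult_left l2_inner_cmult_right L2_add L2_diff L2_cmult

lemma ae_eq_refl [simp]: "ae_eq M f f"
  by (simp add: ae_eq_def)

lemma ae_eq_sym: "ae_eq M f g \<Longrightarrow> ae_eq M g f"
  by (auto simp: ae_eq_def)

lemma l2_inner_cong:
  assumes "ae_eq M f f'" "ae_eq M g g'" "f \<in> L2 M" "f' \<in> L2 M" "g \<in> L2 M" "g' \<in> L2 M"
  shows "l2_inner M f g = l2_inner M f' g'"
  unfolding l2_inner_def
proof (rule integral_cong_AE)
  show "AE x in M. f x * cnj (g x) = f' x * cnj (g' x)"
    using assms(1,2) unfolding ae_eq_def by eventually_elim simp
qed (use assms in \<open>auto simp: L2_def\<close>)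

lemmas l2_inner_cong_left = l2_inner_cong[OF _ ae_eq_refl]
lemmas l2_inner_cong_right = l2_inner_cong[OF ae_eq_refl]

lemma l2_norm_nonneg [simp]: "l2_norm M f \<ge> 0"
  by (simp add: l2_norm_def)

lemma l2_norm_square: "(l2_norm M f)\<^sup>2 = (LINT x|M. (cmod (f x))\<^sup>2)"
  by (simp add: l2_norm_def)

lemma l2_inner_self: "l2_inner M f f = of_real ((l2_norm M f)\<^sup>2)"
  by (simp add: l2_inner_def l2_norm_square flip: integral_complex_of_real complex_norm_square)

lemma l2_inner_self_eq_0:
  assumes "f \<in> L2 M" "l2_inner M f f = 0"
  shows "ae_eq M f (\<lambda>_. 0)"
proof -
  have "(LINT x|M. (cmod (f x))\<^sup>2) = 0"
    using assms(2) by (simp add: l2_inner_self l2_norm_square)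
  then have "AE x in M. (cmod (f x))\<^sup>2 = 0"
    using assms(1) by (subst (asm) integral_nonneg_eq_0_iff_AE) (auto intro: L2_integrable_square)
  then show ?thesis by (simp add: ae_eq_def)
qed

lemma ae_eqI_l2_inner:
  assumes "f \<in> L2 M" "g \<in> L2 M" "\<And>h. h \<in> L2 M \<Longrightarrow> l2_inner M f h = l2_inner M g h"
  shows "ae_eq M f g"
proof -
  have "ae_eq M (\<lambda>x. f x - g x) (\<lambda>_. 0)"
    using assms by (intro l2_inner_self_eq_0) (auto simp: l2_inner_diff_left L2_diff)
  then show ?thesis by (simp add: ae_eq_def)
qed

lemma l2_Cauchy_Schwarz:
  assumes f: "f \<in> L2 M" and g: "g \<in> L2 M"
  shows "cmod (l2_inner M f g) \<le> l2_norm M f * l2_norm M g"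
proof (cases "l2_norm M g = 0")
  case True
  then have "ae_eq M g (\<lambda>_. 0)" using g by (intro l2_inner_self_eq_0) (auto simp: l2_inner_self)
  then have "l2_inner M f g = l2_inner M f (\<lambda>_. 0)" using f g by (intro l2_inner_cong_right) auto
  then show ?thesis by (simp add: True l2_inner_def)
next
  case False
  define c where "c = l2_inner M f g / of_real ((l2_norm M g)\<^sup>2)"
  \<comment> \<open>\<open>h\<close> is the component of \<open>f\<close> orthogonal to
    \<open>g\<close>; that its squared norm is nonnegative is the inequality.\<close>
  define h where "h = (\<lambda>x. f x - c * g x)"
  have "l2_inner M h h = of_real ((l2_norm M f)\<^sup>2) - cnj c * l2_inner M f g - c * cnj (l2_inner M f g)
      + c * cnj c * of_real ((l2_norm M g)\<^sup>2)"
    using f g unfolding h_def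
    by (simp add: l2_sesquilinear l2_inner_self[symmetric] l2_inner_commute[of M g f] algebra_simps del: of_real_power)
  also have "\<dots> = of_real ((l2_norm M f)\<^sup>2) - c * cnj (l2_inner M f g)"
  proof -
    have N: "complex_of_real ((l2_norm M g)\<^sup>2) \<noteq> 0" using False by simp
    have "cnj c * of_real ((l2_norm M g)\<^sup>2) = cnj (l2_inner M f g)"
      unfolding c_def complex_cnj_divide complex_cnj_complex_of_real using N by simp
    moreover have "cnj c * l2_inner M f g = c * cnj (l2_inner M f g)"
      unfolding c_def complex_cnj_divide complex_cnj_complex_of_real by simp
    ultimately show ?thesis by (simp add: mult.assoc)
  qed
  also have "\<dots> = of_real ((l2_norm M f)\<^sup>2 - (cmod (l2_inner M f g))\<^sup>2 / (l2_norm M g)\<^sup>2)"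
    using complex_norm_square[of "l2_inner M f g"] by (simp add: c_def)
  finally have "(l2_norm M h)\<^sup>2 = (l2_norm M f)\<^sup>2 - (cmod (l2_inner M f g))\<^sup>2 / (l2_norm M g)\<^sup>2"
    unfolding l2_inner_self of_real_eq_iff .
  then have "(cmod (l2_inner M f g))\<^sup>2 / (l2_norm M g)\<^sup>2 \<le> (l2_norm M f)\<^sup>2"
    by (smt (verit) zero_le_power2)
  then have "(cmod (l2_inner M f g))\<^sup>2 \<le> (l2_norm M f * l2_norm M g)\<^sup>2"
    using False by (simp add: divide_le_eq power_mult_distrib)
  then show ?thesis by (rule power2_le_imp_le) simp
qed

lemma L2_const [simp, intro]: "finite_measure M \<Longrightarrow> (\<lambda>_. c) \<in> L2 M"
  by (auto simp: L2_def intro: finite_measure.integrable_const)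

lemma L2_integral_norm_le:
  assumes "finite_measure M" "f \<in> L2 M"
  shows "(LINT x|M. cmod (f x)) \<le> l2_norm M f * sqrt (measure M (space M))"
proof -
  let ?a = "\<lambda>x. complex_of_real (cmod (f x))"
  have a: "?a \<in> L2 M" using assms(2) by (auto simp: L2_def)
  have "l2_inner M ?a (\<lambda>_. 1) = of_real (LINT x|M. cmod (f x))"
    by (simp add: l2_inner_def)
  moreover have "l2_norm M ?a = l2_norm M f" "l2_norm M (\<lambda>_. 1) = sqrt (measure M (space M))"
    by (simp_all add: l2_norm_def)
  ultimately show ?thesis
    using l2_Cauchy_Schwarz[OF a L2_const[OF assms(1), of 1]] by simp
qed

text \<open>Over a finite measure an L2-Cauchy sequence is L1-Cauchy and so has a subsequence that
  converges almost everywhere. Fatou's lemma bounds the L2 distance from the limit to each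
  \<open>s n\<close> by distances within the sequence.\<close>

lemma L2_complete:
  assumes fin: "finite_measure M" and s: "\<And>n. s n \<in> L2 M"
    and Cauchy: "\<And>\<epsilon>. 0 < \<epsilon> \<Longrightarrow> \<exists>N. \<forall>m\<ge>N. \<forall>n\<ge>N. l2_norm M (\<lambda>x. s m x - s n x) < \<epsilon>"
  shows "\<exists>g\<in>L2 M. (\<lambda>n. l2_norm M (\<lambda>x. g x - s n x)) \<longlonglongrightarrow> 0"
proof -
  \<comment> \<open>The summand 1 keeps \<open>\<mu>\<close> positive even for the zero measure, so
    that \<open>e / \<mu>\<close> is a positive tolerance.\<close>
  define \<mu> where "\<mu> = sqrt (measure M (space M)) + 1"
  have \<mu>: "\<mu> > 0" by (auto simp: \<mu>_def intro: add_nonneg_pos)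
  have L1: "(LINT x|M. cmod (h x)) \<le> l2_norm M h * \<mu>" if "h \<in> L2 M" for h
    using L2_integral_norm_le[OF fin that] mult_left_mono[of "sqrt (measure M (space M))" \<mu> "l2_norm M h"]
    by (auto simp: \<mu>_def)
  obtain r where r: "strict_mono r" and ae: "AE x in M. Cauchy (\<lambda>i. s (r i) x)"
  proof (rule cauchy_L1_AE_cauchy_subseq)
    fix n
    have "integrable M (\<lambda>x. s n x * cnj 1)"
      using s fin by (intro L2_integrable_mult_cnj) auto
    then show "integrable M (s n)" by simp
  next
    fix e :: real assume "e > 0"
    then obtain N where N: "\<And>m n. m \<ge> N \<Longrightarrow> n \<ge> N \<Longrightarrow> l2_norm M (\<lambda>x. s m x - s n x) < e / \<mu>"
      using Cauchy[of "e / \<mu>"] \<mu> by auto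
    have "(LINT x|M. norm (s i x - s j x)) < e" if "i \<ge> N" "j \<ge> N" for i j
      using L1[OF L2_diff[OF s s], of i j] N[OF that] \<mu> by (auto simp: pos_less_divide_eq)
    then show "\<exists>N. \<forall>i\<ge>N. \<forall>j\<ge>N. (LINT x|M. norm (s i x - s j x)) < e" by blast
  qed blast
  define g where "g x = lim (\<lambda>k. s (r k) x)" for x
  have sm [measurable]: "s n \<in> borel_measurable M" for n using s by (rule L2_measurable)
  have gm [measurable]: "g \<in> borel_measurable M" unfolding g_def by measurable
  have lim: "AE x in M. (\<lambda>k. s (r k) x) \<longlonglongrightarrow> g x"
    using ae by eventually_elim (auto simp: g_def Cauchy_convergent_iff convergent_LIMSEQ_iff)
  have bound: "(\<integral>\<^sup>+x. ennreal ((cmod (g x - s n x))\<^sup>2) \<partial>M) \<le> ennreal (\<epsilon>\<^sup>2)"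
    if "\<epsilon> > 0" "\<And>m. m \<ge> N \<Longrightarrow> l2_norm M (\<lambda>x. s m x - s n x) < \<epsilon>" for \<epsilon> N n
  proof -
    have "(\<integral>\<^sup>+x. ennreal ((cmod (g x - s n x))\<^sup>2) \<partial>M)
        = (\<integral>\<^sup>+x. liminf (\<lambda>k. ennreal ((cmod (s (r k) x - s n x))\<^sup>2)) \<partial>M)"
    proof (rule nn_integral_cong_AE, use lim in eventually_elim)
      fix x assume "(\<lambda>k. s (r k) x) \<longlonglongrightarrow> g x"
      then have "(\<lambda>k. ennreal ((cmod (s (r k) x - s n x))\<^sup>2)) \<longlonglongrightarrow> ennreal ((cmod (g x - s n x))\<^sup>2)"
        by (intro tendsto_intros)
      then show "ennreal ((cmod (g x - s n x))\<^sup>2) = liminf (\<lambda>k. ennreal ((cmod (s (r k) x - s n x))\<^sup>2))"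
        by (intro lim_imp_Liminf[symmetric]) simp
    qed
    also have "\<dots> \<le> liminf (\<lambda>k. \<integral>\<^sup>+x. ennreal ((cmod (s (r k) x - s n x))\<^sup>2) \<partial>M)"
      by (intro nn_integral_liminf) measurable
    also have "\<dots> \<le> ennreal (\<epsilon>\<^sup>2)"
    proof (rule Liminf_le)
      show "\<forall>\<^sub>F k in sequentially. (\<integral>\<^sup>+x. ennreal ((cmod (s (r k) x - s n x))\<^sup>2) \<partial>M) \<le> ennreal (\<epsilon>\<^sup>2)"
        using eventually_ge_at_top[of N]
      proof eventually_elim
        fix k assume "k \<ge> N"
        then have "r k \<ge> N" using r by (meson le_trans seq_suble)
        have "(\<integral>\<^sup>+x. ennreal ((cmod (s (r k) x - s n x))\<^sup>2) \<partial>M)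
            = ennreal (LINT x|M. (cmod (s (r k) x - s n x))\<^sup>2)"
          using L2_integrable_square[OF L2_diff[OF s s]] by (intro nn_integral_eq_integral) auto
        also have "\<dots> = ennreal ((l2_norm M (\<lambda>x. s (r k) x - s n x))\<^sup>2)"
          by (simp add: l2_norm_square)
        also have "\<dots> \<le> ennreal (\<epsilon>\<^sup>2)"
          using that(2)[OF \<open>r k \<ge> N\<close>] by (intro ennreal_leI power_mono) auto
        finally show "(\<integral>\<^sup>+x. ennreal ((cmod (s (r k) x - s n x))\<^sup>2) \<partial>M) \<le> ennreal (\<epsilon>\<^sup>2)" .
      qed
    qed simp
    finally show ?thesis .
  qed
  have diff: "(\<lambda>x. g x - s n x) \<in> L2 M \<and> l2_norm M (\<lambda>x. g x - s n x) \<le> \<epsilon>"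
    if "\<epsilon> > 0" "\<And>m. m \<ge> N \<Longrightarrow> l2_norm M (\<lambda>x. s m x - s n x) < \<epsilon>" for \<epsilon> N n
  proof -
    have int: "integrable M (\<lambda>x. (cmod (g x - s n x))\<^sup>2)"
      unfolding integrable_iff_bounded
      using le_less_trans[OF bound[OF that] ennreal_less_top] by simp
    have "ennreal (LINT x|M. (cmod (g x - s n x))\<^sup>2) \<le> ennreal (\<epsilon>\<^sup>2)"
      using bound[OF that] by (subst nn_integral_eq_integral[OF int, symmetric]) auto
    then have "(l2_norm M (\<lambda>x. g x - s n x))\<^sup>2 \<le> \<epsilon>\<^sup>2"
      unfolding l2_norm_square by (simp add: ennreal_le_iff)
    then have "l2_norm M (\<lambda>x. g x - s n x) \<le> \<epsilon>"
      using that(1) by (meson less_imp_le power2_le_imp_le)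
    with int show ?thesis by (auto simp: L2_def)
  qed
  obtain N where "\<And>m. m \<ge> N \<Longrightarrow> l2_norm M (\<lambda>x. s m x - s N x) < 1"
    using Cauchy[of 1] by auto
  then have "(\<lambda>x. g x - s N x) \<in> L2 M" using diff[of 1 N N] by auto
  then have "(\<lambda>x. (g x - s N x) + s N x) \<in> L2 M" using s by (intro L2_add)
  then have "g \<in> L2 M" by simp
  moreover have "(\<lambda>n. l2_norm M (\<lambda>x. g x - s n x)) \<longlonglongrightarrow> 0"
  proof (rule LIMSEQ_I)
    fix e :: real assume "e > 0"
    then obtain N where "\<And>m n. m \<ge> N \<Longrightarrow> n \<ge> N \<Longrightarrow> l2_norm M (\<lambda>x. s m x - s n x) < e / 2"
      using Cauchy[of "e / 2"] by auto
    then have "l2_norm M (\<lambda>x. g x - s n x) \<le> e / 2" if "n \<ge> N" for n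
      using diff[of "e / 2" N n] that \<open>e > 0\<close> by auto
    then show "\<exists>N. \<forall>n\<ge>N. norm (l2_norm M (\<lambda>x. g x - s n x) - 0) < e"
      using \<open>e > 0\<close> by (intro exI[of _ N]) fastforce
  qed
  ultimately show ?thesis by blast
qed

lemma l2_inner_tendsto:
  assumes "\<And>n. s n \<in> L2 M" "g \<in> L2 M" "h \<in> L2 M" "(\<lambda>n. l2_norm M (\<lambda>x. g x - s n x)) \<longlonglongrightarrow> 0"
  shows "(\<lambda>n. l2_inner M (s n) h) \<longlonglongrightarrow> l2_inner M g h"
proof -
  have "(\<lambda>n. l2_inner M g h - l2_inner M (s n) h) \<longlonglongrightarrow> 0"
  proof (rule Lim_null_comparison)
    show "\<forall>\<^sub>F n in sequentially. norm (l2_inner M g h - l2_inner M (s n) h)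
        \<le> l2_norm M (\<lambda>x. g x - s n x) * l2_norm M h"
      using l2_Cauchy_Schwarz[OF L2_diff[OF assms(2,1)] assms(3)] assms(1-3)
      by (auto simp: l2_inner_diff_left)
    show "(\<lambda>n. l2_norm M (\<lambda>x. g x - s n x) * l2_norm M h) \<longlonglongrightarrow> 0"
      using tendsto_mult[OF assms(4) tendsto_const[of "l2_norm M h"]] by simp
  qed
  from tendsto_diff[OF tendsto_const[of "l2_inner M g h"] this] show ?thesis by simp
qed

section \<open>Orthonormal bases and Fourier expansions\<close>

locale l2_orthonormal_basis =
  fixes M :: "'a measure" and e :: "nat \<Rightarrow> 'a \<Rightarrow> complex"
  assumes finite_M: "finite_measure M"
    and basis_L2 [simp, intro]: "e i \<in> L2 M"
    and orthonormal: "l2_inner M (e i) (e j) = (if i = j then 1 else 0)"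
    and total: "f \<in> L2 M \<Longrightarrow> (\<And>i. l2_inner M f (e i) = 0) \<Longrightarrow> ae_eq M f (\<lambda>_. 0)"
begin

abbreviation coeff :: "('a \<Rightarrow> complex) \<Rightarrow> nat \<Rightarrow> complex" where
  "coeff f i \<equiv> l2_inner M f (e i)"

lemma ae_eqI_coeff:
  assumes "f \<in> L2 M" "g \<in> L2 M" "\<And>i. coeff f i = coeff g i"
  shows "ae_eq M f g"
  using total[of "\<lambda>x. f x - g x"] assms by (auto simp: l2_inner_diff_left ae_eq_def)

lemma basis_sum_L2 [intro]: "(\<lambda>x. \<Sum>i\<in>I. c i * e i x) \<in> L2 M"
  by (intro L2_sum L2_cmult) auto

lemma norm_square_basis_sum:
  "finite I \<Longrightarrow> (l2_norm M (\<lambda>x. \<Sum>i\<in>I. c i * e i x))\<^sup>2 = (\<Sum>i\<in>I. (cmod (c i))\<^sup>2)"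
proof -
  assume I: "finite I"
  have "l2_inner M (\<lambda>x. \<Sum>i\<in>I. c i * e i x) (\<lambda>x. \<Sum>i\<in>I. c i * e i x) = (\<Sum>i\<in>I. c i * cnj (c i))"
    using I by (simp add: l2_inner_sum_left l2_inner_sum_right L2_sum L2_cmult l2_inner_cmult_left
        l2_inner_cmult_right orthonormal if_distrib cong: if_cong)
  then have "complex_of_real ((l2_norm M (\<lambda>x. \<Sum>i\<in>I. c i * e i x))\<^sup>2) = of_real (\<Sum>i\<in>I. (cmod (c i))\<^sup>2)"
    unfolding l2_inner_self of_real_sum complex_norm_square .
  then show ?thesis unfolding of_real_eq_iff .
qed

lemma Bessel:
  assumes "f \<in> L2 M" "finite I"
  shows "(\<Sum>i\<in>I. (cmod (coeff f i))\<^sup>2) \<le> (l2_norm M f)\<^sup>2"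
proof -
  define p where "p = (\<lambda>x. \<Sum>i\<in>I. coeff f i * e i x)"
  have p: "p \<in> L2 M" unfolding p_def by (rule basis_sum_L2)
  have fp: "l2_inner M f p = of_real (\<Sum>i\<in>I. (cmod (coeff f i))\<^sup>2)"
  proof -
    have "l2_inner M f p = (\<Sum>i\<in>I. cnj (coeff f i) * coeff f i)"
      unfolding p_def using assms by (simp add: l2_inner_sum_right L2_cmult l2_inner_cmult_right)
    then show ?thesis unfolding of_real_sum complex_norm_square by (simp only: mult.commute)
  qed
  have pp: "l2_inner M p p = of_real (\<Sum>i\<in>I. (cmod (coeff f i))\<^sup>2)"
    unfolding l2_inner_self unfolding p_def norm_square_basis_sum[OF assms(2)] ..
  have "l2_inner M (\<lambda>x. f x - p x) (\<lambda>x. f x - p x) =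
      of_real ((l2_norm M f)\<^sup>2 - (\<Sum>i\<in>I. (cmod (coeff f i))\<^sup>2))"
    using assms p fp pp
    by (simp add: l2_sesquilinear l2_inner_commute[of M p f] l2_inner_self[symmetric] del: of_real_power)
  then show ?thesis
    unfolding l2_inner_self of_real_eq_iff by (smt (verit) zero_le_power2)
qed

lemma summable_coeff: "f \<in> L2 M \<Longrightarrow> summable (\<lambda>i. (cmod (coeff f i))\<^sup>2)"
  by (rule bounded_imp_summable[of _ "(l2_norm M f)\<^sup>2"]) (auto intro: Bessel)

text \<open>The partial sums are Cauchy because their differences are finite blocks of the series of
  squares. Convergence in norm belongs to the conclusion since \<open>Parseval\<close> passes to the
  limit inside inner products.\<close>

lemma Riesz_Fischer:
  assumes "summable (\<lambda>i. (cmod (c i))\<^sup>2)"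
  obtains g where "g \<in> L2 M" "\<And>i. coeff g i = c i"
    "(\<lambda>N. l2_norm M (\<lambda>x. g x - (\<Sum>i<N. c i * e i x))) \<longlonglongrightarrow> 0"
proof -
  define s where "s N = (\<lambda>x. \<Sum>i<N. c i * e i x)" for N
  have s: "s N \<in> L2 M" for N unfolding s_def by (rule basis_sum_L2)
  have diff: "(l2_norm M (\<lambda>x. s m x - s n x))\<^sup>2 = \<bar>\<Sum>i=n..<m. (cmod (c i))\<^sup>2\<bar>" if "n \<le> m" for m n
  proof -
    have "(\<lambda>x. s m x - s n x) = (\<lambda>x. \<Sum>i=n..<m. c i * e i x)"
      using that by (auto simp: s_def fun_eq_iff lessThan_atLeast0 sum_diff_nat_ivl)
    then show ?thesis by (simp add: norm_square_basis_sum sum_nonneg)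
  qed
  have sym: "l2_norm M (\<lambda>x. s m x - s n x) = l2_norm M (\<lambda>x. s n x - s m x)" for m n
    by (simp add: l2_norm_def norm_minus_commute)
  have "\<exists>g\<in>L2 M. (\<lambda>n. l2_norm M (\<lambda>x. g x - s n x)) \<longlonglongrightarrow> 0"
  proof (rule L2_complete[OF finite_M s])
    fix \<epsilon> :: real assume "\<epsilon> > 0"
    then obtain N where N: "\<And>m n. m \<ge> N \<Longrightarrow> norm (\<Sum>i=m..<n. (cmod (c i))\<^sup>2) < \<epsilon>\<^sup>2"
      using assms unfolding summable_Cauchy by (meson zero_less_power)
    have "l2_norm M (\<lambda>x. s m x - s n x) < \<epsilon>" if "n \<ge> N" "n \<le> m" for m n
    proof -
      have "(l2_norm M (\<lambda>x. s m x - s n x))\<^sup>2 < \<epsilon>\<^sup>2"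
        using N[OF that(1)] diff[OF that(2)] by simp
      then show ?thesis using \<open>\<epsilon> > 0\<close> by (meson less_imp_le power2_less_imp_less)
    qed
    then show "\<exists>N. \<forall>m\<ge>N. \<forall>n\<ge>N. l2_norm M (\<lambda>x. s m x - s n x) < \<epsilon>"
      by (metis nle_le sym)
  qed
  then obtain g where g: "g \<in> L2 M" "(\<lambda>n. l2_norm M (\<lambda>x. g x - s n x)) \<longlonglongrightarrow> 0" by blast
  have "coeff g i = c i" for i
  proof -
    have "coeff (s N) i = c i" if "N > i" for N
      using that by (simp add: s_def l2_inner_sum_left L2_cmult l2_inner_cmult_left orthonormal
          if_distrib cong: if_cong)
    then have "(\<lambda>N. coeff (s N) i) \<longlonglongrightarrow> c i"
      by (intro tendsto_eventually) (auto simp: eventually_at_top_dense)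
    moreover have "(\<lambda>N. coeff (s N) i) \<longlonglongrightarrow> coeff g i"
      using s g by (intro l2_inner_tendsto) auto
    ultimately show ?thesis using LIMSEQ_unique by blast
  qed
  then show ?thesis using that g unfolding s_def by blast
qed

text \<open>\<open>Riesz_Fischer\<close> sums the expansion of \<open>f\<close> to some
  \<open>g\<close> with the same coefficients, totality identifies \<open>g\<close> with
  \<open>f\<close>, and the inner product with \<open>h\<close> is continuous in norm.\<close>

lemma Parseval:
  assumes f: "f \<in> L2 M" and h: "h \<in> L2 M"
  shows "(\<lambda>i. coeff f i * cnj (coeff h i)) sums l2_inner M f h"
proof -
  obtain g where g: "g \<in> L2 M" "\<And>i. coeff g i = coeff f i"
    and lim: "(\<lambda>N. l2_norm M (\<lambda>x. g x - (\<Sum>i<N. coeff f i * e i x))) \<longlonglongrightarrow> 0"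
    using Riesz_Fischer[OF summable_coeff[OF f]] by blast
  have "(\<lambda>N. l2_inner M (\<lambda>x. \<Sum>i<N. coeff f i * e i x) h) \<longlonglongrightarrow> l2_inner M g h"
    using g h lim by (intro l2_inner_tendsto basis_sum_L2) auto
  moreover have "l2_inner M (\<lambda>x. \<Sum>i<N. coeff f i * e i x) h = (\<Sum>i<N. coeff f i * cnj (coeff h i))" for N
    using h by (subst l2_inner_commute)
      (simp add: l2_inner_sum_right L2_cmult l2_inner_cmult_right)
  moreover have "l2_inner M g h = l2_inner M f h"
    by (rule l2_inner_cong_left[OF ae_eqI_coeff[OF g(1) f g(2)] g(1) f h h])
  ultimately show ?thesis by (simp add: sums_def)
qed

end

section \<open>Spectral measures and eigenvectors\<close>

lemma L2_ae_eq_0_iff_norm: "f \<in> L2 M \<Longrightarrow> ae_eq M f (\<lambda>_. 0) \<longleftrightarrow> l2_norm M f = 0"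
  using l2_inner_self_eq_0[of f M] l2_inner_cong[of M f "\<lambda>_. 0" f "\<lambda>_. 0"]
  by (auto simp: l2_inner_self l2_norm_def)

lemma l2_norm_cong:
  assumes "ae_eq M f g" "f \<in> L2 M" "g \<in> L2 M"
  shows "l2_norm M f = l2_norm M g"
proof -
  have "l2_inner M f f = l2_inner M g g" using assms by (intro l2_inner_cong) auto
  then have "(l2_norm M f)\<^sup>2 = (l2_norm M g)\<^sup>2" unfolding l2_inner_self of_real_eq_iff .
  then show ?thesis by simp
qed

text \<open>All structure of the graph, such as closure under sums and under changes on null sets,
  is derived from this test, since \<open>self_adjoint\<close> asks for nothing beyond density and
  the adjoint equation.\<close>

lemma self_adjoint_graph_iff:
  assumes "self_adjoint M H"
  shows "(g, h) \<in> H \<longleftrightarrow> g \<in> L2 M \<and> h \<in> L2 M \<and> (\<forall>(f, f')\<in>H. l2_inner M f' g = l2_inner M f h)"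
proof -
  have "(g, h) \<in> H \<longleftrightarrow> (g, h) \<in> adjoint_graph M H" using assms by (simp add: self_adjoint_def)
  then show ?thesis by (simp add: adjoint_graph_def)
qed

lemma self_adjoint_L2:
  assumes "self_adjoint M H" "(f, g) \<in> H"
  shows "f \<in> L2 M" "g \<in> L2 M"
  using assms(2) by (auto simp: self_adjoint_graph_iff[OF assms(1)])

lemma self_adjoint_symmetric:
  assumes "self_adjoint M H" "(f, f') \<in> H" "(g, g') \<in> H"
  shows "l2_inner M f' g = l2_inner M f g'"
  using assms(2) iffD1[OF self_adjoint_graph_iff[OF assms(1)] assms(3)] by auto

lemma self_adjoint_graph_add:
  assumes "self_adjoint M H" "(f, f') \<in> H" "(g, g') \<in> H"
  shows "(\<lambda>x. f x + g x, \<lambda>x. f' x + g' x) \<in> H"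
  unfolding self_adjoint_graph_iff[OF assms(1)]
proof (intro conjI ballI, safe)
  note L = self_adjoint_L2[OF assms(1)]
  show "(\<lambda>x. f x + g x) \<in> L2 M" "(\<lambda>x. f' x + g' x) \<in> L2 M"
    using L assms(2,3) by auto
  fix u u' assume u: "(u, u') \<in> H"
  show "l2_inner M u' (\<lambda>x. f x + g x) = l2_inner M u (\<lambda>x. f' x + g' x)"
    using L[OF u] L[OF assms(2)] L[OF assms(3)]
    by (simp add: l2_inner_add_right self_adjoint_symmetric[OF assms(1) u assms(2)]
        self_adjoint_symmetric[OF assms(1) u assms(3)])
qed

lemma self_adjoint_graph_cong:
  assumes "self_adjoint M H" "(f, f') \<in> H" "ae_eq M f g" "ae_eq M f' g'" "g \<in> L2 M" "g' \<in> L2 M"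
  shows "(g, g') \<in> H"
  unfolding self_adjoint_graph_iff[OF assms(1)]
proof (intro conjI ballI, safe)
  fix u u' assume u: "(u, u') \<in> H"
  have "l2_inner M u' g = l2_inner M u' f"
    using self_adjoint_L2[OF assms(1)] u assms by (intro l2_inner_cong_right) (auto intro: ae_eq_sym)
  also have "\<dots> = l2_inner M u f'" by (rule self_adjoint_symmetric[OF assms(1) u assms(2)])
  also have "\<dots> = l2_inner M u g'"
    using self_adjoint_L2[OF assms(1)] u assms by (intro l2_inner_cong_right) auto
  finally show "l2_inner M u' g = l2_inner M u g'" .
qed (use assms in auto)

text \<open>A nonzero \<open>h\<close> is at distance at least its own norm from every vector
  orthogonal to it, which contradicts density.\<close>

lemma orthogonal_to_dense:
  assumes "densely_defined M A" "Domain A \<subseteq> L2 M" "h \<in> L2 M"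
    and orth: "\<And>u. u \<in> Domain A \<Longrightarrow> l2_inner M u h = 0"
  shows "ae_eq M h (\<lambda>_. 0)"
proof (rule ccontr)
  assume "\<not> ae_eq M h (\<lambda>_. 0)"
  then have pos: "l2_norm M h > 0"
    using assms(3) by (simp add: L2_ae_eq_0_iff_norm less_le)
  then obtain u where u: "u \<in> Domain A" "l2_norm M (\<lambda>x. h x - u x) < l2_norm M h"
    using assms unfolding densely_defined_def by blast
  have uL: "u \<in> L2 M" using u assms(2) by auto
  have "of_real ((l2_norm M h)\<^sup>2) = l2_inner M (\<lambda>x. h x - u x) h"
    using assms(3) uL orth[OF u(1)] by (simp add: l2_inner_diff_left l2_inner_self)
  then have "(l2_norm M h)\<^sup>2 = cmod (l2_inner M (\<lambda>x. h x - u x) h)"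
    by (metis abs_of_nonneg norm_of_real zero_le_power2)
  also have "\<dots> \<le> l2_norm M (\<lambda>x. h x - u x) * l2_norm M h"
    using assms(3) uL by (intro l2_Cauchy_Schwarz) auto
  also have "\<dots> < l2_norm M h * l2_norm M h"
    using u(2) pos by simp
  finally show False by (simp add: power2_eq_square)
qed

lemma self_adjoint_single_valued:
  assumes "self_adjoint M H" "(f, g) \<in> H" "(f, g') \<in> H"
  shows "ae_eq M g g'"
proof -
  note L = self_adjoint_L2[OF assms(1)]
  have "ae_eq M (\<lambda>x. g x - g' x) (\<lambda>_. 0)"
  proof (rule orthogonal_to_dense)
    show "densely_defined M H" using assms(1) by (simp add: self_adjoint_def)
    show "Domain H \<subseteq> L2 M" using L by auto
    show "(\<lambda>x. g x - g' x) \<in> L2 M" using L assms by auto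
    fix u assume "u \<in> Domain H"
    then obtain u' where u: "(u, u') \<in> H" by auto
    show "l2_inner M u (\<lambda>x. g x - g' x) = 0"
      using self_adjoint_symmetric[OF assms(1) u assms(2)] self_adjoint_symmetric[OF assms(1) u assms(3)]
        L assms u by (simp add: l2_inner_diff_right)
  qed
  then show ?thesis by (simp add: ae_eq_def)
qed

section \<open>Orthogonal projections\<close>

context
  fixes M :: "'a measure" and P
  assumes P: "orthogonal_projection M P"
begin

lemma proj_L2 [intro]: "f \<in> L2 M \<Longrightarrow> P f \<in> L2 M"
  using P by (auto simp: orthogonal_projection_def L2_operator_def)

lemma proj_cong: "ae_eq M f g \<Longrightarrow> f \<in> L2 M \<Longrightarrow> g \<in> L2 M \<Longrightarrow> ae_eq M (P f) (P g)"
  using P by (auto simp: orthogonal_projection_def L2_operator_def)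

lemma proj_idem: "f \<in> L2 M \<Longrightarrow> ae_eq M (P (P f)) (P f)"
  using P by (auto simp: orthogonal_projection_def)

lemma proj_symmetric: "f \<in> L2 M \<Longrightarrow> g \<in> L2 M \<Longrightarrow> l2_inner M (P f) g = l2_inner M f (P g)"
  using P by (auto simp: orthogonal_projection_def)

lemma proj_inner_self:
  assumes "f \<in> L2 M"
  shows "l2_inner M (P f) f = of_real ((l2_norm M (P f))\<^sup>2)"
proof -
  have "l2_inner M (P f) f = l2_inner M (P (P f)) f"
    using assms by (intro l2_inner_cong_left ae_eq_sym[OF proj_idem]) auto
  also have "\<dots> = l2_inner M (P f) (P f)"
    using assms by (intro proj_symmetric) auto
  finally show ?thesis by (simp add: l2_inner_self)
qed

lemma norm_diff_proj:
  assumes "f \<in> L2 M"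
  shows "(l2_norm M (\<lambda>x. f x - P f x))\<^sup>2 = (l2_norm M f)\<^sup>2 - (l2_norm M (P f))\<^sup>2"
proof -
  have "l2_inner M f (P f) = l2_inner M (P f) f" using proj_symmetric[OF assms assms] by simp
  then have "l2_inner M (\<lambda>x. f x - P f x) (\<lambda>x. f x - P f x)
      = of_real ((l2_norm M f)\<^sup>2 - (l2_norm M (P f))\<^sup>2)"
    using assms proj_inner_self[OF assms] by (simp add: l2_sesquilinear proj_L2 l2_inner_self[of M f] l2_inner_self[of M "P f"])
  then show ?thesis unfolding l2_inner_self of_real_eq_iff .
qed

text \<open>Pythagoras in the form of \<open>norm_diff_proj\<close>. This is the device that turns
  equalities of spectral masses into identities between vectors.\<close>

lemma proj_eqI:
  assumes "f \<in> L2 M" "l2_norm M (P f) \<ge> l2_norm M f"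
  shows "ae_eq M (P f) f"
proof -
  have "(l2_norm M (\<lambda>x. f x - P f x))\<^sup>2 \<le> 0"
    unfolding norm_diff_proj[OF assms(1)] using assms(2) by (simp add: power_mono)
  then have "ae_eq M (\<lambda>x. f x - P f x) (\<lambda>_. 0)"
    using assms(1) proj_L2 by (subst L2_ae_eq_0_iff_norm) (auto simp: L2_diff)
  then show ?thesis by (auto simp: ae_eq_def)
qed

end

lemma integrable_of_integrable_square:
  fixes N :: "real measure"
  assumes "finite_measure N" "sets N = sets borel" "integrable N (\<lambda>t. t\<^sup>2)"
  shows "integrable N (\<lambda>t. t)"
proof (rule Bochner_Integration.integrable_bound)
  show "integrable N (\<lambda>t. 1 + t\<^sup>2)"
    using assms by (auto intro: finite_measure.integrable_const)
  have "\<bar>t\<bar> \<le> 1 + t\<^sup>2" for t :: real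
    using zero_le_power2[of "\<bar>t\<bar> - 1"] by (simp add: power2_diff abs_if split: if_splits)
  then show "AE t in N. norm t \<le> norm (1 + t\<^sup>2)" by auto
qed (simp add: measurable_ident_sets assms)

section \<open>Calculus of a projection-valued measure\<close>

locale spectral_measure =
  fixes M :: "'a measure" and E :: "real set \<Rightarrow> ('a \<Rightarrow> complex) \<Rightarrow> ('a \<Rightarrow> complex)"
  assumes pvm: "projection_valued_measure M E"
begin

abbreviation "\<nu> \<equiv> spectral_distribution M E"

lemma proj: "A \<in> sets borel \<Longrightarrow> orthogonal_projection M (E A)"
  using pvm by (auto simp: projection_valued_measure_def)

lemmas E_L2 [intro] = proj_L2[OF proj]

lemma E_UNIV: "f \<in> L2 M \<Longrightarrow> ae_eq M (E UNIV f) f"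
  using pvm by (auto simp: projection_valued_measure_def)

lemma E_sums:
  assumes "f \<in> L2 M" "range A \<subseteq> sets borel" "disjoint_family A"
  shows "(\<lambda>n::nat. (l2_norm M (E (A n) f))\<^sup>2) sums (l2_norm M (E (\<Union>n. A n) f))\<^sup>2"
proof -
  have "(\<lambda>n::nat. l2_inner M (E (A n) f) f) sums l2_inner M (E (\<Union>n. A n) f) f"
    using pvm assms by (auto simp: projection_valued_measure_def)
  moreover have "A n \<in> sets borel" "(\<Union>n. A n) \<in> sets borel" for n using assms(2) by auto
  ultimately show ?thesis
    using assms(1) by (simp add: proj_inner_self[OF proj] sums_of_real_iff del: of_real_power)
qed

text \<open>\<open>measure_of\<close> yields the zero measure unless the given set function is a
  measure, so countable additivity must be verified before \<open>\<nu> f\<close> has the intended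
  values.\<close>

lemma emeasure_\<nu>:
  assumes "f \<in> L2 M" "A \<in> sets borel"
  shows "emeasure (\<nu> f) A = ennreal ((l2_norm M (E A f))\<^sup>2)"
proof -
  have Re: "Re (l2_inner M (E A f) f) = (l2_norm M (E A f))\<^sup>2" if "A \<in> sets borel" for A
    using proj_inner_self[OF proj[OF that] assms(1)] by simp
  have "emeasure (\<nu> f) A = ennreal (Re (l2_inner M (E A f) f))"
    unfolding spectral_distribution_def
  proof (rule emeasure_measure_of_sigma)
    show "sigma_algebra UNIV (sets (borel :: real measure))"
      using sets.sigma_algebra_axioms[of "borel :: real measure"] by simp
    \<comment> \<open>The empty set is the disjoint union of countably many copies of itself, so its
      mass is the term of a summable constant series.\<close>
    have "(l2_norm M (E {} f))\<^sup>2 = 0"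
      using E_sums[OF assms(1), of "\<lambda>_. {}"] sums_summable
      by (fastforce simp: disjoint_family_on_def summable_const_iff)
    then show "positive (sets borel) (\<lambda>A. ennreal (Re (l2_inner M (E A f) f)))"
      by (simp add: positive_def Re)
    show "countably_additive (sets borel) (\<lambda>A. ennreal (Re (l2_inner M (E A f) f)))"
    proof (rule countably_additiveI)
      fix A :: "nat \<Rightarrow> real set"
      assume A: "range A \<subseteq> sets borel" "disjoint_family A" "(\<Union>i. A i) \<in> sets borel"
      then have [simp]: "Re (l2_inner M (E (A i) f) f) = (l2_norm M (E (A i) f))\<^sup>2" for i
        by (intro Re) auto
      from E_sums[OF assms(1) A(1,2)]
      show "(\<Sum>i. ennreal (Re (l2_inner M (E (A i) f) f))) = ennreal (Re (l2_inner M (E (\<Union>i. A i) f) f))"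
        by (simp add: Re[OF A(3)] suminf_ennreal2 sums_iff)
    qed
  qed fact
  then show ?thesis by (simp add: Re[OF assms(2)])
qed

lemma sets_\<nu> [simp, measurable_cong]: "sets (\<nu> f) = sets borel"
  by (simp add: spectral_distribution_def sets.sigma_sets_eq[of borel, simplified])

lemma space_\<nu> [simp]: "space (\<nu> f) = UNIV"
  by (simp add: spectral_distribution_def)

lemma finite_measure_\<nu>: "f \<in> L2 M \<Longrightarrow> finite_measure (\<nu> f)"
  by (rule finite_measureI) (simp add: emeasure_\<nu>)

lemma norm_E_UNIV: "f \<in> L2 M \<Longrightarrow> l2_norm M (E UNIV f) = l2_norm M f"
  by (intro l2_norm_cong E_UNIV E_L2) auto

lemma norm_E_mono:
  assumes "f \<in> L2 M" "A \<in> sets borel" "B \<in> sets borel" "A \<subseteq> B"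
  shows "l2_norm M (E A f) \<le> l2_norm M (E B f)"
proof -
  have "emeasure (\<nu> f) A \<le> emeasure (\<nu> f) B" using assms by (intro emeasure_mono) auto
  then have "(l2_norm M (E A f))\<^sup>2 \<le> (l2_norm M (E B f))\<^sup>2"
    using assms by (simp add: emeasure_\<nu> ennreal_le_iff)
  then show ?thesis by (rule power2_le_imp_le) simp
qed

lemma norm_E_disjoint_Un:
  assumes "f \<in> L2 M" "A \<in> sets borel" "B \<in> sets borel" "A \<inter> B = {}"
  shows "(l2_norm M (E (A \<union> B) f))\<^sup>2 = (l2_norm M (E A f))\<^sup>2 + (l2_norm M (E B f))\<^sup>2"
proof -
  have "emeasure (\<nu> f) A + emeasure (\<nu> f) B = emeasure (\<nu> f) (A \<union> B)"
    using assms by (intro plus_emeasure) auto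
  then have "ennreal ((l2_norm M (E A f))\<^sup>2 + (l2_norm M (E B f))\<^sup>2) = ennreal ((l2_norm M (E (A \<union> B) f))\<^sup>2)"
    using assms by (simp add: emeasure_\<nu>)
  then show ?thesis by (subst (asm) ennreal_inj) auto
qed

text \<open>\<open>E A\<close> preserves the norm of \<open>E A f\<close>, so the larger projection
  \<open>E B\<close> cannot decrease it, and \<open>proj_eqI\<close> applies.\<close>

lemma E_mono:
  assumes f: "f \<in> L2 M" and [measurable]: "A \<in> sets borel" "B \<in> sets borel" and "A \<subseteq> B"
  shows "ae_eq M (E B (E A f)) (E A f)"
proof (rule proj_eqI[OF proj])
  have "l2_norm M (E A f) = l2_norm M (E A (E A f))"
    using f by (intro l2_norm_cong ae_eq_sym[OF proj_idem[OF proj]] E_L2) auto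
  also have "\<dots> \<le> l2_norm M (E B (E A f))"
    using assms by (intro norm_E_mono) auto
  finally show "l2_norm M (E B (E A f)) \<ge> l2_norm M (E A f)" .
qed (use f in auto)

text \<open>The adjoint form of \<open>E_mono\<close>: both projections are moved to the other side
  of the inner product.\<close>

lemma E_mono':
  assumes f: "f \<in> L2 M" and [measurable]: "A \<in> sets borel" "B \<in> sets borel" and "A \<subseteq> B"
  shows "ae_eq M (E A (E B f)) (E A f)"
proof (rule ae_eqI_l2_inner)
  fix h assume h: "h \<in> L2 M"
  have "l2_inner M (E A (E B f)) h = l2_inner M f (E B (E A h))"
    using f h by (simp add: proj_symmetric[OF proj] E_L2)
  also have "\<dots> = l2_inner M f (E A h)"
    using f h assms by (intro l2_inner_cong_right E_mono E_L2) auto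
  also have "\<dots> = l2_inner M (E A f) h"
    using f h by (simp add: proj_symmetric[OF proj])
  finally show "l2_inner M (E A (E B f)) h = l2_inner M (E A f) h" .
qed (use f in \<open>auto intro!: E_L2\<close>)

text \<open>\<open>E A\<close> already captures the whole mass of \<open>E A f\<close>; additivity
  on \<open>A \<union> B\<close> leaves none for \<open>E B\<close>.\<close>

lemma E_disjoint:
  assumes f: "f \<in> L2 M" and [measurable]: "A \<in> sets borel" "B \<in> sets borel" and "A \<inter> B = {}"
  shows "ae_eq M (E B (E A f)) (\<lambda>_. 0)"
proof -
  have g: "E A f \<in> L2 M" using f by auto
  have "(l2_norm M (E A (E A f)))\<^sup>2 + (l2_norm M (E B (E A f)))\<^sup>2 = (l2_norm M (E (A \<union> B) (E A f)))\<^sup>2"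
    using assms g by (subst norm_E_disjoint_Un) auto
  also have "\<dots> = (l2_norm M (E A f))\<^sup>2"
    using f g assms by (intro arg_cong[where f="\<lambda>x. x\<^sup>2"] l2_norm_cong E_mono) auto
  also have "\<dots> = (l2_norm M (E A (E A f)))\<^sup>2"
    using f g assms by (intro arg_cong[where f="\<lambda>x. x\<^sup>2"] l2_norm_cong ae_eq_sym[OF E_mono]) auto
  finally have "l2_norm M (E B (E A f)) = 0" by simp
  then show ?thesis using g by (subst L2_ae_eq_0_iff_norm) auto
qed

text \<open>Outside \<open>A\<close> the vector \<open>E A f\<close> has no mass by
  \<open>E_disjoint\<close>, and inside \<open>A\<close> its masses are those of \<open>f\<close> by
  \<open>E_mono'\<close>. Moments of the truncated vector thus become integrals over
  \<open>A\<close>.\<close>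

lemma \<nu>_E:
  assumes f: "f \<in> L2 M" and A: "A \<in> sets borel"
  shows "\<nu> (E A f) = density (\<nu> f) (indicator A)"
proof (rule measure_eqI)
  fix B assume "B \<in> sets (\<nu> (E A f))"
  then have B [measurable]: "B \<in> sets borel" by simp
  note A [measurable]
  have g: "E A f \<in> L2 M" using f A by auto
  have "emeasure (density (\<nu> f) (indicator A)) B = emeasure (\<nu> f) (A \<inter> B)"
    using A by (subst emeasure_density) (auto simp: indicator_inter_arith[symmetric])
  also have "\<dots> = ennreal ((l2_norm M (E (A \<inter> B) (E A f)))\<^sup>2)"
    using f g A B l2_norm_cong[OF E_mono'[of f "A \<inter> B" A]] by (simp add: emeasure_\<nu> E_L2)
  also have "(l2_norm M (E (A \<inter> B) (E A f)))\<^sup>2 = (l2_norm M (E B (E A f)))\<^sup>2"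
  proof -
    have "(l2_norm M (E ((A \<inter> B) \<union> (B - A)) (E A f)))\<^sup>2 =
        (l2_norm M (E (A \<inter> B) (E A f)))\<^sup>2 + (l2_norm M (E (B - A) (E A f)))\<^sup>2"
      using g by (intro norm_E_disjoint_Un) auto
    moreover have "l2_norm M (E (B - A) (E A f)) = 0"
      using E_disjoint[OF f A, of "B - A"] g by (subst L2_ae_eq_0_iff_norm[symmetric]) auto
    moreover have "(A \<inter> B) \<union> (B - A) = B" by auto
    ultimately show ?thesis by simp
  qed
  finally show "emeasure (\<nu> (E A f)) B = emeasure (density (\<nu> f) (indicator A)) B"
    using g by (simp add: emeasure_\<nu>)
qed simp

text \<open>Additivity in the set is only given for quadratic forms. It lifts to vectors because the
  two parts are orthogonal and their squared norms add up to that of \<open>f\<close>, so that the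
  remainder has norm zero.\<close>

lemma E_Compl:
  assumes f: "f \<in> L2 M" and A [measurable]: "A \<in> sets borel"
  shows "ae_eq M (\<lambda>x. E A f x + E (- A) f x) f"
proof -
  let ?g = "\<lambda>x. E A f x + E (- A) f x"
  have [simp]: "E A f \<in> L2 M" "E (- A) f \<in> L2 M" using f by auto
  have "l2_inner M (E A f) (E (- A) f) = l2_inner M (E (- A) (E A f)) f"
    using f by (simp add: proj_symmetric[OF proj])
  also have "\<dots> = l2_inner M (\<lambda>_. 0) f"
    using f by (intro l2_inner_cong_left E_disjoint) auto
  finally have 0: "l2_inner M (E A f) (E (- A) f) = 0" by (simp add: l2_inner_def)
  then have cross: "l2_inner M (E (- A) f) (E A f) = 0" using l2_inner_commute[of M "E (- A) f"] by simp
  have 1: "l2_inner M f (E B f) = of_real ((l2_norm M (E B f))\<^sup>2)" if "B \<in> sets borel" for B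
    using proj_inner_self[OF proj[OF that] f] proj_symmetric[OF proj[OF that] f f] by simp
  have 2: "(l2_norm M f)\<^sup>2 = (l2_norm M (E A f))\<^sup>2 + (l2_norm M (E (- A) f))\<^sup>2"
    using norm_E_disjoint_Un[OF f A, of "- A"] norm_E_UNIV[OF f] by simp
  have "l2_inner M (\<lambda>x. f x - ?g x) (\<lambda>x. f x - ?g x) =
     of_real ((l2_norm M f)\<^sup>2 - (l2_norm M (E A f))\<^sup>2 - (l2_norm M (E (- A) f))\<^sup>2)"
    using f 0 cross by (simp add: l2_sesquilinear 1 l2_inner_self[of M f] l2_inner_self[of M "E A f"]
        l2_inner_self[of M "E (- A) f"] proj_inner_self[OF proj])
  then have "l2_inner M (\<lambda>x. f x - ?g x) (\<lambda>x. f x - ?g x) = 0" unfolding 2 by simp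
  then have "ae_eq M (\<lambda>x. f x - ?g x) (\<lambda>_. 0)"
    using f by (intro l2_inner_self_eq_0) (auto intro!: L2_diff L2_add)
  then show ?thesis by (auto simp: ae_eq_def)
qed

end

text \<open>
  The quadratic form alone forces the spectral distribution \<open>\<nu> f\<close> of an eigenvector \<open>f\<close> to be
  concentrated at the eigenvalue \<open>\<mu>\<close>: for $f = f_1 + f_2$ with $f_1 = E(\mu,\infty)f$ and
  $f_2 = E(-\infty,\mu]f$, the equation $(H-\mu)f_1 = -(H-\mu)f_2$ and the symmetry of $H$ give
  $\langle (H-\mu)f_1,f_1\rangle = \langle (H-\mu)f_2,f_2\rangle$, where the left-hand side is
  nonnegative and the right-hand side is nonpositive.
\<close>

lemma spectral_resolution_eigenvector:
  assumes H: "self_adjoint M H" and res: "spectral_resolution M H E"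
    and eig: "(f, \<lambda>x. of_real \<mu> * f x) \<in> H" and A: "A \<in> sets borel"
  shows "ae_eq M (E A f) (\<lambda>x. indicator A \<mu> * f x)"
proof -
  interpret spectral_measure M E
    using res by unfold_locales (simp add: spectral_resolution_def)
  note L = self_adjoint_L2[OF H]
  have f: "f \<in> L2 M" using L eig by blast
  interpret \<nu>f: finite_measure "\<nu> f" using f by (rule finite_measure_\<nu>)
  have f2: "integrable (\<nu> f) (\<lambda>t. t\<^sup>2)"
    using res eig by (auto simp: spectral_resolution_def)
  have f1: "integrable (\<nu> f) (\<lambda>t. t)"
    by (rule integrable_of_integrable_square[OF \<nu>f.finite_measure_axioms sets_\<nu> f2])
  \<comment> \<open>\<open>E T f\<close> stays in the domain because its distribution is
    \<open>\<nu> f\<close> cut down to \<open>T\<close>; the same description turns the form of H -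
    \<mu> on it into an integral over \<open>T\<close>.\<close>
  have part: "\<exists>h. (E T f, h) \<in> H \<and> l2_inner M (\<lambda>x. h x - of_real \<mu> * E T f x) (E T f)
      = of_real (LINT t|\<nu> f. indicator T t * (t - \<mu>))"
    if T [measurable]: "T \<in> sets borel" for T
  proof -
    have g: "E T f \<in> L2 M" using f by auto
    have eq: "density (\<nu> f) (indicator T) = density (\<nu> f) (\<lambda>t. ennreal (indicator T t))"
      by (rule density_cong) (auto simp: indicator_def)
    have int: "integrable (\<nu> f) (\<lambda>t. indicator T t * h t)" if "integrable (\<nu> f) h" for h :: "real \<Rightarrow> real"
      using integrable_mult_indicator[OF _ that, of T] by simp
    have "integrable (\<nu> (E T f)) (\<lambda>t. t\<^sup>2)"
      unfolding \<nu>_E[OF f T] eq using int[OF f2] by (subst integrable_density) auto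
    then have "E T f \<in> Domain H" using res g by (auto simp: spectral_resolution_def)
    then obtain h where h: "(E T f, h) \<in> H" by auto
    have "l2_inner M h (E T f) = of_real (LINT t|\<nu> (E T f). t)"
      using res h by (auto simp: spectral_resolution_def)
    also have "(LINT t|\<nu> (E T f). t) = (LINT t|\<nu> f. indicator T t * t)"
      unfolding \<nu>_E[OF f T] eq by (subst integral_density) auto
    finally have *: "l2_inner M h (E T f) = of_real (LINT t|\<nu> f. indicator T t * t)" .
    have "l2_inner M (E T f) (E T f) = of_real (measure (\<nu> f) T)"
      using emeasure_\<nu>[OF f T] by (simp add: l2_inner_self measure_def)
    then have "l2_inner M (\<lambda>x. h x - of_real \<mu> * E T f x) (E T f)
      = of_real ((LINT t|\<nu> f. indicator T t * t) - \<mu> * measure (\<nu> f) T)"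
      using g L(2)[OF h] * by (simp add: l2_sesquilinear)
    also have "(LINT t|\<nu> f. indicator T t * t) - \<mu> * measure (\<nu> f) T = (LINT t|\<nu> f. indicator T t * (t - \<mu>))"
      using int[OF f1] by (simp add: right_diff_distrib mult.commute[of _ \<mu>] emeasure_\<nu>[OF f T])
    finally show ?thesis using h by blast
  qed
  define T where "T = {\<mu><..}"
  have T [measurable]: "T \<in> sets borel" by (simp add: T_def)
  obtain h1 where h1: "(E T f, h1) \<in> H"
    and q1: "l2_inner M (\<lambda>x. h1 x - of_real \<mu> * E T f x) (E T f) = of_real (LINT t|\<nu> f. indicator T t * (t - \<mu>))"
    using part[of T] by auto
  obtain h2 where h2: "(E (- T) f, h2) \<in> H"
    and q2: "l2_inner M (\<lambda>x. h2 x - of_real \<mu> * E (- T) f x) (E (- T) f) = of_real (LINT t|\<nu> f. indicator (- T) t * (t - \<mu>))"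
    using part[of "- T"] by auto
  have L': "E T f \<in> L2 M" "E (- T) f \<in> L2 M" "h1 \<in> L2 M" "h2 \<in> L2 M"
    using L h1 h2 by auto
  have "(\<lambda>x. E T f x + E (- T) f x, \<lambda>x. h1 x + h2 x) \<in> H"
    by (rule self_adjoint_graph_add[OF H h1 h2])
  then have "(f, \<lambda>x. h1 x + h2 x) \<in> H"
    by (rule self_adjoint_graph_cong[OF H _ E_Compl]) (use f L' in auto)
  then have "ae_eq M (\<lambda>x. h1 x + h2 x) (\<lambda>x. of_real \<mu> * f x)"
    by (rule self_adjoint_single_valued[OF H _ eig])
  then have k: "ae_eq M (\<lambda>x. h2 x - of_real \<mu> * E (- T) f x) (\<lambda>x. (-1) * (h1 x - of_real \<mu> * E T f x))"
    using E_Compl[OF f T] unfolding ae_eq_def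
    by eventually_elim algebra
  have k1: "(\<lambda>x. h1 x - of_real \<mu> * E T f x) \<in> L2 M" "(\<lambda>x. h2 x - of_real \<mu> * E (- T) f x) \<in> L2 M"
    using L' by auto
  have "l2_inner M (E T f) (E (- T) f) = l2_inner M (E (- T) (E T f)) f"
    using f L' by (simp add: proj_symmetric[OF proj])
  also have "\<dots> = l2_inner M (\<lambda>_. 0) f"
    using f L' by (intro l2_inner_cong_left E_disjoint) auto
  finally have orth: "l2_inner M (E T f) (E (- T) f) = 0" by (simp add: l2_inner_def)
  have km: "(\<lambda>x. (-1) * (h1 x - of_real \<mu> * E T f x)) \<in> L2 M"
    using k1(1) by (rule L2_cmult)
  have "l2_inner M (\<lambda>x. h2 x - of_real \<mu> * E (- T) f x) (E (- T) f)
      = l2_inner M (\<lambda>x. (-1) * (h1 x - of_real \<mu> * E T f x)) (E (- T) f)"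
    using k1 km L' by (intro l2_inner_cong_left[OF k])
  also have "\<dots> = (-1) * l2_inner M (\<lambda>x. h1 x - of_real \<mu> * E T f x) (E (- T) f)"
    by (rule l2_inner_cmult_left)
  also have "\<dots> = - l2_inner M h1 (E (- T) f)"
    using L' orth by (simp add: l2_inner_diff_left l2_inner_cmult_left L2_cmult)
  also have "\<dots> = - l2_inner M (E T f) h2"
    by (simp add: self_adjoint_symmetric[OF H h1 h2])
  also have "\<dots> = - l2_inner M (E T f) (\<lambda>x. h2 x - of_real \<mu> * E (- T) f x)"
    using L' orth by (simp add: l2_inner_diff_right l2_inner_cmult_right L2_cmult)
  also have "l2_inner M (E T f) (\<lambda>x. h2 x - of_real \<mu> * E (- T) f x)
      = l2_inner M (E T f) (\<lambda>x. (-1) * (h1 x - of_real \<mu> * E T f x))"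
    using k1 km L' by (intro l2_inner_cong_right[OF k])
  also have "\<dots> = cnj (-1) * l2_inner M (E T f) (\<lambda>x. h1 x - of_real \<mu> * E T f x)"
    by (rule l2_inner_cmult_right)
  also have "- \<dots> = l2_inner M (E T f) (\<lambda>x. h1 x - of_real \<mu> * E T f x)" by simp
  also have "\<dots> = cnj (l2_inner M (\<lambda>x. h1 x - of_real \<mu> * E T f x) (E T f))"
    by (rule l2_inner_commute)
  finally have eq: "(LINT t|\<nu> f. indicator (- T) t * (t - \<mu>)) = (LINT t|\<nu> f. indicator T t * (t - \<mu>))"
    unfolding q1 q2 complex_cnj_complex_of_real of_real_eq_iff .
  have int: "integrable (\<nu> f) (\<lambda>t. indicator T t * (t - \<mu>))" "integrable (\<nu> f) (\<lambda>t. indicator (- T) t * (\<mu> - t))"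
    using integrable_mult_indicator[of _ "\<nu> f" "\<lambda>t. t - \<mu>"] integrable_mult_indicator[of _ "\<nu> f" "\<lambda>t. \<mu> - t"] f1
    by auto
  have ge: "(LINT t|\<nu> f. indicator T t * (t - \<mu>)) \<ge> 0" "(LINT t|\<nu> f. indicator (- T) t * (\<mu> - t)) \<ge> 0"
    by (auto intro!: integral_nonneg_AE simp: T_def indicator_def)
  have "(LINT t|\<nu> f. indicator (- T) t * (t - \<mu>)) = - (LINT t|\<nu> f. indicator (- T) t * (\<mu> - t))"
    by (subst Bochner_Integration.integral_minus[symmetric]) (auto simp: algebra_simps)
  \<comment> \<open>By \<open>eq\<close> these two nonnegative integrals add up to zero.\<close>
  with eq ge have "(LINT t|\<nu> f. indicator T t * (t - \<mu>)) = 0" "(LINT t|\<nu> f. indicator (- T) t * (\<mu> - t)) = 0"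
    by linarith+
  then have "AE t in \<nu> f. indicator T t * (t - \<mu>) = 0" "AE t in \<nu> f. indicator (- T) t * (\<mu> - t) = 0"
    using int by (auto simp: integral_nonneg_eq_0_iff_AE T_def indicator_def)
  then have conc: "AE t in \<nu> f. t = \<mu>"
    by eventually_elim (auto simp: T_def indicator_def split: if_splits)
  show ?thesis
  proof (cases "\<mu> \<in> A")
    case True
    have "emeasure (\<nu> f) A = emeasure (\<nu> f) UNIV"
      using conc A True by (intro emeasure_eq_AE) (auto elim!: AE_mp)
    then have "(l2_norm M (E A f))\<^sup>2 = (l2_norm M f)\<^sup>2"
      using f A by (simp add: emeasure_\<nu> norm_E_UNIV)
    then have "l2_norm M (E A f) = l2_norm M f" by simp
    then show ?thesis using proj_eqI[OF proj[OF A] f] True by simp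
  next
    case False
    have "emeasure (\<nu> f) A = emeasure (\<nu> f) {}"
      using conc A False by (intro emeasure_eq_AE) (auto elim!: AE_mp)
    then have "l2_norm M (E A f) = 0"
      using f A by (simp add: emeasure_\<nu>)
    then show ?thesis using f A False by (simp add: L2_ae_eq_0_iff_norm E_L2)
  qed
qed

section \<open>Self-adjoint operators with an eigenbasis\<close>

locale eigenbasis = l2_orthonormal_basis M e
  for M :: "'a measure" and e :: "nat \<Rightarrow> 'a \<Rightarrow> complex" +
  fixes ev :: "nat \<Rightarrow> real" and H :: "('a \<Rightarrow> complex) rel"
  assumes H: "self_adjoint M H"
    and eigenvector: "(e i, \<lambda>x. of_real (ev i) * e i x) \<in> H"
begin

text \<open>For \<open>f\<close> in L2 such a function exists by \<open>Riesz_Fischer\<close>, and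
  any two choices agree almost everywhere by totality.\<close>

definition spec :: "real set \<Rightarrow> ('a \<Rightarrow> complex) \<Rightarrow> 'a \<Rightarrow> complex" where
  "spec A f = (SOME g. g \<in> L2 M \<and> (\<forall>i. coeff g i = indicator A (ev i) * coeff f i))"

lemma spec:
  assumes "f \<in> L2 M"
  shows spec_L2: "spec A f \<in> L2 M" and coeff_spec: "coeff (spec A f) i = indicator A (ev i) * coeff f i"
proof -
  have "summable (\<lambda>i. (cmod (indicator A (ev i) * coeff f i))\<^sup>2)"
    by (rule summable_comparison_test'[OF summable_coeff[OF assms], of 0]) (auto simp: indicator_def)
  from Riesz_Fischer[OF this]
  have "\<exists>g. g \<in> L2 M \<and> (\<forall>i. coeff g i = indicator A (ev i) * coeff f i)" by metis
  from someI_ex[OF this] show "spec A f \<in> L2 M" "coeff (spec A f) i = indicator A (ev i) * coeff f i"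
    unfolding spec_def by auto
qed

lemma spec_orthogonal_projection: "orthogonal_projection M (spec A)"
  unfolding orthogonal_projection_def L2_operator_def
proof (intro conjI ballI allI impI)
  fix f assume f: "f \<in> L2 M"
  show "spec A f \<in> L2 M" using f by (rule spec_L2)
  show "ae_eq M (spec A (spec A f)) (spec A f)"
    using f by (intro ae_eqI_coeff) (auto simp: spec_L2 coeff_spec indicator_def)
  show "ae_eq M (spec A (\<lambda>x. c * f x)) (\<lambda>x. c * spec A f x)" for c
    using f by (intro ae_eqI_coeff) (auto simp: spec_L2 coeff_spec l2_inner_cmult_left L2_cmult)
  fix g assume g: "g \<in> L2 M"
  show "ae_eq M (spec A (\<lambda>x. f x + g x)) (\<lambda>x. spec A f x + spec A g x)"
    using f g by (intro ae_eqI_coeff)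
      (auto simp: spec_L2 coeff_spec l2_inner_add_left L2_add distrib_left)
  show "ae_eq M (spec A f) (spec A g)" if "ae_eq M f g"
    using f g that by (intro ae_eqI_coeff) (auto simp: spec_L2 coeff_spec intro: l2_inner_cong_left)
  show "l2_inner M (spec A f) g = l2_inner M f (spec A g)"
  proof (rule sums_unique2)
    show "(\<lambda>i. indicator A (ev i) * coeff f i * cnj (coeff g i)) sums l2_inner M (spec A f) g"
      using Parseval[OF spec_L2[OF f, of A] g] f by (simp add: coeff_spec)
    have eq: "coeff f i * cnj (coeff (spec A g) i) = indicator A (ev i) * coeff f i * cnj (coeff g i)" for i
      using g by (simp add: coeff_spec indicator_def)
    show "(\<lambda>i. indicator A (ev i) * coeff f i * cnj (coeff g i)) sums l2_inner M f (spec A g)"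
      using Parseval[OF f spec_L2[OF g, of A]] unfolding eq .
  qed
qed

text \<open>The sum of point masses of size \<open>(cmod (coeff f i))\<^sup>2\<close> at
  \<open>ev i\<close>. As an image measure it adds up the masses of repeated eigenvalues and turns
  integrals into series over \<open>i\<close>.\<close>

definition weights :: "('a \<Rightarrow> complex) \<Rightarrow> real measure" where
  "weights f = distr (density (count_space UNIV) (\<lambda>i. ennreal ((cmod (coeff f i))\<^sup>2))) borel ev"

lemma sets_weights [simp]: "sets (weights f) = sets borel"
  and space_weights [simp]: "space (weights f) = UNIV"
  by (simp_all add: weights_def)

lemma inner_spec_sums:
  assumes "f \<in> L2 M"
  shows "(\<lambda>i. indicator A (ev i) * (cmod (coeff f i))\<^sup>2) sums Re (l2_inner M (spec A f) f)"
    and "l2_inner M (spec A f) f = of_real (Re (l2_inner M (spec A f) f))"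
proof -
  have "(\<lambda>i. coeff (spec A f) i * cnj (coeff f i)) sums l2_inner M (spec A f) f"
    by (rule Parseval[OF spec_L2[OF assms] assms])
  moreover have "coeff (spec A f) i * cnj (coeff f i) = of_real (indicator A (ev i) * (cmod (coeff f i))\<^sup>2)" for i
    unfolding coeff_spec[OF assms] of_real_mult complex_norm_square by (simp add: indicator_def)
  ultimately have s: "(\<lambda>i. complex_of_real (indicator A (ev i) * (cmod (coeff f i))\<^sup>2)) sums l2_inner M (spec A f) f"
    by simp
  from sums_Re[OF s] show "(\<lambda>i. indicator A (ev i) * (cmod (coeff f i))\<^sup>2) sums Re (l2_inner M (spec A f) f)"
    by simp
  from sums_Im[OF s] have "(\<lambda>_. 0) sums Im (l2_inner M (spec A f) f)" by simp
  then have "Im (l2_inner M (spec A f) f) = 0" using sums_0 sums_unique2 by blast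
  then show "l2_inner M (spec A f) f = of_real (Re (l2_inner M (spec A f) f))"
    by (simp add: complex_eq_iff)
qed

lemma emeasure_weights:
  assumes "f \<in> L2 M" "A \<in> sets borel"
  shows "emeasure (weights f) A = ennreal (Re (l2_inner M (spec A f) f))"
proof -
  have "emeasure (weights f) A = (\<Sum>i. ennreal ((cmod (coeff f i))\<^sup>2) * indicator (ev -` A) i)"
    using assms by (simp add: weights_def emeasure_distr emeasure_density nn_integral_count_space_nat)
  also have "\<dots> = (\<Sum>i. ennreal (indicator A (ev i) * (cmod (coeff f i))\<^sup>2))"
    by (intro arg_cong[where f=suminf] ext) (auto simp: indicator_def)
  also have "\<dots> = ennreal (Re (l2_inner M (spec A f) f))"
    using inner_spec_sums(1)[OF assms(1), of A]
    by (subst suminf_ennreal2) (auto simp: sums_iff)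
  finally show ?thesis .
qed

lemma finite_measure_weights: "f \<in> L2 M \<Longrightarrow> finite_measure (weights f)"
  by (rule finite_measureI) (simp add: emeasure_weights)

lemma spectral_distribution_spec:
  assumes "f \<in> L2 M"
  shows "spectral_distribution M spec f = weights f"
proof -
  have "spectral_distribution M spec f = measure_of UNIV (sets borel) (emeasure (weights f))"
    unfolding spectral_distribution_def
    by (rule measure_of_eq) (auto simp: emeasure_weights[OF assms] sets.sigma_sets_eq[of borel, simplified])
  also have "\<dots> = weights f"
    using measure_of_of_measure[of "weights f"] by simp
  finally show ?thesis .
qed

lemma integrable_weights:
  fixes h :: "real \<Rightarrow> real"
  assumes [measurable]: "h \<in> borel_measurable borel"
  shows "integrable (weights f) h \<longleftrightarrow> summable (\<lambda>i. \<bar>(cmod (coeff f i))\<^sup>2 * h (ev i)\<bar>)"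
  unfolding weights_def
  by (subst integrable_distr_eq) (auto simp: integrable_density integrable_count_space_nat_iff)

lemma integral_weights:
  fixes h :: "real \<Rightarrow> real"
  assumes [measurable]: "h \<in> borel_measurable borel" and "integrable (weights f) h"
  shows "(\<lambda>i. (cmod (coeff f i))\<^sup>2 * h (ev i)) sums (LINT t|weights f. h t)"
proof -
  have "(LINT t|weights f. h t) = (LINT i|count_space UNIV. (cmod (coeff f i))\<^sup>2 * h (ev i))"
    unfolding weights_def by (subst integral_distr) (auto simp: integral_density)
  moreover have "integrable (count_space UNIV) (\<lambda>i. (cmod (coeff f i))\<^sup>2 * h (ev i))"
    using assms by (simp add: integrable_weights integrable_count_space_nat_iff)
  ultimately show ?thesis using sums_integral_count_space_nat by metis
qed

lemma pvm_spec: "projection_valued_measure M spec"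
  unfolding projection_valued_measure_def
proof (intro conjI ballI allI impI)
  show "orthogonal_projection M (spec A)" for A by (rule spec_orthogonal_projection)
  fix f assume f: "f \<in> L2 M"
  show "ae_eq M (spec UNIV f) f"
    using f by (intro ae_eqI_coeff) (auto simp: spec_L2 coeff_spec)
  fix A :: "nat \<Rightarrow> real set" assume A: "range A \<subseteq> sets borel" "disjoint_family A"
  interpret finite_measure "weights f" by (rule finite_measure_weights[OF f])
  have m: "measure (weights f) B = Re (l2_inner M (spec B f) f)" if "B \<in> sets borel" for B
  proof -
    have "0 \<le> Re (l2_inner M (spec B f) f)"
      by (rule sums_le[OF _ sums_zero inner_spec_sums(1)[OF f, of B]]) simp
    then show ?thesis by (simp add: measure_def emeasure_weights[OF f that])
  qed
  have "(\<lambda>n. measure (weights f) (A n)) sums measure (weights f) (\<Union>n. A n)"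
    using A by (intro finite_measure_UNION) auto
  moreover have "A n \<in> sets borel" for n using A by auto
  moreover from this have "(\<Union>n. A n) \<in> sets borel" by auto
  ultimately have "(\<lambda>n. Re (l2_inner M (spec (A n) f) f)) sums Re (l2_inner M (spec (\<Union>n. A n) f) f)"
    by (simp add: m)
  then have "(\<lambda>n. complex_of_real (Re (l2_inner M (spec (A n) f) f))) sums
      of_real (Re (l2_inner M (spec (\<Union>n. A n) f) f))"
    by (simp only: sums_of_real_iff)
  then show "(\<lambda>n. l2_inner M (spec (A n) f) f) sums l2_inner M (spec (\<Union>n. A n) f) f"
    by (simp only: inner_spec_sums(2)[OF f, symmetric])
qed

lemma coeff_graph:
  assumes "(f, g) \<in> H"
  shows "coeff g i = of_real (ev i) * coeff f i"
  using self_adjoint_symmetric[OF H assms eigenvector[of i]] by (simp add: l2_inner_cmult_right)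

text \<open>The inclusion from right to left is where self-adjointness is stronger than symmetry:
  the function with coefficients \<open>ev i * coeff f i\<close> satisfies the adjoint equation by
  \<open>Parseval\<close>, hence it is the value of \<open>H\<close> at \<open>f\<close>.\<close>

lemma Domain_H: "Domain H = {f \<in> L2 M. summable (\<lambda>i. (cmod (of_real (ev i) * coeff f i))\<^sup>2)}"
proof (intro set_eqI iffI)
  fix f assume "f \<in> Domain H"
  then obtain g where fg: "(f, g) \<in> H" by auto
  show "f \<in> {f \<in> L2 M. summable (\<lambda>i. (cmod (of_real (ev i) * coeff f i))\<^sup>2)}"
    using summable_coeff[of g] self_adjoint_L2[OF H fg] by (simp add: coeff_graph[OF fg])
next
  fix f assume "f \<in> {f \<in> L2 M. summable (\<lambda>i. (cmod (of_real (ev i) * coeff f i))\<^sup>2)}"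
  then have f: "f \<in> L2 M" and s: "summable (\<lambda>i. (cmod (of_real (ev i) * coeff f i))\<^sup>2)" by auto
  obtain g where g: "g \<in> L2 M" "\<And>i. coeff g i = of_real (ev i) * coeff f i"
    using Riesz_Fischer[OF s] by metis
  have "l2_inner M u' f = l2_inner M u g" if u: "(u, u') \<in> H" for u u'
  proof -
    note uL = self_adjoint_L2[OF H u]
    show ?thesis
      using Parseval[OF uL(2) f] Parseval[OF uL(1) g(1)]
      by (auto simp: coeff_graph[OF u] g(2) mult_ac intro: sums_unique2)
  qed
  then have "(f, g) \<in> H"
    using f g(1) by (subst self_adjoint_graph_iff[OF H]) auto
  then show "f \<in> Domain H" by auto
qed

lemma spectral_resolution_spec: "spectral_resolution M H spec"
  unfolding spectral_resolution_def
proof (intro conjI)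
  have eq: "\<bar>(cmod (coeff f i))\<^sup>2 * (ev i)\<^sup>2\<bar> = (cmod (of_real (ev i) * coeff f i))\<^sup>2" for f i
    by (simp add: norm_mult power_mult_distrib)
  then show D: "Domain H = {f \<in> L2 M. integrable (spectral_distribution M spec f) (\<lambda>t. t\<^sup>2)}"
    by (auto simp: Domain_H spectral_distribution_spec integrable_weights simp del: abs_mult)
  show "\<forall>(f, g)\<in>H. l2_inner M g f = complex_of_real (LINT t|spectral_distribution M spec f. t)"
  proof safe
    fix f g assume fg: "(f, g) \<in> H"
    then have f: "f \<in> L2 M" and g: "g \<in> L2 M" by (auto dest: self_adjoint_L2[OF H])
    have "integrable (weights f) (\<lambda>t. t\<^sup>2)"
    proof -
      have "f \<in> Domain H" using fg by auto
      then show ?thesis unfolding D using f by (simp add: spectral_distribution_spec)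
    qed
    then have "integrable (weights f) (\<lambda>t. t)"
      by (rule integrable_of_integrable_square[OF finite_measure_weights[OF f] sets_weights])
    then have "(\<lambda>i. (cmod (coeff f i))\<^sup>2 * ev i) sums (LINT t|weights f. t)"
      by (rule integral_weights[of "\<lambda>t. t" f, OF measurable_ident_sets[OF refl]])
    then have "(\<lambda>i. complex_of_real ((cmod (coeff f i))\<^sup>2 * ev i)) sums of_real (LINT t|weights f. t)"
      by (simp only: sums_of_real_iff)
    moreover have "complex_of_real ((cmod (coeff f i))\<^sup>2 * ev i) = coeff g i * cnj (coeff f i)" for i
      unfolding of_real_mult complex_norm_square coeff_graph[OF fg] by (simp only: mult_ac)
    ultimately show "l2_inner M g f = complex_of_real (LINT t|spectral_distribution M spec f. t)"
      using Parseval[OF g f] f by (auto simp: spectral_distribution_spec intro: sums_unique2)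
  qed
qed (rule pvm_spec)

text \<open>\<open>E A\<close> is symmetric and acts diagonally on the basis by
  \<open>spectral_resolution_eigenvector\<close>, so each coefficient of \<open>w\<close> is
  multiplied by the indicator at its eigenvalue. \<open>E\<close> is arbitrary because
  \<open>strongly_commuting\<close> supplies unspecified resolutions.\<close>

lemma spectral_resolution_joint_eigenvector:
  assumes res: "spectral_resolution M H E" and A: "A \<in> sets borel" and w: "w \<in> L2 M"
    and c: "\<And>i. coeff w i \<noteq> 0 \<Longrightarrow> indicator A (ev i) = c"
  shows "ae_eq M (E A w) (\<lambda>x. c * w x)"
proof (rule ae_eqI_coeff)
  interpret spectral_measure M E
    using res by unfold_locales (simp add: spectral_resolution_def)
  show "E A w \<in> L2 M" using w A by auto
  show "(\<lambda>x. c * w x) \<in> L2 M" using w by auto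
  fix i
  have "coeff (E A w) i = l2_inner M w (E A (e i))"
    using w A by (simp add: proj_symmetric[OF proj])
  also have "\<dots> = l2_inner M w (\<lambda>x. indicator A (ev i) * e i x)"
    using spectral_resolution_eigenvector[OF H res eigenvector A, of i] w A
    by (intro l2_inner_cong_right) auto
  also have "\<dots> = indicator A (ev i) * coeff w i"
    by (simp add: l2_inner_cmult_right indicator_def)
  also have "\<dots> = c * coeff w i" using c[of i] by (cases "coeff w i = 0") auto
  finally show "coeff (E A w) i = coeff (\<lambda>x. c * w x) i" by (simp add: l2_inner_cmult_left)
qed

end

text \<open>By symmetry both orders have the same inner product with each \<open>w i\<close>, namely
  that of \<open>f\<close> times the conjugates of the two scalars; totality of \<open>w\<close>
  decides.\<close>

lemma commuting_projections_of_total_eigenvectors: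
  assumes P: "orthogonal_projection M P" and Q: "orthogonal_projection M Q"
    and W: "\<And>i. w i \<in> L2 M"
    and PW: "\<And>i. ae_eq M (P (w i)) (\<lambda>x. p i * w i x)"
    and QW: "\<And>i. ae_eq M (Q (w i)) (\<lambda>x. q i * w i x)"
    and total: "\<And>g. g \<in> L2 M \<Longrightarrow> (\<And>i. l2_inner M g (w i) = 0) \<Longrightarrow> ae_eq M g (\<lambda>_. 0)"
    and f: "f \<in> L2 M"
  shows "ae_eq M (P (Q f)) (Q (P f))"
proof -
  note L = proj_L2[OF P] proj_L2[OF Q]
  have eig: "l2_inner M (T (S f)) u = cnj s * cnj t * l2_inner M f u"
    if "orthogonal_projection M T" "orthogonal_projection M S" "u \<in> L2 M"
      "ae_eq M (T u) (\<lambda>x. t * u x)" "ae_eq M (S u) (\<lambda>x. s * u x)" for T S s t u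
  proof -
    note w = that(3)
    have "l2_inner M (T (S f)) u = l2_inner M (S f) (T u)"
      using f w by (intro proj_symmetric[OF that(1)] proj_L2[OF that(2)])
    also have "\<dots> = cnj t * l2_inner M (S f) u"
      using that f w by (subst l2_inner_cong_right[OF that(4)]) (auto intro: proj_L2 simp: l2_inner_cmult_right)
    also have "l2_inner M (S f) u = l2_inner M f (S u)"
      using f w by (intro proj_symmetric[OF that(2)])
    also have "\<dots> = cnj s * l2_inner M f u"
      using that f w by (subst l2_inner_cong_right[OF that(5)]) (auto intro: proj_L2 simp: l2_inner_cmult_right)
    finally show ?thesis by simp
  qed
  have "ae_eq M (\<lambda>x. P (Q f) x - Q (P f) x) (\<lambda>_. 0)"
  proof (rule total)
    fix i
    show "l2_inner M (\<lambda>x. P (Q f) x - Q (P f) x) (w i) = 0"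
      using eig[OF P Q W PW QW, of i] eig[OF Q P W QW PW, of i] f L W[of i]
      by (simp add: l2_inner_diff_left)
  qed (use f L in auto)
  then show ?thesis by (auto simp: ae_eq_def)
qed

section \<open>Exponentials are total on the interval\<close>

lemma integrable_mult_bounded:
  fixes g h :: "'a \<Rightarrow> complex"
  assumes g: "integrable M g" and [measurable]: "h \<in> borel_measurable M"
    and bound: "\<And>x. x \<in> space M \<Longrightarrow> cmod (h x) \<le> B"
  shows "integrable M (\<lambda>x. g x * h x)"
proof (rule Bochner_Integration.integrable_bound)
  show "integrable M (\<lambda>x. \<bar>B\<bar> * norm (g x))" using g by simp
  show "(\<lambda>x. g x * h x) \<in> borel_measurable M" using g by measurable
  have "cmod (g x * h x) \<le> \<bar>B\<bar> * cmod (g x)" if "x \<in> space M" for x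
    using mult_right_mono[OF order_trans[OF bound[OF that] abs_ge_self], of "cmod (g x)"]
    by (simp add: norm_mult mult.commute)
  then show "AE x in M. norm (g x * h x) \<le> norm (\<bar>B\<bar> * norm (g x))" by auto
qed

lemma integral_norm_mult_bounded_le:
  fixes g h :: "'a \<Rightarrow> complex"
  assumes g: "integrable M g" and h: "h \<in> borel_measurable M"
    and bound: "\<And>x. x \<in> space M \<Longrightarrow> cmod (h x) \<le> B"
  shows "cmod (LINT x|M. g x * h x) \<le> B * (LINT x|M. cmod (g x))"
proof -
  have "cmod (LINT x|M. g x * h x) \<le> (LINT x|M. cmod (g x * h x))"
    by (rule integral_norm_bound)
  also have "\<dots> \<le> (LINT x|M. B * cmod (g x))"
  proof (rule integral_mono)
    show "integrable M (\<lambda>x. cmod (g x * h x))"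
      using integrable_mult_bounded[OF assms] by simp
    show "cmod (g x * h x) \<le> B * cmod (g x)" if "x \<in> space M" for x
      using mult_right_mono[OF bound[OF that], of "cmod (g x)"] by (simp add: norm_mult mult.commute)
  qed (use g in simp)
  finally show ?thesis by simp
qed

text \<open>
  By the Stone--Weierstrass theorem it suffices to consider real polynomials in the real and
  imaginary part of $e^{2\pi iX}$. The class \<open>\<A>\<close> below is stable under multiplication by
  these, which takes care of the product case of the induction on polynomials.
\<close>

lemma integral_circle_continuous_eq_0:
  fixes g :: "'a \<Rightarrow> complex" and X :: "'a \<Rightarrow> real" and \<phi> :: "complex \<Rightarrow> real"
  assumes g: "integrable M g" and X [measurable]: "X \<in> borel_measurable M"
    and orth: "\<And>m::int. (LINT x|M. g x * cis (2 * pi * of_int m * X x)) = 0"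
    and \<phi>: "continuous_on (sphere 0 1) \<phi>" "(\<lambda>x. \<phi> (cis (2 * pi * X x))) \<in> borel_measurable M"
  shows "(LINT x|M. g x * of_real (\<phi> (cis (2 * pi * X x)))) = 0"
proof -
  let ?Z = "\<lambda>x. cis (2 * pi * X x)"
  have [measurable]: "cis \<in> borel_measurable borel"
    by (intro borel_measurable_continuous_onI continuous_intros)
  define \<A> where "\<A> = {h \<in> borel_measurable M. (\<exists>B. \<forall>x. cmod (h x) \<le> B) \<and>
    (\<forall>m::int. (LINT x|M. g x * (h x * cis (2 * pi * of_int m * X x))) = 0)}"
  have \<A>D: "h \<in> borel_measurable M" "integrable M (\<lambda>x. g x * (h x * cis (2 * pi * of_int m * X x)))"
    "(LINT x|M. g x * (h x * cis (2 * pi * of_int m * X x))) = 0" if "h \<in> \<A>" for h and m :: int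
  proof -
    from that obtain B where [measurable]: "h \<in> borel_measurable M" and B: "\<And>x. cmod (h x) \<le> B"
      by (auto simp: \<A>_def)
    show "integrable M (\<lambda>x. g x * (h x * cis (2 * pi * of_int m * X x)))"
      by (rule integrable_mult_bounded[OF g, of _ B]) (use B in \<open>auto simp: norm_mult\<close>)
  qed (use that in \<open>auto simp: \<A>_def\<close>)
  have \<A>_lin: "(\<lambda>x. c * h x + d * k x) \<in> \<A>" if h: "h \<in> \<A>" and k: "k \<in> \<A>" for c d h k
  proof -
    obtain B C where "\<And>x. cmod (h x) \<le> B" "\<And>x. cmod (k x) \<le> C" using h k by (auto simp: \<A>_def)
    then have "cmod (c * h x + d * k x) \<le> cmod c * B + cmod d * C" for x
      by (intro order_trans[OF norm_triangle_ineq] add_mono) (auto simp: norm_mult mult_left_mono)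
    moreover have "(LINT x|M. g x * ((c * h x + d * k x) * cis (2 * pi * of_int m * X x))) = 0" for m :: int
    proof -
      have "(LINT x|M. g x * ((c * h x + d * k x) * cis (2 * pi * of_int m * X x))) =
        (LINT x|M. c * (g x * (h x * cis (2 * pi * of_int m * X x))) + d * (g x * (k x * cis (2 * pi * of_int m * X x))))"
        by (simp add: algebra_simps)
      also have "\<dots> = 0"
        using \<A>D[OF h] \<A>D[OF k] by simp
      finally show ?thesis .
    qed
    ultimately show ?thesis
      using \<A>D(1)[OF h] \<A>D(1)[OF k] unfolding \<A>_def by (auto intro!: exI[of _ "cmod c * B + cmod d * C"])
  qed
  have \<A>_shift: "(\<lambda>x. cis (2 * pi * of_int n * X x) * h x) \<in> \<A>" if h: "h \<in> \<A>" for h and n :: int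
  proof -
    have eq: "h x * cis (2 * pi * of_int (n + m) * X x) = (cis (2 * pi * of_int n * X x) * h x) * cis (2 * pi * of_int m * X x)"
      for x and m :: int
      by (simp add: cis_mult algebra_simps)
    have "(LINT x|M. g x * ((cis (2 * pi * of_int n * X x) * h x) * cis (2 * pi * of_int m * X x))) = 0" for m :: int
      using \<A>D(3)[OF h, of "n + m"] unfolding eq .
    then show ?thesis using h unfolding \<A>_def by (auto simp: norm_mult)
  qed
  have one: "(\<lambda>_. 1) \<in> \<A>"
    using orth by (auto simp: \<A>_def)
  have poly: "(\<lambda>x. of_real (p (?Z x)) * h x) \<in> \<A>" if "real_polynomial_function p" "h \<in> \<A>" for p h
    using that
  proof (induction arbitrary: h rule: real_polynomial_function.induct)
    case lin: (linear f)
    interpret bounded_linear f by (rule lin)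
    \<comment> \<open>On the circle a real-linear functional has the form
      \<open>c * z + d * cnj z\<close>, a combination of the shifts by 1 and -1.\<close>
    define c where "c = Complex (f 1 / 2) (- f \<i> / 2)"
    define d where "d = Complex (f 1 / 2) (f \<i> / 2)"
    have "of_real (f (cis t)) = c * cis t + d * cis (- t)" for t
    proof -
      have "cis t = cos t *\<^sub>R 1 + sin t *\<^sub>R \<i>" by (simp add: complex_eq_iff)
      then have "f (cis t) = cos t * f 1 + sin t * f \<i>" by (metis add scaleR real_scaleR_def)
      then show ?thesis by (simp add: complex_eq_iff c_def d_def algebra_simps)
    qed
    then have eq: "(\<lambda>x. of_real (f (?Z x)) * h x) =
      (\<lambda>x. c * (cis (2 * pi * of_int 1 * X x) * h x) + d * (cis (2 * pi * of_int (-1) * X x) * h x))"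
      by (simp add: fun_eq_iff algebra_simps)
    show ?case unfolding eq by (rule \<A>_lin[OF \<A>_shift[OF lin(2), of 1] \<A>_shift[OF lin(2), of "-1"]])
  next
    case (const c)
    then show ?case using \<A>_lin[OF const const, of "of_real c" 0] by simp
  next
    case (add p q)
    then show ?case using \<A>_lin[OF add(3)[OF add(5)] add(4)[OF add(5)], of 1 1] by (simp add: algebra_simps)
  next
    case (mult p q)
    then show ?case using mult(3)[OF mult(4)[OF mult(5)]] by (simp add: mult.assoc)
  qed
  have "cmod (LINT x|M. g x * of_real (\<phi> (?Z x))) \<le> \<epsilon> * (LINT x|M. cmod (g x))" if "\<epsilon> > 0" for \<epsilon>
  proof -
    obtain p where p: "real_polynomial_function p" and le: "\<And>z. z \<in> sphere 0 1 \<Longrightarrow> \<bar>\<phi> z - p z\<bar> < \<epsilon>"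
      using Stone_Weierstrass_real_polynomial_function[OF _ \<phi>(1) \<open>\<epsilon> > 0\<close>] by auto
    have pA: "(\<lambda>x. of_real (p (?Z x)) * 1) \<in> \<A>" using poly[OF p one] .
    have [measurable]: "(\<lambda>x. complex_of_real (p (?Z x))) \<in> borel_measurable M" using \<A>D(1)[OF pA] by simp
    note \<phi>(2) [measurable]
    have ip: "integrable M (\<lambda>x. g x * of_real (p (?Z x)))" "(LINT x|M. g x * of_real (p (?Z x))) = 0"
      using \<A>D(2,3)[OF pA, of 0] by simp_all
    have b: "cmod (of_real (\<phi> (?Z x)) - of_real (p (?Z x))) \<le> \<epsilon>" for x
      using le[of "?Z x"] by (simp flip: of_real_diff)
    have "integrable M (\<lambda>x. g x * (of_real (\<phi> (?Z x)) - of_real (p (?Z x))))"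
      by (rule integrable_mult_bounded[OF g _ b]) measurable
    then have "(LINT x|M. g x * (of_real (\<phi> (?Z x)) - of_real (p (?Z x))) + g x * of_real (p (?Z x)))
      = (LINT x|M. g x * (of_real (\<phi> (?Z x)) - of_real (p (?Z x))))"
      using ip by simp
    then have "(LINT x|M. g x * of_real (\<phi> (?Z x))) = (LINT x|M. g x * (of_real (\<phi> (?Z x)) - of_real (p (?Z x))))"
      by (simp add: algebra_simps)
    also have "cmod \<dots> \<le> \<epsilon> * (LINT x|M. cmod (g x))"
      by (rule integral_norm_mult_bounded_le[OF g _ b]) measurable
    finally show ?thesis .
  qed
  note le = this
  have "cmod (LINT x|M. g x * of_real (\<phi> (?Z x))) \<le> 0 + e" if "e > 0" for e
  proof -
    define c where "c = (LINT x|M. cmod (g x)) + 1"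
    have "c > 0" unfolding c_def by (intro add_nonneg_pos) auto
    have "(LINT x|M. cmod (g x)) / c \<le> 1" using \<open>c > 0\<close> by (simp add: c_def)
    then have "e / c * (LINT x|M. cmod (g x)) \<le> e"
      using that mult_left_mono[of "(LINT x|M. cmod (g x)) / c" 1 e] by simp
    then show ?thesis using le[of "e / c"] that \<open>c > 0\<close> by simp
  qed
  then have "cmod (LINT x|M. g x * of_real (\<phi> (?Z x))) \<le> 0" by (rule field_le_epsilon)
  then show ?thesis by simp
qed

text \<open>The interval corresponds to the open arc around \<open>w\<close> with half angle
  \<open>pi * (b - a)\<close>, that is, to the part of the circle where the inner product with
  \<open>w\<close> exceeds \<open>cos (pi * (b - a))\<close>. The continuous cutoffs
  \<open>\<phi> n\<close> increase to the indicator of this arc.\<close>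

lemma integral_indicator_Ioo_eq_0:
  fixes g :: "'a \<Rightarrow> complex" and X :: "'a \<Rightarrow> real"
  assumes g: "integrable M g" and X [measurable]: "X \<in> borel_measurable M"
    and range: "\<And>x. x \<in> space M \<Longrightarrow> X x \<in> {0<..<1}"
    and orth: "\<And>m::int. (LINT x|M. g x * cis (2 * pi * of_int m * X x)) = 0"
    and ab: "0 \<le> a" "a < b" "b \<le> 1"
  shows "(LINT x|M. g x * indicator {a<..<b} (X x)) = 0"
proof -
  define w where "w = cis (pi * (a + b))"
  define \<phi> where "\<phi> n z = min 1 (real n * max 0 (z \<bullet> w - cos (pi * (b - a))))" for n :: nat and z
  have [measurable]: "cis \<in> borel_measurable borel"
    by (intro borel_measurable_continuous_onI continuous_intros)
  have cont: "continuous_on UNIV (\<phi> n)" for n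
    unfolding \<phi>_def by (intro continuous_intros)
  then have [measurable]: "\<phi> n \<in> borel_measurable borel" for n by (rule borel_measurable_continuous_onI)
  have inner: "cis (2 * pi * t) \<bullet> w = cos (2 * pi * (t - (a + b) / 2))" for t
  proof -
    have "2 * pi * (t - (a + b) / 2) = 2 * pi * t - pi * (a + b)" by (simp add: field_simps)
    then show ?thesis by (simp only: cos_diff) (simp add: w_def inner_complex_def)
  qed
  have iff: "cis (2 * pi * t) \<bullet> w > cos (pi * (b - a)) \<longleftrightarrow> t \<in> {a<..<b}" if t: "t \<in> {0<..<1}" for t
  proof -
    define s where "s = 2 * pi * \<bar>t - (a + b) / 2\<bar>"
    have cos_s: "cis (2 * pi * t) \<bullet> w = cos s"
    proof -
      have "2 * pi * \<bar>u\<bar> = 2 * pi * u \<or> 2 * pi * \<bar>u\<bar> = - (2 * pi * u)" for u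
        by (simp add: abs_if)
      then have "s = 2 * pi * (t - (a + b) / 2) \<or> s = - (2 * pi * (t - (a + b) / 2))"
        unfolding s_def .
      then show ?thesis unfolding inner by (metis cos_minus)
    qed
    have "2 * (t - (a + b) / 2) = 2 * t - a - b" by (simp add: field_simps)
    then have u: "2 * \<bar>t - (a + b) / 2\<bar> = \<bar>2 * t - a - b\<bar>" by (metis abs_mult abs_numeral)
    have s0: "0 \<le> s" by (simp add: s_def)
    have "s \<le> 2 * pi - pi * (b - a)"
    proof -
      have "2 * \<bar>t - (a + b) / 2\<bar> \<le> 2 - (b - a)" using t ab unfolding u by auto
      from mult_left_mono[OF this, of pi] show ?thesis by (simp add: s_def algebra_simps)
    qed
    have ba: "0 \<le> pi * (b - a)" "pi * (b - a) \<le> pi" using ab mult_left_mono[of "b - a" 1 pi] by auto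
    have "t \<in> {a<..<b} \<longleftrightarrow> 2 * \<bar>t - (a + b) / 2\<bar> < b - a" unfolding u by auto
    also have "\<dots> \<longleftrightarrow> s < pi * (b - a)"
      using mult_less_cancel_left_pos[of pi "2 * \<bar>t - (a + b) / 2\<bar>" "b - a"] by (simp add: s_def mult_ac)
    also have "\<dots> \<longleftrightarrow> cos s > cos (pi * (b - a))"
    proof (cases "s \<le> pi")
      case True
      then show ?thesis using s0 ba cos_mono_less_eq[of "pi * (b - a)" s] by simp
    next
      case False
      \<comment> \<open>Beyond \<open>pi\<close> the angle from the midpoint is measured the other
        way round; the upper bound on \<open>s\<close> keeps it at least
        \<open>pi * (b - a)\<close>.\<close>
      have "cos s = cos (2 * pi - s)" by (simp add: cos_diff)
      also have "\<dots> \<le> cos (pi * (b - a))"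
        using False ba \<open>s \<le> 2 * pi - pi * (b - a)\<close> by (intro cos_monotone_0_pi_le) auto
      finally show ?thesis using False order_trans[OF ba(2), of s] by (simp add: not_less)
    qed
    finally show ?thesis using cos_s by simp
  qed
  have "(\<lambda>n. LINT x|M. g x * of_real (\<phi> n (cis (2 * pi * X x)))) \<longlonglongrightarrow> (LINT x|M. g x * indicator {a<..<b} (X x))"
  proof (rule integral_dominated_convergence)
    show "integrable M (\<lambda>x. cmod (g x))" using g by simp
    show "(\<lambda>x. g x * indicator {a<..<b} (X x)) \<in> borel_measurable M" using g by measurable
    show "(\<lambda>x. g x * of_real (\<phi> n (cis (2 * pi * X x)))) \<in> borel_measurable M" for n using g by measurable
    have "(\<lambda>n. \<phi> n (cis (2 * pi * t))) \<longlonglongrightarrow> indicator {a<..<b} t" if t: "t \<in> {0<..<1}" for t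
    proof (cases "t \<in> {a<..<b}")
      case True
      define c where "c = cis (2 * pi * t) \<bullet> w - cos (pi * (b - a))"
      have "c > 0" using iff[OF t] True by (simp add: c_def)
      obtain N :: nat where N: "1 / c < N" using reals_Archimedean2 by blast
      have "\<phi> n (cis (2 * pi * t)) = 1" if "n \<ge> N" for n
      proof -
        have "1 / c \<le> real n" using N that by linarith
        then have "1 \<le> real n * c" using \<open>c > 0\<close> by (simp add: divide_le_eq)
        then show ?thesis using \<open>c > 0\<close> by (simp add: \<phi>_def c_def[symmetric])
      qed
      then show ?thesis using True
        by (intro tendsto_eventually eventually_sequentiallyI[of N]) auto
    next
      case False
      then have "\<phi> n (cis (2 * pi * t)) = 0" for n
        using iff[OF t] by (auto simp: \<phi>_def max_def)
      then show ?thesis using False by simp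
    qed
    note lim = this
    show "AE x in M. (\<lambda>n. g x * of_real (\<phi> n (cis (2 * pi * X x)))) \<longlonglongrightarrow> g x * indicator {a<..<b} (X x)"
    proof (rule AE_I2)
      fix x assume "x \<in> space M"
      then have "(\<lambda>n. complex_of_real (\<phi> n (cis (2 * pi * X x)))) \<longlonglongrightarrow> complex_of_real (indicator {a<..<b} (X x))"
        by (intro tendsto_of_real lim range)
      then have "(\<lambda>n. complex_of_real (\<phi> n (cis (2 * pi * X x)))) \<longlonglongrightarrow> indicator {a<..<b} (X x)"
        by (cases "X x \<in> {a<..<b}") simp_all
      then show "(\<lambda>n. g x * of_real (\<phi> n (cis (2 * pi * X x)))) \<longlonglongrightarrow> g x * indicator {a<..<b} (X x)"
        by (intro tendsto_intros)
    qed
    have "0 \<le> \<phi> n z" "\<phi> n z \<le> 1" for n z by (simp_all add: \<phi>_def)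
    then show "AE x in M. norm (g x * of_real (\<phi> n (cis (2 * pi * X x)))) \<le> cmod (g x)" for n
      by (simp add: norm_mult mult_left_le)
  qed
  moreover have "(LINT x|M. g x * of_real (\<phi> n (cis (2 * pi * X x)))) = 0" for n
    by (rule integral_circle_continuous_eq_0[OF g X orth])
      (auto intro: continuous_on_subset[OF cont])
  ultimately show ?thesis by (simp add: LIMSEQ_const_iff)
qed

lemma sets_borel_eq_sigma_sets_Ioo:
  "sets (borel :: real measure) = sigma_sets UNIV (range (\<lambda>(a, b). {a<..<b}))"
  by (subst borel_eq_box) (simp add: split_def box_real)

text \<open>Intervals form a generator of the Borel sets that is stable under intersections. The
  hypothesis covers only intervals with closure inside (0,1), because test functions have compact
  support there; all others are exhausted from inside, as \<open>X\<close> takes its values in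
  (0,1).\<close>

lemma integral_indicator_borel_eq_0:
  fixes g :: "'a \<Rightarrow> complex" and X :: "'a \<Rightarrow> real"
  assumes g: "integrable M g" and X [measurable]: "X \<in> borel_measurable M"
    and range: "\<And>x. x \<in> space M \<Longrightarrow> X x \<in> {0<..<1}"
    and Ioo: "\<And>a b. 0 < a \<Longrightarrow> a < b \<Longrightarrow> b < 1 \<Longrightarrow> (LINT x|M. g x * indicator {a<..<b} (X x)) = 0"
    and C: "C \<in> sets borel"
  shows "(LINT x|M. g x * indicator C (X x)) = 0"
proof -
  have int: "integrable M (\<lambda>x. g x * indicator A (X x))" if [measurable]: "A \<in> sets borel" for A
    by (rule integrable_mult_bounded[OF g, of _ 1]) (auto simp: indicator_def)
  have dct: "(LINT x|M. g x * indicator A (X x)) = 0"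
    if [measurable]: "A \<in> sets borel" "\<And>n. B n \<in> sets borel"
      and zero: "\<And>n. (LINT x|M. g x * indicator (B n) (X x)) = 0"
      and lim: "\<And>t. t \<in> {0<..<1} \<Longrightarrow> (\<lambda>n. indicator (B n) t :: complex) \<longlonglongrightarrow> indicator A t"
    for A and B :: "nat \<Rightarrow> real set"
  proof -
    have "(\<lambda>n. LINT x|M. g x * indicator (B n) (X x)) \<longlonglongrightarrow> (LINT x|M. g x * indicator A (X x))"
    proof (rule integral_dominated_convergence)
      show "integrable M (\<lambda>x. cmod (g x))" using g by simp
      show "(\<lambda>x. g x * indicator A (X x)) \<in> borel_measurable M"
        "\<And>n. (\<lambda>x. g x * indicator (B n) (X x)) \<in> borel_measurable M" using int by auto
      show "AE x in M. (\<lambda>n. g x * indicator (B n) (X x)) \<longlonglongrightarrow> g x * indicator A (X x)"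
        using lim range by (intro AE_I2 tendsto_intros) auto
    qed (auto simp: indicator_def norm_mult)
    then show ?thesis using zero by (simp add: LIMSEQ_const_iff)
  qed
  have box: "(LINT x|M. g x * indicator {a<..<b} (X x)) = 0" for a b
  proof (rule dct)
    let ?B = "\<lambda>n. {max a (inverse (real (Suc n)))<..<min b (1 - inverse (real (Suc n)))}"
    show "(LINT x|M. g x * indicator (?B n) (X x)) = 0" for n
    proof (cases "max a (inverse (real (Suc n))) < min b (1 - inverse (real (Suc n)))")
      case True
      have "inverse (real (Suc n)) > 0" by simp
      with True show ?thesis by (intro Ioo) (linarith | simp)+
    next
      case False
      then have "?B n = {}" by auto
      then show ?thesis by simp
    qed
    show "(\<lambda>n. indicator (?B n) t :: complex) \<longlonglongrightarrow> indicator {a<..<b} t" if t: "t \<in> {0<..<1}" for t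
    proof -
      obtain N where N: "inverse (real (Suc N)) < min t (1 - t)"
        using reals_Archimedean[of "min t (1 - t)"] t by auto
      have "indicator (?B n) t = (indicator {a<..<b} t :: complex)" if "n \<ge> N" for n
      proof -
        have "inverse (real (Suc n)) \<le> inverse (real (Suc N))"
          using that by (intro le_imp_inverse_le) auto
        then have "inverse (real (Suc n)) < t" "t < 1 - inverse (real (Suc n))"
          using N unfolding min_less_iff_conj by linarith+
        then show ?thesis by (auto simp: indicator_def)
      qed
      then show ?thesis by (intro tendsto_eventually eventually_sequentiallyI[of N]) auto
    qed
  qed auto
  have all: "(LINT x|M. g x) = 0"
    using box[of 0 1] range by (subst (asm) Bochner_Integration.integral_cong[of M M _ g]) auto
  have Cs: "C \<in> sigma_sets UNIV (range (\<lambda>(a, b). {a<..<b::real}))"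
    using C by (simp only: sets_borel_eq_sigma_sets_Ioo)
  have stable: "Int_stable (range (\<lambda>(a, b). {a<..<b::real}))"
  proof -
    have "{a<..<b} \<inter> {c<..<d} = (\<lambda>(a, b). {a<..<b}) (max a c, min b d)" for a b c d :: real by auto
    then show ?thesis by (fastforce simp: Int_stable_def)
  qed
  have closed: "range (\<lambda>(a, b). {a<..<b::real}) \<subseteq> Pow UNIV" by simp
  from stable closed Cs show ?thesis
  proof (induction rule: sigma_sets_induct_disjoint)
    case (basic A)
    then show ?case using box by auto
  next
    case (compl A)
    then have [measurable]: "A \<in> sets borel" by (simp only: sets_borel_eq_sigma_sets_Ioo)
    have "(LINT x|M. g x * indicator (UNIV - A) (X x)) = (LINT x|M. g x - g x * indicator A (X x))"
      by (intro Bochner_Integration.integral_cong) (auto simp: indicator_def)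
    also have "\<dots> = 0" using compl int all g by simp
    finally show ?case .
  next
    case (union A)
    have [measurable]: "A i \<in> sets borel" for i using union(2) unfolding sets_borel_eq_sigma_sets_Ioo by auto
    show ?case
    proof (rule dct[where B="\<lambda>n. \<Union>i<n. A i"])
      have "indicator (\<Union>i<n. A i) t = (\<Sum>i<n. indicator (A i) t :: complex)" for n t
        using union(1) by (intro indicator_UN_disjoint) (auto simp: disjoint_family_on_def)
      then have "(LINT x|M. g x * indicator (\<Union>i<n. A i) (X x)) = (LINT x|M. (\<Sum>i<n. g x * indicator (A i) (X x)))" for n
        by (simp only: sum_distrib_left)
      also have "\<dots> n = (\<Sum>i<n. LINT x|M. g x * indicator (A i) (X x))" for n
        by (rule Bochner_Integration.integral_sum) (rule int, measurable)
      finally have "(LINT x|M. g x * indicator (\<Union>i<n. A i) (X x)) = (\<Sum>i<n. LINT x|M. g x * indicator (A i) (X x))" for n .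
      then show "(LINT x|M. g x * indicator (\<Union>i<n. A i) (X x)) = 0" for n using union(3) by simp
      show "(\<lambda>n. indicator (\<Union>i<n. A i) t :: complex) \<longlonglongrightarrow> indicator (\<Union>i. A i) t" for t
        by (rule LIMSEQ_indicator_UN)
    qed auto
  qed simp
qed

text \<open>Rounding a bounded real function down to multiples of 1/n gives a finite combination of
  indicators within distance 1/n. Complex functions are split into real and imaginary parts.\<close>

lemma integral_bounded_borel_eq_0:
  fixes g :: "'a \<Rightarrow> complex" and X :: "'a \<Rightarrow> real" and h :: "real \<Rightarrow> complex"
  assumes g: "integrable M g" and X [measurable]: "X \<in> borel_measurable M"
    and ind: "\<And>C. C \<in> sets borel \<Longrightarrow> (LINT x|M. g x * indicator C (X x)) = 0"
    and h [measurable]: "h \<in> borel_measurable borel" and bound: "\<And>t. cmod (h t) \<le> B"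
  shows "(LINT x|M. g x * h (X x)) = 0"
proof -
  have *: "(LINT x|M. g x * of_real (k (X x))) = 0"
    if k [measurable]: "k \<in> borel_measurable borel" and kB: "\<And>t. \<bar>k t\<bar> \<le> B" for k :: "real \<Rightarrow> real"
  proof -
    define L where "L = (LINT x|M. g x * of_real (k (X x)))"
    have "cmod L \<le> 1 / real n * (LINT x|M. cmod (g x))" if n: "n > 0" for n :: nat
    proof -
      define s where "s t = real_of_int \<lfloor>real n * k t\<rfloor> / real n" for t
      have [measurable]: "s \<in> borel_measurable borel" unfolding s_def by measurable
      have close: "\<bar>k t - s t\<bar> \<le> 1 / real n" for t
      proof -
        have "k t - s t = (real n * k t - real_of_int \<lfloor>real n * k t\<rfloor>) / real n"
          using n by (simp add: s_def field_simps)
        moreover have "0 \<le> real n * k t - real_of_int \<lfloor>real n * k t\<rfloor>" "real n * k t - real_of_int \<lfloor>real n * k t\<rfloor> \<le> 1"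
          by linarith+
        ultimately show ?thesis using n by (simp add: divide_right_mono)
      qed
      define F where "F = {\<lfloor>- real n * B\<rfloor>..\<lfloor>real n * B\<rfloor>}"
      have F: "\<lfloor>real n * k t\<rfloor> \<in> F" for t
      proof -
        have "- B \<le> k t" "k t \<le> B" using kB[of t] by (auto simp: abs_le_iff)
        then have "real n * (- B) \<le> real n * k t" "real n * k t \<le> real n * B"
          using n by (intro mult_left_mono; simp)+
        then show ?thesis unfolding F_def by (auto intro!: floor_mono)
      qed
      have s_sum: "complex_of_real (s t) = (\<Sum>i\<in>F. of_int i / of_nat n * indicator {u. \<lfloor>real n * k u\<rfloor> = i} t)" for t
      proof -
        have "(\<Sum>i\<in>F. of_int i / of_nat n * indicator {u. \<lfloor>real n * k u\<rfloor> = i} t :: complex)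
          = (\<Sum>i\<in>{\<lfloor>real n * k t\<rfloor>}. of_int i / of_nat n)"
          using F[of t] by (intro sum.mono_neutral_cong_right) (auto simp: F_def)
        then show ?thesis by (simp add: s_def)
      qed
      have C: "{u. \<lfloor>real n * k u\<rfloor> = i} \<in> sets borel" for i
        using measurable_sets[of "\<lambda>u. \<lfloor>real n * k u\<rfloor>" borel "count_space UNIV" "{i}"]
        by (simp add: vimage_def)
      have int: "integrable M (\<lambda>x. g x * indicator {u. \<lfloor>real n * k u\<rfloor> = i} (X x))" for i
        using C by (intro integrable_mult_bounded[OF g, of _ 1]) (auto simp: indicator_def)
      have "(LINT x|M. g x * of_real (s (X x)))
        = (LINT x|M. (\<Sum>i\<in>F. of_int i / of_nat n * (g x * indicator {u. \<lfloor>real n * k u\<rfloor> = i} (X x))))"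
        unfolding s_sum by (simp add: sum_distrib_left mult_ac)
      also have "\<dots> = (\<Sum>i\<in>F. of_int i / of_nat n * (LINT x|M. g x * indicator {u. \<lfloor>real n * k u\<rfloor> = i} (X x)))"
        using int by simp
      also have "\<dots> = 0" using ind[OF C] by simp
      finally have s0: "(LINT x|M. g x * of_real (s (X x))) = 0" .
      have b: "cmod (of_real (k (X x)) - of_real (s (X x))) \<le> 1 / real n" for x
        using close[of "X x"] by (simp flip: of_real_diff)
      have si: "integrable M (\<lambda>x. g x * of_real (s (X x)))"
        unfolding s_sum using int by (simp add: sum_distrib_left mult.left_commute)
      have ki: "integrable M (\<lambda>x. g x * of_real (k (X x)))"
        by (rule integrable_mult_bounded[OF g, of _ B]) (use kB in auto)
      have "L = (LINT x|M. g x * (of_real (k (X x)) - of_real (s (X x))))"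
        using si ki s0 by (simp add: right_diff_distrib L_def)
      also have "cmod \<dots> \<le> 1 / real n * (LINT x|M. cmod (g x))"
        by (rule integral_norm_mult_bounded_le[OF g _ b]) measurable
      finally show ?thesis .
    qed
    then have "\<forall>\<^sub>F n in sequentially. cmod L \<le> 1 / real n * (LINT x|M. cmod (g x))"
      by (intro eventually_sequentiallyI[of 1]) auto
    moreover have "(\<lambda>n. 1 / real n * (LINT x|M. cmod (g x))) \<longlonglongrightarrow> 0 * (LINT x|M. cmod (g x))"
      by (intro tendsto_mult lim_1_over_n tendsto_const)
    ultimately have "cmod L \<le> 0" using tendsto_lowerbound by fastforce
    then show ?thesis by (simp add: L_def)
  qed
  have re: "\<bar>Re (h t)\<bar> \<le> B" "\<bar>Im (h t)\<bar> \<le> B" for t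
    using abs_Re_le_cmod[of "h t"] abs_Im_le_cmod[of "h t"] bound[of t] by linarith+
  have "integrable M (\<lambda>x. g x * of_real (Re (h (X x))))" "integrable M (\<lambda>x. g x * of_real (Im (h (X x))))"
    by (rule integrable_mult_bounded[OF g, of _ B]; use re in auto)+
  then have "(LINT x|M. g x * of_real (Re (h (X x))) + \<i> * (g x * of_real (Im (h (X x)))))
    = 0"
    using *[of "\<lambda>t. Re (h t)"] *[of "\<lambda>t. Im (h t)"] re by simp
  moreover have "g x * of_real (Re (h (X x))) + \<i> * (g x * of_real (Im (h (X x)))) = g x * h (X x)" for x
    by (subst (5) complex_eq) (simp add: algebra_simps)
  ultimately show ?thesis by simp
qed

text \<open>The factor with frequency \<open>\<beta>\<close> is moved into \<open>g\<close>, leaving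
  integer frequencies, and compensated in \<open>h\<close>. \<open>X\<close> lives on an arbitrary
  measure space so that it can be one coordinate of the cube while the other variables are hidden in
  \<open>g\<close>.\<close>

lemma integral_exponentials_eq_0:
  fixes g :: "'a \<Rightarrow> complex" and X :: "'a \<Rightarrow> real" and h :: "real \<Rightarrow> complex"
  assumes g: "integrable M g" and X [measurable]: "X \<in> borel_measurable M"
    and range: "\<And>x. x \<in> space M \<Longrightarrow> X x \<in> {0<..<1}"
    and orth: "\<And>m::int. (LINT x|M. g x * cis (2 * pi * (\<beta> + of_int m) * X x)) = 0"
    and h [measurable]: "h \<in> borel_measurable borel" and bound: "\<And>t. cmod (h t) \<le> B"
  shows "(LINT x|M. g x * h (X x)) = 0"
proof -
  have [measurable]: "cis \<in> borel_measurable borel"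
    by (intro borel_measurable_continuous_onI continuous_intros)
  let ?g = "\<lambda>x. g x * cis (2 * pi * \<beta> * X x)"
  have gi: "integrable M ?g"
    by (rule integrable_mult_bounded[OF g, of _ 1]) auto
  have eq: "?g x * cis (2 * pi * of_int m * X x) = g x * cis (2 * pi * (\<beta> + of_int m) * X x)" for x and m :: int
    by (simp add: mult.assoc cis_mult ring_distribs)
  have orth': "(LINT x|M. ?g x * cis (2 * pi * of_int m * X x)) = 0" for m :: int
    unfolding eq by (rule orth)
  have "(LINT x|M. ?g x * indicator {a<..<b} (X x)) = 0" if "0 < a" "a < b" "b < 1" for a b
    using that by (intro integral_indicator_Ioo_eq_0[OF gi X range orth']) auto
  then have ind: "(LINT x|M. ?g x * indicator C (X x)) = 0" if "C \<in> sets borel" for C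
    by (intro integral_indicator_borel_eq_0[OF gi X range _ that]) auto
  have "(LINT x|M. ?g x * (cis (- (2 * pi * \<beta> * X x)) * h (X x))) = 0"
    by (rule integral_bounded_borel_eq_0[OF gi X ind, where h="\<lambda>t. cis (- (2 * pi * \<beta> * t)) * h t" and B=B])
      (use bound in \<open>auto simp: norm_mult\<close>)
  moreover have "?g x * (cis (- (2 * pi * \<beta> * X x)) * h (X x)) = g x * h (X x)" for x
  proof -
    have "?g x * (cis (- (2 * pi * \<beta> * X x)) * h (X x))
      = (cis (2 * pi * \<beta> * X x) * cis (- (2 * pi * \<beta> * X x))) * (g x * h (X x))"
      by (simp only: mult_ac)
    then show ?thesis by (simp add: cis_mult)
  qed
  ultimately show ?thesis by simp
qed

section \<open>Exponentials on the cube\<close>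

abbreviation unit_lborel :: "real measure" where
  "unit_lborel \<equiv> restrict_space lborel {0<..<1}"

lemma emeasure_unit_lborel: "emeasure unit_lborel (space unit_lborel) = 1"
  by (simp add: emeasure_restrict_space space_restrict_space)

interpretation unit_lborel: finite_measure unit_lborel
  by (rule finite_measureI) (simp only: emeasure_unit_lborel, simp)

interpretation unit_cube: product_sigma_finite "\<lambda>_::nat. unit_lborel"
  by unfold_locales

lemma space_unit_lborel: "space unit_lborel = {0<..<1}"
  by (simp add: space_restrict_space)

lemma space_cube_measure: "space (cube_measure J) = cube J"
  by (simp add: cube_measure_def cube_def space_PiM space_unit_lborel)

lemma borel_measurable_unit_lborel: "f \<in> borel_measurable borel \<Longrightarrow> f \<in> borel_measurable unit_lborel"
  by (simp add: measurable_restrict_space1)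

lemma measurable_coordinate [measurable]:
  "r \<in> J \<Longrightarrow> (\<lambda>x. x r) \<in> borel_measurable (cube_measure J)"
  unfolding cube_measure_def
  by (rule measurable_compose[OF measurable_component_singleton[of r J]])
    (simp_all add: borel_measurable_unit_lborel)

lemma coordinate_range: "x \<in> space (cube_measure J) \<Longrightarrow> r \<in> J \<Longrightarrow> x r \<in> {0<..<1}"
  unfolding space_cube_measure cube_def by (erule PiE_mem)

lemma emeasure_cube_measure:
  assumes "finite J"
  shows "emeasure (cube_measure J) (space (cube_measure J)) = 1"
proof -
  have "emeasure (cube_measure J) (Pi\<^sub>E J (\<lambda>_. space unit_lborel)) = (\<Prod>r\<in>J. emeasure unit_lborel (space unit_lborel))"
    unfolding cube_measure_def by (rule unit_cube.emeasure_PiM[OF assms]) (rule sets.top)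
  then show ?thesis using emeasure_unit_lborel by (simp add: cube_measure_def space_PiM space_unit_lborel)
qed

lemma finite_measure_cube_measure: "finite J \<Longrightarrow> finite_measure (cube_measure J)"
  by (rule finite_measureI) (simp add: emeasure_cube_measure)

text \<open>The admissible one-variable factors. The bound is 1, so that products over any set of
  coordinates are again bounded by 1.\<close>

definition unit_bounded :: "(real \<Rightarrow> complex) set" where
  "unit_bounded = {h \<in> borel_measurable borel. \<forall>t. cmod (h t) \<le> 1}"

lemma indicator_unit_bounded: "A \<in> sets borel \<Longrightarrow> indicator A \<in> unit_bounded"
  by (auto simp: unit_bounded_def indicator_def)

lemma borel_measurable_cis [measurable]: "cis \<in> borel_measurable borel"
  by (intro borel_measurable_continuous_onI continuous_intros)

lemma cis_unit_bounded: "(\<lambda>t. cis (c * t)) \<in> unit_bounded"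
  by (auto simp: unit_bounded_def)

lemma integrable_mult_prod:
  assumes g: "integrable (cube_measure J) g" and I: "I \<subseteq> J"
    and h: "\<And>r. r \<in> I \<Longrightarrow> h r \<in> unit_bounded"
  shows "integrable (cube_measure J) (\<lambda>x. g x * (\<Prod>r\<in>I. h r (x r)))"
proof (rule integrable_mult_bounded[OF g])
  show "(\<lambda>x. \<Prod>r\<in>I. h r (x r)) \<in> borel_measurable (cube_measure J)"
  proof (rule borel_measurable_prod)
    fix r assume "r \<in> I"
    then have [measurable]: "h r \<in> borel_measurable borel" and [simp]: "r \<in> J"
      using h I by (auto simp: unit_bounded_def)
    show "(\<lambda>x. h r (x r)) \<in> borel_measurable (cube_measure J)" by measurable
  qed
  show "cmod (\<Prod>r\<in>I. h r (x r)) \<le> 1" for x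
    unfolding prod_norm[symmetric] using h by (intro prod_le_1) (auto simp: unit_bounded_def)
qed

text \<open>Induction over the set \<open>S\<close> of coordinates whose factors have already been
  replaced. All factors but one are absorbed into the integrable function \<open>g'\<close>, which
  makes each replacement the one-variable statement \<open>step\<close>.\<close>

lemma integral_coordinatewise_eq_0:
  assumes J: "finite J" and g: "integrable (cube_measure J) g"
    and \<F>: "\<And>r. r \<in> J \<Longrightarrow> \<F> r \<subseteq> unit_bounded" and \<G>: "\<And>r. r \<in> J \<Longrightarrow> \<G> r \<subseteq> unit_bounded"
    and step: "\<And>r g' h. r \<in> J \<Longrightarrow> integrable (cube_measure J) g' \<Longrightarrow>
      (\<And>f. f \<in> \<F> r \<Longrightarrow> (LINT x|cube_measure J. g' x * f (x r)) = 0) \<Longrightarrow> h \<in> \<G> r \<Longrightarrow>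
      (LINT x|cube_measure J. g' x * h (x r)) = 0"
    and zero: "\<And>f. (\<And>r. r \<in> J \<Longrightarrow> f r \<in> \<F> r) \<Longrightarrow> (LINT x|cube_measure J. g x * (\<Prod>r\<in>J. f r (x r))) = 0"
    and h: "\<And>r. r \<in> J \<Longrightarrow> h r \<in> \<G> r"
  shows "(LINT x|cube_measure J. g x * (\<Prod>r\<in>J. h r (x r))) = 0"
proof -
  have "\<forall>h. (\<forall>r\<in>S. h r \<in> \<G> r) \<longrightarrow> (\<forall>r\<in>J - S. h r \<in> \<F> r) \<longrightarrow>
    (LINT x|cube_measure J. g x * (\<Prod>r\<in>J. h r (x r))) = 0" if "S \<subseteq> J" for S
    using finite_subset[OF that J] that
  proof (induction S rule: finite_induct)
    case empty
    then show ?case using zero by auto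
  next
    case (insert r S)
    then have r: "r \<in> J" by auto
    show ?case
    proof (intro allI impI)
      fix h assume hG: "\<forall>s\<in>insert r S. h s \<in> \<G> s" and hF: "\<forall>s\<in>J - insert r S. h s \<in> \<F> s"
      define g' where "g' x = g x * (\<Prod>s\<in>J - {r}. h s (x s))" for x
      have eq: "g x * (\<Prod>s\<in>J. (h(r := f)) s (x s)) = g' x * f (x r)" for f x
      proof -
        have "(\<Prod>s\<in>J - {r}. (h(r := f)) s (x s)) = (\<Prod>s\<in>J - {r}. h s (x s))" by (intro prod.cong) auto
        then show ?thesis using prod.remove[OF J r, of "\<lambda>s. (h(r := f)) s (x s)"] by (simp add: g'_def)
      qed
      have "h s \<in> unit_bounded" if "s \<in> J - {r}" for s
        using that hG hF \<F>[of s] \<G>[of s] by (cases "s \<in> S") auto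
      then have gi: "integrable (cube_measure J) g'"
        unfolding g'_def by (intro integrable_mult_prod g) auto
      have gz: "(LINT x|cube_measure J. g' x * f (x r)) = 0" if f: "f \<in> \<F> r" for f
      proof -
        have "(\<forall>s\<in>S. (h(r := f)) s \<in> \<G> s) \<and> (\<forall>s\<in>J - S. (h(r := f)) s \<in> \<F> s)"
          using hG hF f insert.hyps(2) by auto
        then have "(LINT x|cube_measure J. g x * (\<Prod>s\<in>J. (h(r := f)) s (x s))) = 0"
          using insert by blast
        then show ?thesis unfolding eq .
      qed
      have "(LINT x|cube_measure J. g' x * h r (x r)) = 0"
        by (rule step[OF r gi gz]) (use hG in auto)
      then have "(LINT x|cube_measure J. g x * (\<Prod>s\<in>J. (h(r := h r)) s (x s))) = 0" unfolding eq .
      then show "(LINT x|cube_measure J. g x * (\<Prod>s\<in>J. h s (x s))) = 0" by (simp only: fun_upd_triv)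
    qed
  qed
  from this[OF order_refl] h show ?thesis by auto
qed

text \<open>Boxes extend to measurable rectangles one coordinate at a time, and these to all
  measurable sets by Dynkin's argument. The totality of exponentials and the density of test
  functions both end here.\<close>

lemma AE_0_of_boxes:
  fixes g :: "(nat \<Rightarrow> real) \<Rightarrow> complex"
  assumes J: "finite J" and g: "integrable (cube_measure J) g"
    and box: "\<And>a b. (\<And>r. r \<in> J \<Longrightarrow> 0 < a r \<and> a r < b r \<and> b r < (1::real)) \<Longrightarrow>
      (LINT x|cube_measure J. g x * (\<Prod>r\<in>J. indicator {a r<..<b r} (x r))) = 0"
  shows "AE x in cube_measure J. g x = 0"
proof -
  let ?M = "cube_measure J"
  interpret finite_measure ?M by (rule finite_measure_cube_measure[OF J])
  have rect: "(LINT x|?M. g x * (\<Prod>r\<in>J. indicator (C r) (x r))) = 0"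
    if C: "\<And>r. r \<in> J \<Longrightarrow> C r \<in> sets borel" for C
  proof (rule integral_coordinatewise_eq_0[OF J g,
        where \<F> = "\<lambda>_. {indicator {a<..<b} |a b. 0 < a \<and> a < b \<and> b < 1}" and \<G> = "\<lambda>_. indicator ` sets borel"])
    fix r and g' :: "(nat \<Rightarrow> real) \<Rightarrow> complex" and h :: "real \<Rightarrow> complex"
    assume r: "r \<in> J" and g': "integrable ?M g'" and h: "h \<in> indicator ` sets borel"
      and z: "\<And>f. f \<in> {indicator {a<..<b} |a b. 0 < a \<and> a < b \<and> b < 1} \<Longrightarrow> (LINT x|?M. g' x * f (x r)) = 0"
    from h obtain D where D: "D \<in> sets borel" "h = indicator D" by auto
    show "(LINT x|?M. g' x * h (x r)) = 0"
      unfolding D(2)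
      by (rule integral_indicator_borel_eq_0[OF g' _ _ _ D(1)])
        (use r z coordinate_range in auto)
  next
    fix f :: "nat \<Rightarrow> real \<Rightarrow> complex"
    assume "\<And>r. r \<in> J \<Longrightarrow> f r \<in> {indicator {a<..<b} |a b. 0 < a \<and> a < b \<and> b < 1}"
    then have "\<forall>r\<in>J. \<exists>a b. f r = indicator {a<..<b} \<and> 0 < a \<and> a < b \<and> b < 1" by blast
    then obtain a b where ab: "\<And>r. r \<in> J \<Longrightarrow> f r = indicator {a r<..<b r} \<and> 0 < a r \<and> a r < b r \<and> b r < 1"
      by metis
    have "(\<Prod>r\<in>J. f r (x r)) = (\<Prod>r\<in>J. indicator {a r<..<b r} (x r))" for x
      using ab by (intro prod.cong) auto
    then show "(LINT x|?M. g x * (\<Prod>r\<in>J. f r (x r))) = 0" using box[of a b] ab by simp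
  qed (use C in \<open>auto simp: indicator_unit_bounded\<close>)
  have int: "set_integrable ?M A g" if "A \<in> sets ?M" for A
    using g that unfolding set_integrable_def by (intro integrable_mult_indicator)
  have gen: "sets ?M = sigma_sets (space ?M) {Pi\<^sub>E J X |X. X \<in> (\<Pi> r\<in>J. sets unit_lborel)}"
    using sets_PiM[of J "\<lambda>_. unit_lborel"] prod_algebra_eq_finite[OF J, of "\<lambda>_. unit_lborel"]
    by (simp add: cube_measure_def space_PiM)
  have basic: "(LINT x:Pi\<^sub>E J X|?M. g x) = 0" if X: "X \<in> (\<Pi> r\<in>J. sets unit_lborel)" for X
  proof -
    have "(LINT x:Pi\<^sub>E J X|?M. g x) = (LINT x|?M. g x * (\<Prod>r\<in>J. indicator (X r) (x r)))"
      unfolding set_lebesgue_integral_def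
    proof (rule Bochner_Integration.integral_cong)
      fix x assume "x \<in> space ?M"
      then have "indicator (Pi\<^sub>E J X) x = (\<Prod>r\<in>J. indicator (X r) (x r) :: real)"
        using J by (auto simp: indicator_def PiE_iff space_cube_measure cube_def)
      then show "indicator (Pi\<^sub>E J X) x *\<^sub>R g x = g x * (\<Prod>r\<in>J. indicator (X r) (x r))"
        by (simp add: scaleR_conv_of_real of_real_prod of_real_indicator mult.commute)
    qed simp
    also have "\<dots> = 0"
    proof (rule rect)
      fix r assume "r \<in> J"
      then have "X r \<in> sets unit_lborel" using X by auto
      then show "X r \<in> sets borel" by (auto simp: sets_restrict_space_iff)
    qed
    finally show ?thesis .
  qed
  have sp: "space ?M = Pi\<^sub>E J (\<lambda>_. space unit_lborel)" by (simp add: cube_measure_def space_PiM)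
  have "(\<lambda>_. space unit_lborel) \<in> (\<Pi> r\<in>J. sets unit_lborel)" by (rule Pi_I) (rule sets.top)
  then have whole: "(LINT x:space ?M|?M. g x) = 0" unfolding sp by (rule basic)
  have "(LINT x:A|?M. g x) = 0" if A: "A \<in> sets ?M" for A
  proof -
    have "Int_stable {Pi\<^sub>E J X |X. X \<in> (\<Pi> r\<in>J. sets unit_lborel)}"
      using Int_stable_PiE[of J J "\<lambda>_. unit_lborel"] by (simp only: Pi_iff)
    moreover have "{Pi\<^sub>E J X |X. X \<in> (\<Pi> r\<in>J. sets unit_lborel)} \<subseteq> Pow (space ?M)"
    proof -
      have "Pi\<^sub>E J X \<subseteq> space ?M" if "X \<in> (\<Pi> r\<in>J. sets unit_lborel)" for X
        unfolding sp using that by (intro PiE_mono sets.sets_into_space) auto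
      then show ?thesis by blast
    qed
    moreover have "A \<in> sigma_sets (space ?M) {Pi\<^sub>E J X |X. X \<in> (\<Pi> r\<in>J. sets unit_lborel)}"
      using A gen by simp
    ultimately show ?thesis
    proof (induction rule: sigma_sets_induct_disjoint)
      case (compl B)
      have B: "B \<in> sets ?M" using compl gen by simp
      have "(LINT x:B \<union> (space ?M - B)|?M. g x) = (LINT x:B|?M. g x) + (LINT x:space ?M - B|?M. g x)"
        using B int by (intro set_integral_Un) auto
      moreover have "B \<union> (space ?M - B) = space ?M" using sets.sets_into_space[OF B] by auto
      ultimately show ?case using whole compl by simp
    next
      case (union B)
      have B: "B i \<in> sets ?M" for i using union gen by auto
      have "(LINT x:(\<Union>i. B i)|?M. g x) = (\<Sum>i. LINT x:B i|?M. g x)"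
        using B union(1) int[of "\<Union>i. B i"] by (intro lebesgue_integral_countable_add) (auto simp: disjoint_family_on_def)
      then show ?case using union by simp
    qed (use basic in \<open>auto simp: set_lebesgue_integral_def\<close>)
  qed
  then show ?thesis by (intro density_zero[OF g])
qed

section \<open>Tensor products of exponentials and their totality\<close>

lemma tensor_exp_eq_cis: "tensor_exp J \<xi> x = (\<Prod>r\<in>J. cis (2 * pi * \<xi> r * x r))"
  by (simp add: tensor_exp_def cis_conv_exp)

lemma cnj_tensor_exp: "cnj (tensor_exp J \<xi> x) = (\<Prod>r\<in>J. cis (- (2 * pi * \<xi> r) * x r))"
  by (simp add: tensor_exp_eq_cis cnj_prod cis_cnj)

lemma norm_tensor_exp [simp]: "cmod (tensor_exp J \<xi> x) = 1"
  by (simp add: tensor_exp_eq_cis prod_norm[symmetric])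

lemma borel_measurable_tensor_exp [measurable]:
  assumes "I \<subseteq> J"
  shows "tensor_exp I \<xi> \<in> borel_measurable (cube_measure J)"
  unfolding tensor_exp_eq_cis[abs_def]
proof (rule borel_measurable_prod)
  fix r assume "r \<in> I"
  then have [simp]: "r \<in> J" using assms by auto
  show "(\<lambda>x. cis (2 * pi * \<xi> r * x r)) \<in> borel_measurable (cube_measure J)" by measurable
qed

lemma tensor_exp_L2: "finite J \<Longrightarrow> I \<subseteq> J \<Longrightarrow> tensor_exp I \<xi> \<in> L2 (cube_measure J)"
  using borel_measurable_tensor_exp[of I J \<xi>]
  by (simp add: L2_def finite_measure.integrable_const[OF finite_measure_cube_measure])

lemma integral_tensor_exp_coordinate:
  assumes J: "finite J" "k \<in> J" and g: "integrable (cube_measure J) g"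
    and orth: "\<And>m::int. (LINT x|cube_measure J. g x * cnj (tensor_exp J (\<xi>(k := \<beta> + of_int m)) x)) = 0"
    and h: "h \<in> unit_bounded"
  shows "(LINT x|cube_measure J. g x * (\<Prod>r\<in>J - {k}. cis (- (2 * pi * \<xi> r) * x r)) * h (x k)) = 0"
proof (rule integral_exponentials_eq_0[where \<beta> = "- \<beta>" and B = 1])
  show "integrable (cube_measure J) (\<lambda>x. g x * (\<Prod>r\<in>J - {k}. cis (- (2 * pi * \<xi> r) * x r)))"
    by (rule integrable_mult_prod[OF g _ cis_unit_bounded]) auto
  fix m :: int
  \<comment> \<open>Conjugation negates frequencies, which accounts for \<open>- \<beta>\<close> and
    \<open>- m\<close>.\<close>
  have "cnj (tensor_exp J (\<xi>(k := \<beta> + of_int (- m))) x) =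
    (\<Prod>r\<in>J - {k}. cis (- (2 * pi * \<xi> r) * x r)) * cis (2 * pi * (- \<beta> + of_int m) * x k)" for x
  proof -
    have "(\<Prod>r\<in>J - {k}. cis (- (2 * pi * (\<xi>(k := \<beta> + of_int (- m))) r) * x r)) =
      (\<Prod>r\<in>J - {k}. cis (- (2 * pi * \<xi> r) * x r))" by (intro prod.cong) auto
    moreover have "- (2 * pi * (\<beta> + of_int (- m))) * x k = 2 * pi * (- \<beta> + of_int m) * x k"
      by (simp add: algebra_simps)
    ultimately show ?thesis
      unfolding cnj_tensor_exp prod.remove[OF J, of "\<lambda>r. cis (- (2 * pi * (\<xi>(k := \<beta> + of_int (- m))) r) * x r)"]
      by (simp only: fun_upd_same mult.commute)
  qed
  then show "(LINT x|cube_measure J. g x * (\<Prod>r\<in>J - {k}. cis (- (2 * pi * \<xi> r) * x r)) *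
      cis (2 * pi * (- \<beta> + of_int m) * x k)) = 0"
    using orth[of "- m"] by (simp only: mult.assoc)
qed (use J h in \<open>auto simp: unit_bounded_def coordinate_range[simplified]\<close>)

text \<open>\<open>\<beta>\<close> and \<open>\<xi> k\<close> may lie in different cosets of the
  integers. This is how one phase in a variable is exchanged for another when the joint eigenvectors
  are shown to be total.\<close>

lemma integral_tensor_exp_swap:
  assumes J: "finite J" "k \<in> J" and g: "integrable (cube_measure J) g"
    and orth: "\<And>m::int. (LINT x|cube_measure J. g x * cnj (tensor_exp J (\<xi>(k := \<beta> + of_int m)) x)) = 0"
  shows "(LINT x|cube_measure J. g x * cnj (tensor_exp J \<xi> x)) = 0"
  using integral_tensor_exp_coordinate[OF J g orth cis_unit_bounded[of "- (2 * pi * \<xi> k)"]]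
  unfolding cnj_tensor_exp prod.remove[OF J, of "\<lambda>r. cis (- (2 * pi * \<xi> r) * _ r)"]
  by (simp only: mult_ac)

text \<open>With the other indices fixed, the frequencies in the variable \<open>j\<close> fill a
  whole coset of the integers, so the factor in \<open>j\<close> is freed first. Then the dependence
  on \<open>\<theta>\<close> is gone, and the other factors run through full sets of exponentials
  independently of each other.\<close>

lemma tensor_exp_total:
  fixes \<alpha> :: "nat \<Rightarrow> real" and \<theta> :: "(nat \<Rightarrow> int) \<Rightarrow> real"
  assumes J: "finite J" "j \<in> J" and g: "integrable (cube_measure J) g"
    and orth: "\<And>n. (LINT x|cube_measure J. g x *
      cnj (tensor_exp J (\<lambda>r. (if r = j then \<theta> (restrict n (J - {j})) else \<alpha> r) + of_int (n r)) x)) = 0"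
  shows "AE x in cube_measure J. g x = 0"
proof (rule AE_0_of_boxes[OF J(1) g])
  let ?M = "cube_measure J"
  let ?F = "\<lambda>r. if r = j then unit_bounded else range (\<lambda>m::int. \<lambda>t. cis (- (2 * pi * (\<alpha> r + of_int m)) * t))"
  have all: "(LINT x|?M. g x * (\<Prod>r\<in>J. h r (x r))) = 0" if h: "\<And>r. r \<in> J \<Longrightarrow> h r \<in> unit_bounded" for h
  proof (rule integral_coordinatewise_eq_0[OF J(1) g, where \<F> = ?F and \<G> = "\<lambda>_. unit_bounded"])
    have "range (\<lambda>m::int. \<lambda>t. cis (- (2 * pi * (\<alpha> r + of_int m)) * t)) \<subseteq> unit_bounded" for r
      by (rule image_subsetI) (rule cis_unit_bounded)
    then show "?F r \<subseteq> unit_bounded" for r by simp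
  next
    fix r and g' :: "(nat \<Rightarrow> real) \<Rightarrow> complex" and k assume r: "r \<in> J" and g': "integrable ?M g'" and k: "k \<in> unit_bounded"
      and z: "\<And>f. f \<in> ?F r \<Longrightarrow> (LINT x|?M. g' x * f (x r)) = 0"
    show "(LINT x|?M. g' x * k (x r)) = 0"
    proof (cases "r = j")
      case False
      show ?thesis
      proof (rule integral_exponentials_eq_0[OF g', where \<beta> = "- \<alpha> r" and B = 1])
        fix m :: int
        have "(LINT x|?M. g' x * cis (- (2 * pi * (\<alpha> r + of_int (- m))) * x r)) = 0"
          by (rule z[of "\<lambda>t. cis (- (2 * pi * (\<alpha> r + of_int (- m))) * t)"])
            (simp only: False if_False, rule range_eqI[of _ _ "- m"], rule refl)
        moreover have "- (2 * pi * (\<alpha> r + of_int (- m))) = 2 * pi * (- \<alpha> r + of_int m)" by (simp add: algebra_simps)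
        ultimately show "(LINT x|?M. g' x * cis (2 * pi * (- \<alpha> r + of_int m) * x r)) = 0" by (simp only:)
      qed (use r k in \<open>auto simp: unit_bounded_def coordinate_range[simplified]\<close>)
    qed (use z k in auto)
  next
    fix f assume f: "\<And>r. r \<in> J \<Longrightarrow> f r \<in> ?F r"
    have "\<forall>r\<in>J - {j}. \<exists>m::int. f r = (\<lambda>t. cis (- (2 * pi * (\<alpha> r + of_int m)) * t))"
  proof (intro ballI)
    fix r assume "r \<in> J - {j}"
    then have "f r \<in> range (\<lambda>m::int. \<lambda>t. cis (- (2 * pi * (\<alpha> r + of_int m)) * t))"
      using f[of r] by simp
    then show "\<exists>m::int. f r = (\<lambda>t. cis (- (2 * pi * (\<alpha> r + of_int m)) * t))"
      by (elim rangeE, intro exI)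
  qed
    then obtain n :: "nat \<Rightarrow> int" where n: "\<And>r. r \<in> J - {j} \<Longrightarrow> f r = (\<lambda>t. cis (- (2 * pi * (\<alpha> r + of_int (n r))) * t))"
      by metis
    let ?\<xi> = "\<lambda>r. \<alpha> r + of_int (n r)"
    have "(LINT x|?M. g x * (\<Prod>r\<in>J - {j}. cis (- (2 * pi * ?\<xi> r) * x r)) * f j (x j)) = 0"
    proof (rule integral_tensor_exp_coordinate[OF J g, where \<beta> = "\<theta> (restrict n (J - {j}))"])
      fix m :: int
      have "restrict (n(j := m)) (J - {j}) = restrict n (J - {j})" by (auto simp: restrict_def)
      moreover have "(\<lambda>r. (if r = j then \<theta> (restrict n (J - {j})) else \<alpha> r) + of_int ((n(j := m)) r))
        = ?\<xi>(j := \<theta> (restrict n (J - {j})) + of_int m)" by auto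
      ultimately show "(LINT x|?M. g x * cnj (tensor_exp J (?\<xi>(j := \<theta> (restrict n (J - {j})) + of_int m)) x)) = 0"
        using orth[of "n(j := m)"] by (simp only:)
    qed (use f[OF J(2)] in simp)
    moreover have "(\<Prod>r\<in>J. f r (x r)) = (\<Prod>r\<in>J - {j}. cis (- (2 * pi * ?\<xi> r) * x r)) * f j (x j)" for x
    proof -
      have "(\<Prod>r\<in>J - {j}. f r (x r)) = (\<Prod>r\<in>J - {j}. cis (- (2 * pi * ?\<xi> r) * x r))"
        by (intro prod.cong refl) (simp only: n)
      then show ?thesis
        unfolding prod.remove[OF J, of "\<lambda>r. f r (x r)"] by (simp only: mult.commute)
    qed
    ultimately show "(LINT x|?M. g x * (\<Prod>r\<in>J. f r (x r))) = 0" by (simp only: mult.assoc)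
  qed (use h in auto)
  show "(LINT x|?M. g x * (\<Prod>r\<in>J. indicator {a r<..<b r} (x r))) = 0" for a b
    by (rule all) (simp add: indicator_unit_bounded)
qed

section \<open>Inner products of exponentials\<close>

definition exp_mean :: "real \<Rightarrow> complex" where
  "exp_mean \<delta> = (LINT t|unit_lborel. cis (2 * pi * \<delta> * t))"

lemma exp_mean_0 [simp]: "exp_mean 0 = 1"
proof -
  have "measure unit_lborel (space unit_lborel) = 1"
    unfolding measure_def emeasure_unit_lborel by simp
  then show ?thesis by (simp add: exp_mean_def)
qed

lemma exp_mean_nonzero:
  assumes "\<delta> \<noteq> 0"
  shows "exp_mean \<delta> = (cis (2 * pi * \<delta>) - 1) / (2 * pi * \<delta> * \<i>)"
proof -
  define c where "c = 2 * pi * \<delta>"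
  have "c \<noteq> 0" using assms by (simp add: c_def)
  have "exp_mean \<delta> = (LINT t:{0<..<1}|lborel. cis (c * t))"
    unfolding exp_mean_def c_def by (subst integral_restrict_space) (simp_all add: set_lebesgue_integral_def)
  also have "\<dots> = (LBINT t=0..1. cis (c * t))"
  proof -
    have "{x. 0 < x \<and> x < 1} = {0<..<1::real}" by auto
    then show ?thesis by (simp add: interval_lebesgue_integral_def einterval_def zero_ereal_def one_ereal_def)
  qed
  also have "\<dots> = cis (c * 1) / (c * \<i>) - cis (c * 0) / (c * \<i>)"
  proof (rule interval_integral_FTC_finite[of 0 1, unfolded zero_ereal_def[symmetric] one_ereal_def[symmetric]])
    show "continuous_on {min 0 1..max 0 1} (\<lambda>t. cis (c * t))" by (intro continuous_intros)
    fix t :: real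
    have "((\<lambda>t. exp (\<i> * (c * t)) / (c * \<i>)) has_vector_derivative exp (\<i> * (c * t))) (at t within {min 0 1..max 0 1})"
      using \<open>c \<noteq> 0\<close> by (auto intro!: derivative_eq_intros has_vector_derivative_real_field simp: field_simps)
    then show "((\<lambda>t. cis (c * t) / (c * \<i>)) has_vector_derivative cis (c * t)) (at t within {min 0 1..max 0 1})"
      by (simp add: cis_conv_exp)
  qed
  finally show ?thesis by (simp add: c_def diff_divide_distrib)
qed

lemma cis_2pi_eq_1_iff: "cis (2 * pi * \<delta>) = 1 \<longleftrightarrow> \<delta> \<in> \<int>"
proof -
  have "cis (2 * pi * \<delta>) = 1 \<longleftrightarrow> (\<exists>n::int. 2 * pi * \<delta> = of_int (2 * n) * pi)"
    unfolding cis_conv_exp by (subst exp_eq_1) simp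
  also have "\<dots> \<longleftrightarrow> (\<exists>n::int. \<delta> = of_int n)" by simp
  finally show ?thesis by (auto simp: Ints_def)
qed

lemma exp_mean_eq_0_iff: "exp_mean \<delta> = 0 \<longleftrightarrow> \<delta> \<in> \<int> \<and> \<delta> \<noteq> 0"
proof (cases "\<delta> = 0")
  case False
  then show ?thesis unfolding exp_mean_nonzero[OF False] using cis_2pi_eq_1_iff[of \<delta>] by simp
qed simp

lemma inner_tensor_exp:
  assumes "finite J"
  shows "l2_inner (cube_measure J) (tensor_exp J \<xi>) (tensor_exp J \<eta>) = (\<Prod>r\<in>J. exp_mean (\<xi> r - \<eta> r))"
proof -
  have "tensor_exp J \<xi> x * cnj (tensor_exp J \<eta> x) = (\<Prod>r\<in>J. cis (2 * pi * (\<xi> r - \<eta> r) * x r))" for x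
    unfolding cnj_tensor_exp unfolding tensor_exp_eq_cis prod.distrib[symmetric] cis_mult
    by (intro prod.cong refl arg_cong[where f=cis]) (simp add: algebra_simps)
  then have "l2_inner (cube_measure J) (tensor_exp J \<xi>) (tensor_exp J \<eta>) =
    (LINT x|cube_measure J. (\<Prod>r\<in>J. cis (2 * pi * (\<xi> r - \<eta> r) * x r)))"
    by (simp add: l2_inner_def)
  also have "\<dots> = (\<Prod>r\<in>J. exp_mean (\<xi> r - \<eta> r))"
    unfolding cube_measure_def exp_mean_def
  proof (rule unit_cube.product_integral_prod[OF assms])
    show "integrable unit_lborel (\<lambda>t. cis (2 * pi * (\<xi> r - \<eta> r) * t))" for r
      by (rule unit_lborel.integrable_const_bound[of _ 1])
        (auto intro!: borel_measurable_unit_lborel)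
  qed
  finally show ?thesis .
qed

text \<open>Non-orthogonality matters as much as orthogonality: frequencies with a non-integer
  difference never give zero. This makes the decisive coefficients in the necessity proof
  nonzero.\<close>

lemma inner_tensor_exp_eq_0_iff:
  "finite J \<Longrightarrow> l2_inner (cube_measure J) (tensor_exp J \<xi>) (tensor_exp J \<eta>) = 0 \<longleftrightarrow>
    (\<exists>r\<in>J. \<xi> r - \<eta> r \<in> \<int> \<and> \<xi> r \<noteq> \<eta> r)"
  by (auto simp: inner_tensor_exp exp_mean_eq_0_iff)

section \<open>Density of the test functions\<close>

text \<open>For \<open>p = 1\<close> and \<open>k = 0\<close> this tends to the indicator of the
  open interval as \<open>c\<close> tends to 0; general \<open>p\<close> and \<open>k\<close>
  account for the derivatives.\<close>

definition bump :: "real \<Rightarrow> real \<Rightarrow> real \<Rightarrow> real poly \<Rightarrow> nat \<Rightarrow> real \<Rightarrow> real" where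
  "bump c a b p k t = (if a < t \<and> t < b
     then poly p t / ((t - a) * (b - t)) ^ k * exp (- c / ((t - a) * (b - t))) else 0)"

text \<open>A single term of the exponential series of \<open>c * y\<close> is at most its
  sum.\<close>

lemma power_mult_exp_minus_le:
  fixes c y :: real
  assumes "c > 0" "y \<ge> 0"
  shows "y ^ m * exp (- c * y) \<le> fact m / c ^ m"
proof -
  have "(\<Sum>i\<in>{m}. (c * y) ^ i /\<^sub>R fact i) \<le> exp (c * y)"
    unfolding exp_def using assms by (intro sum_le_suminf summable_exp_generic) auto
  then have "(c * y) ^ m \<le> fact m * exp (c * y)"
    by (simp add: field_simps)
  then have "y ^ m * c ^ m \<le> fact m * exp (c * y)"
    by (simp add: power_mult_distrib mult.commute)
  then show ?thesis using assms by (simp add: exp_minus field_simps)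
qed

text \<open>
  The functions \<open>bump c a b p k\<close> are flat at the endpoints of their support, and differentiation
  only changes the parameters \<open>p\<close> and \<open>k\<close>.
\<close>

lemma bump_le_square:
  assumes "c > 0" "a < b"
  obtains K where "\<And>t. \<bar>bump c a b p k t\<bar> \<le> K * (t - a)\<^sup>2" "\<And>t. \<bar>bump c a b p k t\<bar> \<le> K * (t - b)\<^sup>2"
proof -
  have "bounded (poly p ` {a..b})"
    by (intro compact_imp_bounded compact_continuous_image continuous_intros) auto
  then obtain Q where Q: "Q > 0" "\<And>t. t \<in> {a..b} \<Longrightarrow> \<bar>poly p t\<bar> \<le> Q"
    unfolding bounded_pos by auto
  \<comment> \<open>Of the exponent \<open>k + 2\<close>, the part \<open>k\<close> cancels the pole
    of the bump and the part 2 supplies the square.\<close>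
  define D where "D = fact (k + 2) / c ^ (k + 2)"
  have D: "D \<ge> 0" using assms by (simp add: D_def)
  have main: "\<bar>bump c a b p k t\<bar> \<le> Q * D * ((t - a) * (b - t))\<^sup>2" if t: "a < t" "t < b" for t
  proof -
    define w where "w = (t - a) * (b - t)"
    have w: "w > 0" using t by (simp add: w_def)
    have "(1 / w) ^ (k + 2) * exp (- c * (1 / w)) \<le> D"
      unfolding D_def using assms w by (intro power_mult_exp_minus_le) auto
    then have "(1 / w) ^ (k + 2) * exp (- c * (1 / w)) * w\<^sup>2 \<le> D * w\<^sup>2"
      by (intro mult_right_mono) auto
    moreover have "(1 / w) ^ (k + 2) * exp (- c * (1 / w)) * w\<^sup>2 = exp (- c / w) / w ^ k"
      using w by (simp add: power_add field_simps power2_eq_square)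
    ultimately have e: "exp (- c / w) / w ^ k \<le> D * w\<^sup>2" by simp
    have "\<bar>bump c a b p k t\<bar> = \<bar>poly p t\<bar> * (exp (- c / w) / w ^ k)"
      using t w by (simp add: bump_def w_def[symmetric] abs_mult)
    also have "\<dots> \<le> Q * (D * w\<^sup>2)"
      using Q(2)[of t] Q(1) t e w by (intro mult_mono) auto
    finally show ?thesis by (simp add: w_def mult.assoc)
  qed
  have QD: "0 \<le> Q * D * (b - a)\<^sup>2" using Q D by simp
  show thesis
  proof (rule that[of "Q * D * (b - a)\<^sup>2"])
    fix t
    have sq: "((t - a) * (b - t))\<^sup>2 \<le> (b - a)\<^sup>2 * (t - a)\<^sup>2" "((t - a) * (b - t))\<^sup>2 \<le> (b - a)\<^sup>2 * (t - b)\<^sup>2"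
      if "a < t" "t < b"
    proof -
      have "(b - t)\<^sup>2 \<le> (b - a)\<^sup>2" "(t - a)\<^sup>2 \<le> (b - a)\<^sup>2" using that by (auto intro!: power_mono)
      then show "((t - a) * (b - t))\<^sup>2 \<le> (b - a)\<^sup>2 * (t - a)\<^sup>2" "((t - a) * (b - t))\<^sup>2 \<le> (b - a)\<^sup>2 * (t - b)\<^sup>2"
        using mult_left_mono[of "(b - t)\<^sup>2" "(b - a)\<^sup>2" "(t - a)\<^sup>2"]
          mult_right_mono[of "(t - a)\<^sup>2" "(b - a)\<^sup>2" "(b - t)\<^sup>2"]
        by (simp_all add: power_mult_distrib power2_commute[of t b] mult.commute)
    qed
    show "\<bar>bump c a b p k t\<bar> \<le> Q * D * (b - a)\<^sup>2 * (t - a)\<^sup>2"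
    proof (cases "a < t \<and> t < b")
      case True
      then show ?thesis using order_trans[OF main mult_left_mono[OF sq(1), of "Q * D"]] Q D by (simp add: mult.assoc)
    next
      case False
      then have "bump c a b p k t = 0" by (auto simp: bump_def)
      then show ?thesis using QD by simp
    qed
    show "\<bar>bump c a b p k t\<bar> \<le> Q * D * (b - a)\<^sup>2 * (t - b)\<^sup>2"
    proof (cases "a < t \<and> t < b")
      case True
      then show ?thesis using order_trans[OF main mult_left_mono[OF sq(2), of "Q * D"]] Q D by (simp add: mult.assoc)
    next
      case False
      then have "bump c a b p k t = 0" by (auto simp: bump_def)
      then show ?thesis using QD by simp
    qed
  qed
qed

lemma has_real_derivative_0_of_square_bound:
  fixes f :: "real \<Rightarrow> real"
  assumes "\<And>t. \<bar>f t\<bar> \<le> K * (t - x)\<^sup>2"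
  shows "(f has_real_derivative 0) (at x)"
proof -
  have fx: "f x = 0" using assms[of x] by simp
  have "((\<lambda>t. (f t - f x) / (t - x)) \<longlongrightarrow> 0) (at x)"
  proof (rule Lim_null_comparison)
    have "\<bar>(f t - f x) / (t - x)\<bar> \<le> K * \<bar>t - x\<bar>" if "t \<noteq> x" for t
      using assms[of t] that by (simp add: fx divide_le_eq power2_eq_square abs_mult_self_eq mult.assoc)
    then show "\<forall>\<^sub>F t in at x. norm ((f t - f x) / (t - x)) \<le> K * \<bar>t - x\<bar>"
      by (auto simp: eventually_at_filter)
    have "((\<lambda>t. K * \<bar>t - x\<bar>) \<longlongrightarrow> K * \<bar>x - x\<bar>) (at x)" by (intro tendsto_intros)
    then show "((\<lambda>t. K * \<bar>t - x\<bar>) \<longlongrightarrow> 0) (at x)" by simp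
  qed
  then show ?thesis by (simp add: has_field_derivative_iff)
qed

lemma bump_has_derivative:
  assumes "c > 0" "a < b"
  shows "\<exists>q l. \<forall>t. (bump c a b p k has_real_derivative bump c a b q l t) (at t)"
proof -
  define W where "W = [:- a, 1:] * [:b, - 1:]"
  \<comment> \<open>The numerator when the three terms of the derivative of
    \<open>p / W ^ k * exp (- c / W)\<close> are brought to the common denominator
    \<open>W ^ (k + 2)\<close>.\<close>
  define q where "q = pderiv p * W\<^sup>2 - smult (of_nat k) (p * pderiv W * W) + smult c (p * pderiv W)"
  have W: "poly W t = (t - a) * (b - t)" for t by (simp add: W_def algebra_simps)
  have "(bump c a b p k has_real_derivative bump c a b q (k + 2) t) (at t)" for t
  proof -
    consider "a < t" "t < b" | "t < a \<or> t > b" | "t = a \<or> t = b" using assms by linarith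
    then show ?thesis
    proof cases
      case 1
      then have w: "poly W t > 0" by (simp add: W)
      define u where "u = inverse (poly W t)"
      have Wu: "poly W t * u = 1" using w by (simp add: u_def)
      have dW: "(poly W has_real_derivative poly (pderiv W) t) (at t)" by (rule poly_DERIV)
      have du: "((\<lambda>s. inverse (poly W s)) has_real_derivative - (poly (pderiv W) t * u\<^sup>2)) (at t)"
        using DERIV_inverse'[OF dW] w by (simp add: u_def power2_eq_square mult_ac)
      have duk: "((\<lambda>s. inverse (poly W s) ^ k) has_real_derivative - (of_nat k * poly (pderiv W) t * u ^ (k + 1))) (at t)"
        using DERIV_power[OF du, of k] by (cases k) (simp_all add: u_def power2_eq_square mult_ac)
      have de: "((\<lambda>s. exp (- c * inverse (poly W s))) has_real_derivative
          exp (- c * u) * (c * poly (pderiv W) t * u\<^sup>2)) (at t)"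
        using DERIV_chain2[OF DERIV_exp DERIV_cmult[OF du, of "- c"]] by (simp add: u_def mult_ac)
      have alg: "(poly (pderiv p) t * u ^ k + - (of_nat k * poly (pderiv W) t * u ^ (k + 1)) * poly p t) * exp (- c * u) +
          exp (- c * u) * (c * poly (pderiv W) t * u\<^sup>2) * (poly p t * u ^ k) = poly q t * u ^ (k + 2) * exp (- c * u)"
      proof -
        have "(poly (pderiv p) t * u ^ k + - (of_nat k * poly (pderiv W) t * u ^ (k + 1)) * poly p t) * exp (- c * u) +
            exp (- c * u) * (c * poly (pderiv W) t * u\<^sup>2) * (poly p t * u ^ k) =
            (poly (pderiv p) t * u ^ k - of_nat k * poly p t * poly (pderiv W) t * u ^ (k + 1)
            + c * poly p t * poly (pderiv W) t * u ^ (k + 2)) * exp (- c * u)"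
          by (simp add: algebra_simps power2_eq_square)
        moreover have "poly q t * u ^ (k + 2) = poly (pderiv p) t * u ^ k * (poly W t * u)\<^sup>2
            - of_nat k * poly p t * poly (pderiv W) t * u ^ (k + 1) * (poly W t * u)
            + c * poly p t * poly (pderiv W) t * u ^ (k + 2)"
          by (simp add: q_def algebra_simps power2_eq_square)
        ultimately show ?thesis unfolding Wu by simp
      qed
      have "((\<lambda>s. poly p s * inverse (poly W s) ^ k * exp (- c * inverse (poly W s))) has_real_derivative
          poly q t * u ^ (k + 2) * exp (- c * u)) (at t)"
        using DERIV_mult[OF DERIV_mult[OF poly_DERIV[of p t] duk] de]
        unfolding u_def[symmetric] alg .
      then have "((\<lambda>s. poly p s / poly W s ^ k * exp (- c / poly W s)) has_real_derivative
          poly q t / poly W t ^ (k + 2) * exp (- c / poly W t)) (at t)"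
        by (simp only: u_def divide_inverse power_inverse)
      then have "(bump c a b p k has_real_derivative poly q t / poly W t ^ (k + 2) * exp (- c / poly W t)) (at t)"
        by (rule has_field_derivative_transform_within_open[of _ _ _ "{a<..<b}"])
          (use 1 in \<open>auto simp: bump_def W\<close>)
      then show ?thesis using 1 by (simp add: bump_def W)
    next
      case 2
      have "((\<lambda>_. 0) has_real_derivative 0) (at t)" by simp
      then have "(bump c a b p k has_real_derivative 0) (at t)"
        by (rule has_field_derivative_transform_within_open[of _ _ _ "- {a..b}"])
          (use 2 in \<open>auto simp: bump_def\<close>)
      then show ?thesis using 2 by (auto simp: bump_def)
    next
      case 3
      \<comment> \<open>At the endpoints the quadratic bound forces the derivative 0, which is the
        value of every bump there.\<close>
      obtain K where "\<And>t. \<bar>bump c a b p k t\<bar> \<le> K * (t - a)\<^sup>2" "\<And>t. \<bar>bump c a b p k t\<bar> \<le> K * (t - b)\<^sup>2"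
        using bump_le_square[OF assms] by metis
      then have "(bump c a b p k has_real_derivative 0) (at t)"
        using 3 has_real_derivative_0_of_square_bound by blast
      then show ?thesis using 3 by (auto simp: bump_def)
    qed
  qed
  then show ?thesis by blast
qed

definition complex_bumps :: "real \<Rightarrow> real \<Rightarrow> real \<Rightarrow> (real \<Rightarrow> complex) set" where
  "complex_bumps c a b = {\<lambda>t. of_real (bump c a b p k t) |p k. True}"

lemma complex_bumps_derivative:
  assumes "c > 0" "a < b" "h \<in> complex_bumps c a b"
  shows "\<exists>h'\<in>complex_bumps c a b. \<forall>t. (h has_vector_derivative h' t) (at t)"
proof -
  from assms(3) obtain p k where h: "h = (\<lambda>t. of_real (bump c a b p k t))"
    unfolding complex_bumps_def by auto
  obtain q l where ql: "\<And>t. (bump c a b p k has_real_derivative bump c a b q l t) (at t)"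
    using bump_has_derivative[OF assms(1,2)] by metis
  have "(h has_vector_derivative of_real (bump c a b q l t)) (at t)" for t
    unfolding h using ql[of t] by (intro has_vector_derivative_of_real) (simp add: has_real_derivative_iff_has_vector_derivative)
  moreover have "(\<lambda>t. of_real (bump c a b q l t)) \<in> complex_bumps c a b"
    by (auto simp: complex_bumps_def)
  ultimately show ?thesis by (intro bexI[where x = "\<lambda>t. of_real (bump c a b q l t)"] allI)
qed

text \<open>The second part is an equality of functions everywhere, not only on the cube, so that it
  can be rewritten inside \<open>C_k_on_cube\<close>.\<close>

lemma pderiv_at_prod:
  assumes J: "finite J" "j \<in> J" and h: "\<And>t. (g j has_vector_derivative h t) (at t)"
  shows "((\<lambda>t. \<Prod>r\<in>J. g r ((x(j := t)) r)) has_vector_derivative (\<Prod>r\<in>J. (g(j := h)) r ((x(j := s)) r))) (at s)"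
    and "pderiv_at j (\<lambda>x. \<Prod>r\<in>J. g r (x r)) = (\<lambda>x. \<Prod>r\<in>J. (g(j := h)) r (x r) :: complex)"
proof -
  have eq: "(\<Prod>r\<in>J. (g(j := k)) r ((x(j := t)) r)) = k t * (\<Prod>r\<in>J - {j}. g r (x r))" for k t x
  proof -
    have "(\<Prod>r\<in>J - {j}. (g(j := k)) r ((x(j := t)) r)) = (\<Prod>r\<in>J - {j}. g r (x r))"
      by (intro prod.cong) auto
    then show ?thesis using prod.remove[OF J, of "\<lambda>r. (g(j := k)) r ((x(j := t)) r)"] by simp
  qed
  have eq': "(\<Prod>r\<in>J. g r ((x(j := t)) r)) = g j t * (\<Prod>r\<in>J - {j}. g r (x r))" for t x
    using eq[of "g j"] by (simp only: fun_upd_triv)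
  show D: "((\<lambda>t. \<Prod>r\<in>J. g r ((x(j := t)) r)) has_vector_derivative (\<Prod>r\<in>J. (g(j := h)) r ((x(j := s)) r))) (at s)" for x s
    unfolding eq eq' by (intro has_vector_derivative_mult_left h)
  show "pderiv_at j (\<lambda>x. \<Prod>r\<in>J. g r (x r)) = (\<lambda>x. \<Prod>r\<in>J. (g(j := h)) r (x r))"
    unfolding pderiv_at_def
  proof
    fix x
    show "vector_derivative (\<lambda>t. \<Prod>r\<in>J. g r ((x(j := t)) r)) (at (x j)) = (\<Prod>r\<in>J. (g(j := h)) r (x r))"
      using vector_derivative_at[OF D[of x "x j"]] by (simp only: fun_upd_triv)
  qed
qed

text \<open>The classes \<open>S r\<close> are closed under differentiation, so every partial
  derivative of such a product is again one; hence the induction on \<open>k\<close> with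
  \<open>g\<close> arbitrary.\<close>

lemma C_k_on_cube_prod:
  assumes J: "finite J"
    and S: "\<And>r h. r \<in> J \<Longrightarrow> h \<in> S r \<Longrightarrow> \<exists>h'\<in>S r. \<forall>t. (h has_vector_derivative h' t) (at t)"
    and g: "\<And>r. r \<in> J \<Longrightarrow> g r \<in> S r"
  shows "C_k_on_cube k J (\<lambda>x. \<Prod>r\<in>J. g r (x r))"
proof -
  have cont: "continuous_on (cube J) (\<lambda>x. \<Prod>r\<in>J. g r (x r))" if "\<And>r. r \<in> J \<Longrightarrow> g r \<in> S r" for g
  proof (intro continuous_on_prod)
    fix r assume r: "r \<in> J"
    have "continuous_on UNIV (g r)"
      using S[OF r that[OF r]] by (auto intro!: continuous_at_imp_continuous_on has_vector_derivative_continuous)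
    then show "continuous_on (cube J) (\<lambda>x. g r (x r))"
      by (rule continuous_on_compose2)
        (auto intro: continuous_on_subset[OF continuous_on_product_coordinates])
  qed
  from g show ?thesis
  proof (induction k arbitrary: g)
    case 0
    then show ?case using cont[of g] by simp
  next
    case (Suc k)
    have "(\<forall>x\<in>cube J. (\<lambda>t. \<Prod>r\<in>J. g r ((x(j := t)) r)) differentiable (at (x j))) \<and>
      C_k_on_cube k J (pderiv_at j (\<lambda>x. \<Prod>r\<in>J. g r (x r)))" if j: "j \<in> J" for j
    proof -
      obtain h where h: "h \<in> S j" "\<And>t. (g j has_vector_derivative h t) (at t)"
        using S[OF j Suc.prems[OF j]] by blast
      note D = pderiv_at_prod[OF J j, of g h, OF h(2)]
      have "C_k_on_cube k J (\<lambda>x. \<Prod>r\<in>J. (g(j := h)) r (x r))"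
        using h(1) Suc.prems by (intro Suc.IH) auto
      then show ?thesis
        unfolding D(2) using D(1) by (blast intro: differentiableI_vector)
    qed
    then show ?case using cont[of g] Suc.prems by simp
  qed
qed

text \<open>Compactness refers to the product topology on all functions. The extensional box becomes
  a full product with the factor \<open>{undefined}\<close> outside \<open>J\<close>, to which
  Tychonoff's theorem applies.\<close>

lemma compact_PiE_Icc:
  fixes a b :: "nat \<Rightarrow> real"
  shows "compact (Pi\<^sub>E J (\<lambda>r. {a r..b r}))"
proof -
  have "Pi\<^sub>E J (\<lambda>r. {a r..b r}) = Pi\<^sub>E UNIV (\<lambda>r. if r \<in> J then {a r..b r} else {undefined})"
    by (auto simp: PiE_iff extensional_def split: if_splits)
  moreover have "compactin (product_topology (\<lambda>_. euclidean) UNIV)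
    (Pi\<^sub>E UNIV (\<lambda>r. if r \<in> J then {a r..b r} else {undefined}))"
    by (subst compactin_PiE) (auto simp: compactin_euclidean_iff)
  ultimately show ?thesis
    by (simp add: euclidean_product_topology)
qed

lemma prod_bumps_test_function:
  assumes J: "finite J" and ab: "\<And>r. r \<in> J \<Longrightarrow> 0 < a r \<and> a r < b r \<and> b r < 1" and c: "c > 0"
    and g: "\<And>r. r \<in> J \<Longrightarrow> g r \<in> complex_bumps c (a r) (b r)"
  shows "(\<lambda>x. \<Prod>r\<in>J. g r (x r)) \<in> test_functions J"
  unfolding test_functions_def
proof (intro CollectI conjI allI exI)
  show "C_k_on_cube k J (\<lambda>x. \<Prod>r\<in>J. g r (x r))" for k
    by (rule C_k_on_cube_prod[OF J, where S = "\<lambda>r. complex_bumps c (a r) (b r)"])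
      (use complex_bumps_derivative[OF c] ab g in auto)
  show "compact (Pi\<^sub>E J (\<lambda>r. {a r..b r}))" by (rule compact_PiE_Icc)
  show "Pi\<^sub>E J (\<lambda>r. {a r..b r}) \<subseteq> cube J"
    unfolding cube_def using ab by (intro PiE_mono) fastforce
  show "\<forall>x\<in>cube J - Pi\<^sub>E J (\<lambda>r. {a r..b r}). (\<Prod>r\<in>J. g r (x r)) = 0"
  proof
    fix x assume "x \<in> cube J - Pi\<^sub>E J (\<lambda>r. {a r..b r})"
    then obtain r where r: "r \<in> J" "x r \<notin> {a r..b r}"
      by (auto simp: cube_def PiE_iff)
    then have "g r (x r) = 0"
      using g[OF r(1)] by (auto simp: complex_bumps_def bump_def)
    then show "(\<Prod>r\<in>J. g r (x r)) = 0" using J r(1) by auto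
  qed
qed

text \<open>Products of bumps with \<open>c = 1 / Suc n\<close> are bounded by 1 and converge to the
  indicator of a box, so \<open>AE_0_of_boxes\<close> applies after dominated convergence.\<close>

lemma orthogonal_to_test_functions:
  assumes J: "finite J" and g: "g \<in> L2 (cube_measure J)"
    and orth: "\<And>\<phi>. \<phi> \<in> test_functions J \<Longrightarrow> l2_inner (cube_measure J) \<phi> g = 0"
  shows "ae_eq (cube_measure J) g (\<lambda>_. 0)"
proof -
  let ?M = "cube_measure J"
  note fin = finite_measure_cube_measure[OF J]
  have gi: "integrable ?M g"
    using L2_integrable_mult_cnj[OF g L2_const[OF fin, of 1]] by simp
  have [measurable]: "g \<in> borel_measurable ?M" using g by (rule L2_measurable)
  show ?thesis unfolding ae_eq_def
  proof (rule AE_0_of_boxes[OF J gi])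
    fix a b :: "nat \<Rightarrow> real" assume ab: "\<And>r. r \<in> J \<Longrightarrow> 0 < a r \<and> a r < b r \<and> b r < 1"
    define \<beta> where "\<beta> n r t = complex_of_real (bump (1 / real (Suc n)) (a r) (b r) 1 0 t)" for n r t
    have \<beta>_test: "(\<lambda>x. \<Prod>r\<in>J. \<beta> n r (x r)) \<in> test_functions J" for n
      by (rule prod_bumps_test_function[OF J ab, where c = "1 / real (Suc n)"])
        (auto simp: \<beta>_def complex_bumps_def)
    have \<beta>_ub: "\<beta> n r \<in> unit_bounded" for n r
    proof -
      have "bump (1 / real (Suc n)) (a r) (b r) 1 0 = (\<lambda>t. indicator {a r<..<b r} t *
          exp (- (1 / real (Suc n)) / ((t - a r) * (b r - t))))"
        by (auto simp: bump_def fun_eq_iff)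
      then have [measurable]: "bump (1 / real (Suc n)) (a r) (b r) 1 0 \<in> borel_measurable borel"
        by simp
      have "\<beta> n r = (\<lambda>t. complex_of_real (bump (1 / real (Suc n)) (a r) (b r) 1 0 t))"
        by (simp add: \<beta>_def fun_eq_iff)
      moreover have "(\<lambda>t. complex_of_real (bump (1 / real (Suc n)) (a r) (b r) 1 0 t)) \<in> borel_measurable borel"
        by measurable
      moreover have "cmod (\<beta> n r t) \<le> 1" for t by (auto simp: \<beta>_def bump_def)
      ultimately show ?thesis by (simp add: unit_bounded_def)
    qed
    have "(\<lambda>n. LINT x|?M. g x * (\<Prod>r\<in>J. \<beta> n r (x r))) \<longlonglongrightarrow>
      (LINT x|?M. g x * (\<Prod>r\<in>J. indicator {a r<..<b r} (x r)))"
    proof (rule integral_dominated_convergence)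
      show "integrable ?M (\<lambda>x. cmod (g x))" using gi by simp
      show "(\<lambda>x. g x * (\<Prod>r\<in>J. indicator {a r<..<b r} (x r))) \<in> borel_measurable ?M"
        by (rule borel_measurable_integrable, rule integrable_mult_prod[OF gi]) (auto simp: indicator_unit_bounded)
      show "(\<lambda>x. g x * (\<Prod>r\<in>J. \<beta> n r (x r))) \<in> borel_measurable ?M" for n
        by (rule borel_measurable_integrable, rule integrable_mult_prod[OF gi]) (auto simp: \<beta>_ub)
      have "(\<lambda>n. \<beta> n r t) \<longlonglongrightarrow> indicator {a r<..<b r} t" for r t
      proof (cases "t \<in> {a r<..<b r}")
        case True
        have "(\<lambda>n. complex_of_real (exp (- (1 / real (Suc n)) / ((t - a r) * (b r - t))))) \<longlonglongrightarrow>
            complex_of_real (exp (- 0 / ((t - a r) * (b r - t))))"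
          using True by (intro tendsto_intros LIMSEQ_Suc[OF lim_1_over_n]) auto
        then show ?thesis using True by (simp add: \<beta>_def bump_def)
      qed (auto simp: \<beta>_def bump_def)
      then show "AE x in ?M. (\<lambda>n. g x * (\<Prod>r\<in>J. \<beta> n r (x r))) \<longlonglongrightarrow> g x * (\<Prod>r\<in>J. indicator {a r<..<b r} (x r))"
        by (intro AE_I2 tendsto_intros)
      have "cmod (\<Prod>r\<in>J. \<beta> n r (x r)) \<le> 1" for n x
        unfolding prod_norm[symmetric] using \<beta>_ub by (intro prod_le_1) (auto simp: unit_bounded_def)
      then show "AE x in ?M. norm (g x * (\<Prod>r\<in>J. \<beta> n r (x r))) \<le> cmod (g x)" for n
        by (simp add: norm_mult mult_left_le)
    qed
    moreover have "(LINT x|?M. g x * (\<Prod>r\<in>J. \<beta> n r (x r))) = 0" for n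
    proof -
      have "(LINT x|?M. g x * (\<Prod>r\<in>J. \<beta> n r (x r))) = l2_inner ?M g (\<lambda>x. \<Prod>r\<in>J. \<beta> n r (x r))"
        unfolding l2_inner_def by (simp add: cnj_prod \<beta>_def)
      also have "\<dots> = cnj (l2_inner ?M (\<lambda>x. \<Prod>r\<in>J. \<beta> n r (x r)) g)" by (rule l2_inner_commute)
      also have "\<dots> = 0" using orth[OF \<beta>_test] by simp
      finally show ?thesis .
    qed
    ultimately show "(LINT x|?M. g x * (\<Prod>r\<in>J. indicator {a r<..<b r} (x r))) = 0"
      by (simp add: LIMSEQ_const_iff)
  qed
qed

section \<open>Eigenvectors of the self-adjoint extensions\<close>

lemma tensor_exp_upd:
  assumes "finite J" "j \<in> J"
  shows "tensor_exp J \<xi> (y(j := t)) = cis (2 * pi * \<xi> j * t) * tensor_exp (J - {j}) \<xi> y"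
proof -
  have "(\<Prod>r\<in>J - {j}. cis (2 * pi * \<xi> r * (y(j := t)) r)) = (\<Prod>r\<in>J - {j}. cis (2 * pi * \<xi> r * y r))"
    by (intro prod.cong) auto
  then show ?thesis
    unfolding tensor_exp_eq_cis using prod.remove[OF assms, of "\<lambda>r. cis (2 * pi * \<xi> r * (y(j := t)) r)"] by simp
qed

lemma tensor_exp_cong: "(\<And>r. r \<in> J \<Longrightarrow> \<xi> r = \<eta> r) \<Longrightarrow> tensor_exp J \<xi> = tensor_exp J \<eta>"
  unfolding tensor_exp_def by (intro ext prod.cong) auto

text \<open>The coordinate \<open>j\<close> attains its extrema on the compact support inside (0,1).
  Going halfway from them to 0 and 1 gives a nondegenerate interval.\<close>

lemma test_function_support:
  assumes \<phi>: "\<phi> \<in> test_functions J" and j: "j \<in> J"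
  obtains a b where "0 < a" "a < b" "b < 1" "\<And>x. x \<in> cube J \<Longrightarrow> x j \<notin> {a..b} \<Longrightarrow> \<phi> x = 0"
proof -
  obtain K where K: "compact K" "K \<subseteq> cube J" "\<And>x. x \<in> cube J - K \<Longrightarrow> \<phi> x = 0"
    using \<phi> by (auto simp: test_functions_def)
  show thesis
  proof (cases "K = {}")
    case True
    show thesis by (rule that[of "1/3" "2/3"]) (use K True in auto)
  next
    case False
    have cont: "continuous_on K (\<lambda>x. x j)"
      by (rule continuous_on_subset[OF continuous_on_product_coordinates]) auto
    obtain x where x: "x \<in> K" "\<And>y. y \<in> K \<Longrightarrow> x j \<le> y j"
      using continuous_attains_inf[OF K(1) False cont] by auto
    obtain z where z: "z \<in> K" "\<And>y. y \<in> K \<Longrightarrow> y j \<le> z j"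
      using continuous_attains_sup[OF K(1) False cont] by auto
    have "x j \<in> {0<..<1}" "z j \<in> {0<..<1}" using x(1) z(1) K(2) j by (auto simp: cube_def PiE_iff)
    then have "0 < x j / 2" "x j / 2 < (z j + 1) / 2" "(z j + 1) / 2 < 1"
      using x(2)[OF z(1)] by auto
    moreover have "\<phi> y = 0" if y: "y \<in> cube J" "y j \<notin> {x j / 2..(z j + 1) / 2}" for y
    proof (rule K(3))
      have "y \<notin> K"
      proof
        assume "y \<in> K"
        then have "x j \<le> y j" "y j \<le> z j" using x z by auto
        then show False using y(2) \<open>x j \<in> {0<..<1}\<close> \<open>z j \<in> {0<..<1}\<close> by auto
      qed
      then show "y \<in> cube J - K" using y by auto
    qed
    ultimately show thesis by (rule that)
  qed
qed

text \<open>The fundamental theorem is applied on a closed interval between \<open>{a..b}\<close>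
  and (0,1): \<open>\<psi>\<close> vanishes at its endpoints and \<open>D\<close> vanishes outside
  it.\<close>

lemma integral_unit_lborel_FTC:
  fixes \<psi> D :: "real \<Rightarrow> complex"
  assumes ab: "0 < a" "a < b" "b < 1"
    and deriv: "\<And>t. t \<in> {0<..<1} \<Longrightarrow> (\<psi> has_vector_derivative D t) (at t)"
    and cont: "continuous_on {0<..<1} D"
    and zero: "\<And>t. t \<in> {0<..<1} \<Longrightarrow> t \<notin> {a..b} \<Longrightarrow> \<psi> t = 0"
  shows "(LINT t|unit_lborel. D t) = 0"
proof -
  define a' b' where "a' = a / 2" and "b' = (b + 1) / 2"
  have ab': "0 < a'" "a' < a" "b < b'" "b' < 1" using ab by (auto simp: a'_def b'_def)
  have D0: "D t = 0" if t: "t \<in> {0<..<1}" "t \<notin> {a..b}" for t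
  proof -
    have "((\<lambda>_. 0) has_vector_derivative 0) (at t)" by simp
    then have "(\<psi> has_vector_derivative 0) (at t)"
      by (rule has_vector_derivative_transform_within_open[of _ _ _ "{0<..<1} - {a..b}"])
        (use t zero in auto)
    then show ?thesis using deriv[OF t(1)] vector_derivative_unique_at by blast
  qed
  have "(LINT t|unit_lborel. D t) = (LINT t|lborel. indicator {0<..<1} t *\<^sub>R D t)"
    by (subst integral_restrict_space) (simp_all add: set_lebesgue_integral_def)
  also have "\<dots> = (LINT t|lborel. indicator {a'..b'} t *\<^sub>R D t)"
    using ab ab' D0 by (intro Bochner_Integration.integral_cong) (auto simp: indicator_def)
  also have "\<dots> = \<psi> b' - \<psi> a'"
  proof (rule integral_FTC_Icc)
    show "a' \<le> b'" using ab ab' by simp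
    show "(\<psi> has_vector_derivative D t) (at t within {a'..b'})" if "a' \<le> t" "t \<le> b'" for t
      by (rule has_vector_derivative_at_within[OF deriv]) (use that ab' in auto)
    show "continuous_on {a'..b'} D" using ab' by (intro continuous_on_subset[OF cont]) auto
  qed
  also have "\<dots> = 0" using zero[of a'] zero[of b'] ab ab' by simp
  finally show ?thesis .
qed

lemma cube_upd: "j \<in> J \<Longrightarrow> y \<in> cube (J - {j}) \<Longrightarrow> t \<in> {0<..<1} \<Longrightarrow> y(j := t) \<in> cube J"
  unfolding cube_def by (auto simp: PiE_iff extensional_def)

text \<open>On each line in direction \<open>j\<close> the difference of the two integrands is the
  derivative of \<open>\<phi>\<close> times the conjugate exponential, up to the factor 1/i. Its
  support is compact in the line, so it integrates to zero, and Fubini's theorem concludes.\<close>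

lemma integration_by_parts:
  assumes J: "finite J" "j \<in> J" and \<phi>: "\<phi> \<in> test_functions J"
    and L2: "\<phi> \<in> L2 (cube_measure J)" "(\<lambda>x. (1 / \<i>) * pderiv_at j \<phi> x) \<in> L2 (cube_measure J)"
  shows "l2_inner (cube_measure J) (\<lambda>x. (1 / \<i>) * pderiv_at j \<phi> x) (tensor_exp J \<xi>) =
    l2_inner (cube_measure J) \<phi> (\<lambda>x. of_real (2 * pi * \<xi> j) * tensor_exp J \<xi> x)"
proof -
  let ?M = "cube_measure J"
  let ?\<mu> = "complex_of_real (2 * pi * \<xi> j)"
  define D where "D x = ((1 / \<i>) * pderiv_at j \<phi> x - ?\<mu> * \<phi> x) * cnj (tensor_exp J \<xi> x)" for x
  note eL = tensor_exp_L2[OF J(1) order_refl, of \<xi>]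
  have Di: "integrable ?M D"
    unfolding D_def using L2 eL by (intro L2_integrable_mult_cnj) auto
  obtain a b where ab: "0 < a" "a < b" "b < 1" and supp: "\<And>x. x \<in> cube J \<Longrightarrow> x j \<notin> {a..b} \<Longrightarrow> \<phi> x = 0"
    using test_function_support[OF \<phi> J(2)] by metis
  have C: "C_k_on_cube (Suc 0) J \<phi>" using \<phi> by (auto simp: test_functions_def)
  then have \<phi>_cont: "continuous_on (cube J) \<phi>" and p_cont: "continuous_on (cube J) (pderiv_at j \<phi>)"
    and \<phi>_diff: "\<And>x. x \<in> cube J \<Longrightarrow> (\<lambda>t. \<phi> (x(j := t))) differentiable (at (x j))"
    using J(2) by auto
  have slice: "(LINT t|unit_lborel. D (y(j := t))) = 0" if y: "y \<in> cube (J - {j})" for y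
  proof -
    let ?\<psi> = "\<lambda>t. (1 / \<i>) * (\<phi> (y(j := t)) * cnj (tensor_exp J \<xi> (y(j := t))))"
    have cexp: "cnj (tensor_exp J \<xi> (y(j := t))) = cis (- (2 * pi * \<xi> j) * t) * cnj (tensor_exp (J - {j}) \<xi> y)" for t
      unfolding tensor_exp_upd[OF J] by (simp add: cis_cnj)
    have updc: "continuous_on A (\<lambda>t. y(j := t))" for A :: "real set"
    proof (rule continuous_on_coordinatewise_then_product)
      show "continuous_on A (\<lambda>t. (y(j := t)) i)" for i
        by (cases "i = j") (simp_all add: continuous_on_id)
    qed
    have im: "(\<lambda>t. y(j := t)) ` {0<..<1} \<subseteq> cube J" using cube_upd[OF J(2) y] by auto
    show ?thesis
    proof (rule integral_unit_lborel_FTC[OF ab, of ?\<psi>])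
      fix t :: real assume t: "t \<in> {0<..<1}"
      have "(\<lambda>s. \<phi> ((y(j := t))(j := s))) differentiable (at ((y(j := t)) j))"
        by (rule \<phi>_diff[OF cube_upd[OF J(2) y t]])
      then have "(\<lambda>s. \<phi> (y(j := s))) differentiable (at t)" by simp
      then have 1: "((\<lambda>s. \<phi> (y(j := s))) has_vector_derivative pderiv_at j \<phi> (y(j := t))) (at t)"
        by (simp add: pderiv_at_def vector_derivative_works)
      have "((\<lambda>s. exp (\<i> * (- (2 * pi * \<xi> j) * s))) has_vector_derivative
          - \<i> * ?\<mu> * exp (\<i> * (- (2 * pi * \<xi> j) * t))) (at t)"
        by (auto intro!: derivative_eq_intros has_vector_derivative_real_field)
      then have 2: "((\<lambda>s. cis (- (2 * pi * \<xi> j) * s)) has_vector_derivative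
          - \<i> * ?\<mu> * cis (- (2 * pi * \<xi> j) * t)) (at t)"
        by (simp add: cis_conv_exp)
      have "(?\<psi> has_vector_derivative (1 / \<i>) * (\<phi> (y(j := t)) * ((- \<i> * ?\<mu> * cis (- (2 * pi * \<xi> j) * t)) * cnj (tensor_exp (J - {j}) \<xi> y))
          + pderiv_at j \<phi> (y(j := t)) * (cis (- (2 * pi * \<xi> j) * t) * cnj (tensor_exp (J - {j}) \<xi> y)))) (at t)"
        unfolding cexp
        by (intro has_vector_derivative_mult_right has_vector_derivative_mult 1 has_vector_derivative_mult_left 2)
      moreover have "(1 / \<i>) * (\<phi> (y(j := t)) * ((- \<i> * ?\<mu> * cis (- (2 * pi * \<xi> j) * t)) * cnj (tensor_exp (J - {j}) \<xi> y))
          + pderiv_at j \<phi> (y(j := t)) * (cis (- (2 * pi * \<xi> j) * t) * cnj (tensor_exp (J - {j}) \<xi> y))) = D (y(j := t))"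
        unfolding D_def cexp by (simp add: algebra_simps)
      ultimately show "(?\<psi> has_vector_derivative D (y(j := t))) (at t)" by simp
    next
      show "continuous_on {0<..<1} (\<lambda>t. D (y(j := t)))"
        unfolding D_def cexp
        by (intro continuous_intros continuous_on_compose2[OF p_cont updc im] continuous_on_compose2[OF \<phi>_cont updc im])
    next
      fix t assume t: "t \<in> {0<..<1}" "t \<notin> {a..b}"
      then show "?\<psi> t = 0" using supp[OF cube_upd[OF J(2) y t(1)]] by simp
    qed
  qed
  have ins: "J = insert j (J - {j})" using J by auto
  have "(LINT x|?M. D x) = (LINT y|cube_measure (J - {j}). LINT t|unit_lborel. D (y(j := t)))"
    unfolding cube_measure_def
    by (subst ins, rule unit_cube.product_integral_insert)
      (use J Di ins in \<open>auto simp: cube_measure_def insert_absorb\<close>)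
  also have "\<dots> = (LINT y|cube_measure (J - {j}). 0)"
    by (intro Bochner_Integration.integral_cong) (auto simp: slice space_cube_measure)
  finally have "(LINT x|?M. D x) = 0" by simp
  moreover have "(LINT x|?M. D x) = l2_inner ?M (\<lambda>x. (1 / \<i>) * pderiv_at j \<phi> x - ?\<mu> * \<phi> x) (tensor_exp J \<xi>)"
    unfolding l2_inner_def D_def ..
  moreover have "\<dots> = l2_inner ?M (\<lambda>x. (1 / \<i>) * pderiv_at j \<phi> x) (tensor_exp J \<xi>) - ?\<mu> * l2_inner ?M \<phi> (tensor_exp J \<xi>)"
    by (simp only: l2_inner_diff_left[OF L2(2) L2_cmult[OF L2(1)] eL] l2_inner_cmult_left)
  ultimately have "l2_inner ?M (\<lambda>x. (1 / \<i>) * pderiv_at j \<phi> x) (tensor_exp J \<xi>) - ?\<mu> * l2_inner ?M \<phi> (tensor_exp J \<xi>) = 0"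
    by (simp only:)
  then show ?thesis
    unfolding l2_inner_cmult_right complex_cnj_complex_of_real by (simp only: right_minus_eq)
qed

text \<open>The boundary condition puts the exponential into the domain of \<open>H\<close> without
  telling the value of \<open>H\<close> there. That value is identified by testing against test
  functions, using symmetry and \<open>integration_by_parts\<close>.\<close>

lemma tensor_exp_eigenvector:
  assumes j: "j \<in> {1..d}"
    and ext: "self_adjoint_extension (cube_measure {1..d}) (minimal_partial d j) H"
    and bdry: "boundary_operator d j H V"
    and V: "ae_eq (cube_measure ({1..d} - {j})) (V (tensor_exp ({1..d} - {j}) \<xi>))
      (\<lambda>y. cis (2 * pi * \<xi> j) * tensor_exp ({1..d} - {j}) \<xi> y)"
  shows "(tensor_exp {1..d} \<xi>, \<lambda>x. of_real (2 * pi * \<xi> j) * tensor_exp {1..d} \<xi> x) \<in> H"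
proof -
  let ?J = "{1..d}"
  let ?M = "cube_measure ?J"
  let ?e = "tensor_exp ?J \<xi>" and ?u = "tensor_exp (?J - {j}) \<xi>"
  let ?h = "\<lambda>x. of_real (2 * pi * \<xi> j) * ?e x"
  have H: "self_adjoint ?M H" and sub: "minimal_partial d j \<subseteq> H"
    using ext by (auto simp: self_adjoint_extension_def)
  have min: "(\<phi>, \<lambda>x. (1 / \<i>) * pderiv_at j \<phi> x) \<in> H" if "\<phi> \<in> test_functions ?J" for \<phi>
    using that sub by (auto simp: minimal_partial_def)
  have eL: "?e \<in> L2 ?M" by (rule tensor_exp_L2) auto
  have hL: "?h \<in> L2 ?M" using eL by (rule L2_cmult)
  have parts: "l2_inner ?M (\<lambda>x. (1 / \<i>) * pderiv_at j \<phi> x) ?e = l2_inner ?M \<phi> ?h"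
    if "\<phi> \<in> test_functions ?J" for \<phi>
    using self_adjoint_L2[OF H min[OF that]] j that by (intro integration_by_parts) auto
  have "(?e, ?h) \<in> adjoint_graph ?M (minimal_partial d j)"
    using eL hL parts by (auto simp: adjoint_graph_def minimal_partial_def)
  then have "?e \<in> Domain (adjoint_graph ?M (minimal_partial d j))" by blast
  moreover have "\<exists>a\<in>L2 (cube_measure (?J - {j})). \<exists>b\<in>L2 (cube_measure (?J - {j})).
    face_value d j 0 ?e a \<and> face_value d j 1 ?e b \<and> ae_eq (cube_measure (?J - {j})) b (V a)"
  proof (intro bexI conjI)
    have cont: "continuous_on {0..1} (\<lambda>s. ?e (y(j := s)))" for y
      using j by (subst tensor_exp_upd) (auto intro!: continuous_intros)
    show "face_value d j 0 ?e ?u"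
      unfolding face_value_def using cont j tensor_exp_upd[of ?J j \<xi> _ 0] by (intro exI[of _ ?e]) auto
    show "face_value d j 1 ?e (\<lambda>y. cis (2 * pi * \<xi> j) * ?u y)"
      unfolding face_value_def using cont j tensor_exp_upd[of ?J j \<xi> _ 1] by (intro exI[of _ ?e]) auto
    show "ae_eq (cube_measure (?J - {j})) (\<lambda>y. cis (2 * pi * \<xi> j) * ?u y) (V ?u)"
      using V by (rule ae_eq_sym)
    show "?u \<in> L2 (cube_measure (?J - {j}))" by (rule tensor_exp_L2) auto
    then show "(\<lambda>y. cis (2 * pi * \<xi> j) * ?u y) \<in> L2 (cube_measure (?J - {j}))" by (rule L2_cmult)
  qed
  ultimately have "?e \<in> Domain H" using bdry by (auto simp: boundary_operator_def)
  then obtain g where g: "(?e, g) \<in> H" by auto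
  have gL: "g \<in> L2 ?M" by (rule self_adjoint_L2(2)[OF H g])
  have "ae_eq ?M (\<lambda>x. g x - ?h x) (\<lambda>_. 0)"
  proof (rule orthogonal_to_test_functions)
    fix \<phi> assume \<phi>: "\<phi> \<in> test_functions ?J"
    then show "l2_inner ?M \<phi> (\<lambda>x. g x - ?h x) = 0"
      using self_adjoint_symmetric[OF H min[OF \<phi>] g] parts[OF \<phi>] self_adjoint_L2(1)[OF H min[OF \<phi>]] gL hL
      by (simp add: l2_inner_diff_right)
  qed (use gL hL in auto)
  then have "ae_eq ?M g ?h" by (simp add: ae_eq_def)
  then show ?thesis using eL hL by (intro self_adjoint_graph_cong[OF H g]) auto
qed

section \<open>Quasi-commuting families\<close>

declare One_nat_def [simp del] \<comment> \<open>it would turn \<open>{1..d}\<close> into \<open>{Suc 0..d}\<close>\<close>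

locale quasi_commuting_family =
  fixes d :: nat and H :: "nat \<Rightarrow> ((nat \<Rightarrow> real) \<Rightarrow> complex) rel"
    and \<alpha> :: "nat \<Rightarrow> real" and v :: "nat \<Rightarrow> (nat \<Rightarrow> int) \<Rightarrow> complex"
  assumes ext: "j \<in> {1..d} \<Longrightarrow> self_adjoint_extension (cube_measure {1..d}) (minimal_partial d j) (H j)"
    and quasi: "quasi_commuting_with d H \<alpha> v"
begin

abbreviation "M \<equiv> cube_measure {1..d}"

text \<open>\<open>Arg2pi\<close> normalises the phase to [0,1), the range of the angles
  \<open>\<alpha>\<close>, so that congruence modulo 1 of the two means equality.\<close>

definition phase :: "nat \<Rightarrow> (nat \<Rightarrow> int) \<Rightarrow> real" where
  "phase j n = Arg2pi (v j (omit d j n)) / (2 * pi)"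

definition freq :: "nat \<Rightarrow> (nat \<Rightarrow> int) \<Rightarrow> nat \<Rightarrow> real" where
  "freq j n r = (if r = j then phase j n else \<alpha> r) + of_int (n r)"

text \<open>An enumeration of the lattice of extensional index vectors, since bases are indexed by
  natural numbers.\<close>

definition idx :: "nat \<Rightarrow> nat \<Rightarrow> int" where
  "idx = from_nat_into ({1..d} \<rightarrow>\<^sub>E UNIV)"

abbreviation eig :: "nat \<Rightarrow> (nat \<Rightarrow> int) \<Rightarrow> (nat \<Rightarrow> real) \<Rightarrow> complex" where
  "eig j n \<equiv> tensor_exp {1..d} (freq j n)"

lemma omit_PiE: "omit d j n \<in> ({1..d} - {j}) \<rightarrow>\<^sub>E UNIV"
  by (simp add: omit_def)

lemma norm_v: "j \<in> {1..d} \<Longrightarrow> cmod (v j (omit d j n)) = 1"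
  using quasi omit_PiE[of j n] by (auto simp: quasi_commuting_with_def)

lemma cis_phase: "j \<in> {1..d} \<Longrightarrow> cis (2 * pi * phase j n) = v j (omit d j n)"
  using Arg2pi_eq[of "v j (omit d j n)"] norm_v[of j n] by (simp add: phase_def cis_conv_exp mult.commute)

lemma phase_cong: "v j (omit d j n) = v j (omit d j m) \<Longrightarrow> phase j n = phase j m"
  by (simp add: phase_def)

lemma phase_diff_Ints_iff:
  assumes j: "j \<in> {1..d}"
  shows "phase j n - x \<in> \<int> \<longleftrightarrow> v j (omit d j n) = cis (2 * pi * x)"
proof -
  have "phase j n - x \<in> \<int> \<longleftrightarrow> cis (2 * pi * (phase j n - x)) = 1" by (rule cis_2pi_eq_1_iff[symmetric])
  also have "cis (2 * pi * (phase j n - x)) = cis (2 * pi * phase j n) / cis (2 * pi * x)"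
    by (simp add: cis_divide right_diff_distrib)
  also have "\<dots> = 1 \<longleftrightarrow> cis (2 * pi * phase j n) = cis (2 * pi * x)" by simp
  finally show ?thesis by (simp only: cis_phase[OF j])
qed

lemma \<alpha>_range: "j \<in> {1..d} \<Longrightarrow> \<alpha> j \<in> {0..<1}"
  using quasi by (auto simp: quasi_commuting_with_def)

text \<open>Both numbers lie in [0,1) and differ by an integer.\<close>

lemma phase_eq_\<alpha>:
  assumes j: "j \<in> {1..d}" and eq: "v j (omit d j n) = cis (2 * pi * \<alpha> j)"
  shows "phase j n = \<alpha> j"
proof -
  have "phase j n - \<alpha> j \<in> \<int>" using phase_diff_Ints_iff[OF j] eq by blast
  then obtain m :: int where m: "phase j n - \<alpha> j = of_int m" by (auto elim: Ints_cases)
  have "phase j n \<in> {0..<1}"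
    using Arg2pi[of "v j (omit d j n)"] by (simp add: phase_def)
  then have "\<bar>real_of_int m\<bar> < 1" using \<alpha>_range[OF j] unfolding m[symmetric] by auto
  then have "m = 0" by linarith
  then show ?thesis using m by simp
qed

lemma omit_upd: "omit d j (n(j := m)) = omit d j n"
  by (auto simp: omit_def restrict_def)

lemma omit_cong: "(\<And>r. r \<in> {1..d} \<Longrightarrow> r \<noteq> j \<Longrightarrow> n r = m r) \<Longrightarrow> omit d j n = omit d j m"
  by (auto simp: omit_def restrict_def)

lemma bij_idx:
  assumes "d \<ge> 1"
  shows "bij_betw idx UNIV ({1..d} \<rightarrow>\<^sub>E UNIV)"
  unfolding idx_def
proof (rule bij_betw_from_nat_into)
  show "countable ({1..d} \<rightarrow>\<^sub>E (UNIV :: int set))" by (intro countable_PiE) auto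
  show "infinite ({1..d} \<rightarrow>\<^sub>E (UNIV :: int set))"
    using assms by (subst finite_PiE_iff) (auto simp: PiE_eq_empty_iff infinite_UNIV_int)
qed

text \<open>An arbitrary \<open>n\<close> may have values outside \<open>{1..d}\<close>, whereas
  \<open>idx\<close> yields extensional vectors; \<open>eig j n\<close> only depends on the
  restriction.\<close>

lemma eig_idx:
  assumes "d \<ge> 1"
  obtains i where "eig j n = eig j (idx i)" "idx i = restrict n {1..d}"
proof -
  have "restrict n {1..d} \<in> range idx"
    using bij_idx[OF assms] by (simp add: bij_betw_def)
  then obtain i where i: "idx i = restrict n {1..d}" by (metis rangeE)
  have "omit d j (restrict n {1..d}) = omit d j n" by (intro omit_cong) auto
  then have "eig j n = eig j (idx i)"
    unfolding i by (intro tensor_exp_cong) (simp add: freq_def phase_def)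
  then show thesis using i by (rule that)
qed

lemma inner_eq_0_iff:
  "l2_inner M (tensor_exp {1..d} \<xi>) (tensor_exp {1..d} \<eta>) = 0 \<longleftrightarrow>
    (\<exists>r\<in>{1..d}. \<xi> r - \<eta> r \<in> \<int> \<and> \<xi> r \<noteq> \<eta> r)"
  by (rule inner_tensor_exp_eq_0_iff) simp

text \<open>The integer \<open>n j\<close> does not change the value of the exponential at 1, so
  every shift of the phase meets the boundary condition with the same eigenvalue.\<close>

lemma eig_in_H:
  assumes j: "j \<in> {1..d}"
  shows "(eig j n, \<lambda>x. of_real (2 * pi * freq j n j) * eig j n x) \<in> H j"
proof -
  from quasi[unfolded quasi_commuting_with_def, rule_format, OF j]
  obtain V where bd: "boundary_operator d j (H j) V"
    and V: "\<forall>n \<in> ({1..d} - {j}) \<rightarrow>\<^sub>E UNIV. v j n \<in> sphere 0 1 \<and> ae_eq (cube_measure ({1..d} - {j}))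
              (V (tensor_exp ({1..d} - {j}) (\<lambda>r. \<alpha> r + of_int (n r))))
              (\<lambda>y. v j n * tensor_exp ({1..d} - {j}) (\<lambda>r. \<alpha> r + of_int (n r)) y)"
    by (elim conjE exE)
  have u: "tensor_exp ({1..d} - {j}) (\<lambda>r. \<alpha> r + of_int (omit d j n r)) = tensor_exp ({1..d} - {j}) (freq j n)"
    by (intro tensor_exp_cong) (auto simp: freq_def omit_def)
  have "cis (2 * pi * freq j n j) = cis (2 * pi * phase j n) * cis (2 * pi * of_int (n j))"
    unfolding freq_def cis_mult by (simp only: simp_thms if_True distrib_left)
  also have "cis (2 * pi * of_int (n j)) = 1" by (simp add: cis_2pi_eq_1_iff)
  finally have "cis (2 * pi * freq j n j) = v j (omit d j n)" by (simp add: cis_phase[OF j])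
  then show ?thesis
    using conjunct2[OF bspec[OF V omit_PiE[of j n]]] unfolding u by (intro tensor_exp_eigenvector[OF j ext[OF j] bd]) simp
qed

lemma basis:
  assumes j: "j \<in> {1..d}"
  shows "eigenbasis M (\<lambda>i. eig j (idx i)) (\<lambda>i. 2 * pi * freq j (idx i) j) (H j)"
proof (intro eigenbasis.intro l2_orthonormal_basis.intro eigenbasis_axioms.intro)
  have d: "d \<ge> 1" using j by auto
  show "finite_measure M" by (rule finite_measure_cube_measure) simp
  show "eig j (idx i) \<in> L2 M" for i by (rule tensor_exp_L2) auto
  show "self_adjoint M (H j)" using ext[OF j] by (simp add: self_adjoint_extension_def)
  show "(eig j (idx i), \<lambda>x. of_real (2 * pi * freq j (idx i) j) * eig j (idx i) x) \<in> H j" for i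
    by (rule eig_in_H[OF j])
  show "l2_inner M (eig j (idx i)) (eig j (idx i')) = (if i = i' then 1 else 0)" for i i'
  proof (cases "i = i'")
    case True
    then show ?thesis by (simp add: inner_tensor_exp)
  next
    case False
    let ?n = "idx i" and ?m = "idx i'"
    have "?n \<noteq> ?m" using False bij_idx[OF d] by (auto simp: bij_betw_def inj_on_def)
    moreover have "?n \<in> {1..d} \<rightarrow>\<^sub>E UNIV" "?m \<in> {1..d} \<rightarrow>\<^sub>E UNIV"
      using bij_idx[OF d] by (auto simp: bij_betw_def)
    ultimately obtain s where s: "s \<in> {1..d}" "?n s \<noteq> ?m s" by (metis PiE_ext)
    \<comment> \<open>An index difference off \<open>j\<close> shifts that frequency by a nonzero
      integer. If there is none, the phases agree and the difference at \<open>j\<close> is a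
      nonzero integer.\<close>
    have "\<exists>r\<in>{1..d}. freq j ?n r - freq j ?m r \<in> \<int> \<and> freq j ?n r \<noteq> freq j ?m r"
    proof (cases "\<exists>r\<in>{1..d} - {j}. ?n r \<noteq> ?m r")
      case True
      then obtain r where "r \<in> {1..d} - {j}" "?n r \<noteq> ?m r" by blast
      then show ?thesis by (intro bexI[of _ r]) (auto simp: freq_def)
    next
      case False
      then have "omit d j ?n = omit d j ?m" by (intro omit_cong) auto
      then have "phase j ?n = phase j ?m" by (simp add: phase_def)
      moreover have "s = j" using s False by blast
      ultimately show ?thesis using s by (intro bexI[of _ j]) (auto simp: freq_def)
    qed
    then show ?thesis using False by (simp add: inner_eq_0_iff)
  qed
  fix f assume f: "f \<in> L2 M" and 0: "\<And>i. l2_inner M f (eig j (idx i)) = 0"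
  have fin: "finite_measure M" by (rule finite_measure_cube_measure) simp
  have fi: "integrable M f"
    using L2_integrable_mult_cnj[OF f L2_const[OF fin, of 1]] by simp
  show "ae_eq M f (\<lambda>_. 0)"
    unfolding ae_eq_def
  proof (rule tensor_exp_total[OF _ j fi, where \<theta> = "\<lambda>n. Arg2pi (v j n) / (2 * pi)" and \<alpha> = \<alpha>])
    fix n
    obtain i where "eig j n = eig j (idx i)" using eig_idx[OF d] by metis
    then have "l2_inner M f (eig j n) = 0" using 0 by simp
    then show "(LINT x|M. f x * cnj (tensor_exp {1..d} (\<lambda>r. (if r = j then Arg2pi (v j (restrict n ({1..d} - {j}))) / (2 * pi)
        else \<alpha> r) + of_int (n r)) x)) = 0"
      by (simp only: l2_inner_def freq_def[abs_def] phase_def omit_def)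
  qed simp
qed

text \<open>The functions \<open>f m\<close> need not be eigenvectors of \<open>H j\<close>, but
  \<open>E j A\<close> still acts on them by scalars, because all basis vectors not orthogonal to
  \<open>f m\<close> share the eigenvalue of the boundary operator.\<close>

lemma cocycle_of_strongly_commuting:
  assumes comm: "strongly_commuting M {1..d} H" and jk: "j \<in> {1..d}" "k \<in> {1..d}" "j \<noteq> k"
  shows "(v j (omit d j (n(k := n k + l))) - v j (omit d j n)) * (cis (2 * pi * \<alpha> k) - v k (omit d k n)) = 0"
proof (rule ccontr)
  assume "\<not> ?thesis"
  then have vj: "v j (omit d j (n(k := n k + l))) \<noteq> v j (omit d j n)"
    and vk: "cis (2 * pi * \<alpha> k) \<noteq> v k (omit d k n)" by auto
  define n' where "n' = n(k := n k + l)"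
  define f where "f m = tensor_exp {1..d} (\<lambda>r. \<alpha> r + of_int (m r))" for m :: "nat \<Rightarrow> int"
  have fL: "f m \<in> L2 M" for m unfolding f_def by (rule tensor_exp_L2) auto
  from comm obtain E where
    res_all: "\<forall>j\<in>{1..d}. spectral_resolution M (H j) (E j)" and
    comm_all: "\<forall>j\<in>{1..d}. \<forall>k\<in>{1..d}. \<forall>A\<in>sets borel. \<forall>B\<in>sets borel. \<forall>f\<in>L2 M.
             ae_eq M (E j A (E k B f)) (E k B (E j A f))"
    unfolding strongly_commuting_def by (elim exE conjE)
  have res: "spectral_resolution M (H i) (E i)" if "i \<in> {1..d}" for i
    using res_all that by blast
  have EE: "ae_eq M (E j A (E k B g)) (E k B (E j A g))"
    if "A \<in> sets borel" "B \<in> sets borel" "g \<in> L2 M" for A B g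
    using comm_all jk that by blast
  interpret Bj: eigenbasis M "\<lambda>i. eig j (idx i)" "\<lambda>i. 2 * pi * freq j (idx i) j" "H j" by (rule basis[OF jk(1)])
  interpret Bk: eigenbasis M "\<lambda>i. eig k (idx i)" "\<lambda>i. 2 * pi * freq k (idx i) k" "H k" by (rule basis[OF jk(2)])
  interpret Ej: spectral_measure M "E j" using res[OF jk(1)] by unfold_locales (simp add: spectral_resolution_def)
  interpret Ek: spectral_measure M "E k" using res[OF jk(2)] by unfold_locales (simp add: spectral_resolution_def)
  \<comment> \<open>\<open>E j A\<close> projects onto the part on which the boundary operator of \<open>H j\<close> is the scalar
    \<open>v j (omit d j n)\<close>, so it separates \<open>f n\<close> from \<open>f n'\<close>\<close>
  define A where "A = range (\<lambda>m::int. 2 * pi * (phase j n + of_int m))"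
  define B where "B = {2 * pi * freq k n k}"
  have A: "A \<in> sets borel" unfolding A_def by (rule sets.countable) simp_all
  have B: "B \<in> sets borel" unfolding B_def by simp
  \<comment> \<open>Off \<open>i\<close> both frequencies lie in the same coset of the integers, so
    they must coincide unless the functions are orthogonal.\<close>
  have supp: "m r = p r"
    if nz: "l2_inner M (f m) (eig i p) \<noteq> 0" and r: "r \<in> {1..d}" "r \<noteq> i" for m i p r
  proof -
    have "freq i p r = \<alpha> r + of_int (p r)" using r(2) by (simp add: freq_def)
    moreover have "\<not> (\<alpha> r + of_int (m r) - freq i p r \<in> \<int> \<and> \<alpha> r + of_int (m r) \<noteq> freq i p r)"
      using nz r(1) unfolding f_def inner_eq_0_iff by blast
    ultimately show ?thesis by simp
  qed
  have Ef: "ae_eq M (E j A (f m)) (\<lambda>x. (if v j (omit d j m) = v j (omit d j n) then 1 else 0) * f m x)" for m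
  proof (rule Bj.spectral_resolution_joint_eigenvector[OF res[OF jk(1)] A fL])
    fix i assume "l2_inner M (f m) (eig j (idx i)) \<noteq> 0"
    then have "omit d j m = omit d j (idx i)" using supp by (intro omit_cong) auto
    moreover have "2 * pi * freq j (idx i) j \<in> A \<longleftrightarrow> v j (omit d j (idx i)) = v j (omit d j n)"
    proof -
      have "2 * pi * freq j (idx i) j \<in> A \<longleftrightarrow> (\<exists>m. phase j (idx i) + of_int (idx i j) = phase j n + of_int m)"
        by (auto simp: A_def freq_def)
      also have "\<dots> \<longleftrightarrow> phase j (idx i) - phase j n \<in> \<int>"
      proof
        assume "\<exists>m. phase j (idx i) + of_int (idx i j) = phase j n + of_int m"
        then obtain m where "phase j (idx i) - phase j n = of_int (m - idx i j)" by (auto simp: algebra_simps)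
        then show "phase j (idx i) - phase j n \<in> \<int>" by (metis Ints_of_int)
      next
        assume "phase j (idx i) - phase j n \<in> \<int>"
        then obtain m where "phase j (idx i) - phase j n = of_int m" by (auto elim: Ints_cases)
        then show "\<exists>m. phase j (idx i) + of_int (idx i j) = phase j n + of_int m"
          by (intro exI[of _ "m + idx i j"]) simp
      qed
      also have "\<dots> \<longleftrightarrow> v j (omit d j (idx i)) = v j (omit d j n)"
        by (simp add: phase_diff_Ints_iff[OF jk(1)] cis_phase[OF jk(1)])
      finally show ?thesis .
    qed
    ultimately show "indicator A (2 * pi * freq j (idx i) j) = (if v j (omit d j m) = v j (omit d j n) then 1 else 0)"
      by (simp add: indicator_def)
  qed
  have E1: "ae_eq M (E j A (f n)) (f n)" using Ef[of n] by simp
  have E0: "ae_eq M (E j A (f n')) (\<lambda>_. 0)" using Ef[of n'] vj by (simp add: n'_def)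
  note Lj = Ej.E_L2[OF A] and Lk = Ek.E_L2[OF B]
  \<comment> \<open>\<open>E j A\<close> can be inserted in front of \<open>f n\<close>, commuted
    past \<open>E k B\<close> and moved to \<open>f n'\<close>, which it kills.\<close>
  have "l2_inner M (E k B (f n)) (f n') = l2_inner M (E k B (E j A (f n))) (f n')"
    by (intro l2_inner_cong_left proj_cong[OF Ek.proj[OF B]] ae_eq_sym[OF E1] Lj Lk fL)
  also have "\<dots> = l2_inner M (E j A (E k B (f n))) (f n')"
    by (intro l2_inner_cong_left ae_eq_sym[OF EE] A B Lj Lk fL)
  also have "\<dots> = l2_inner M (E k B (f n)) (E j A (f n'))"
    by (intro proj_symmetric[OF Ej.proj[OF A]] Lk fL)
  also have "\<dots> = l2_inner M (E k B (f n)) (\<lambda>_. 0)"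
    by (intro l2_inner_cong_right E0 Lj Lk fL L2_zero)
  finally have zero: "l2_inner M (E k B (f n)) (f n') = 0" by (simp add: l2_inner_def)
  have nint: "phase k n - \<alpha> k \<notin> \<int>"
    using vk by (auto simp: phase_diff_Ints_iff[OF jk(2)])
  define c where "c = l2_inner M (f n) (eig k n)"
  have eigL: "eig k n \<in> L2 M" by (rule tensor_exp_L2) auto
  \<comment> \<open>Many basis vectors may have the eigenvalue in \<open>B\<close>, but one that is
    not orthogonal to \<open>f n\<close> agrees with \<open>n\<close> off \<open>k\<close>, and then
    the eigenvalue fixes the index at \<open>k\<close> as well.\<close>
  have "ae_eq M (E k B (f n)) (\<lambda>x. c * eig k n x)"
  proof (rule Bk.ae_eqI_coeff)
    show "E k B (f n) \<in> L2 M" "(\<lambda>x. c * eig k n x) \<in> L2 M" using Lk fL eigL by auto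
    fix i
    obtain i0 where i0: "eig k n = eig k (idx i0)" "idx i0 = restrict n {1..d}" using eig_idx[of k n] jk by auto
    have fr: "freq k (idx i0) k = freq k n k"
      using jk omit_cong[of k "idx i0" n] by (auto simp: i0(2) freq_def phase_def)
    have eB: "ae_eq M (E k B (eig k (idx i))) (\<lambda>x. indicator B (2 * pi * freq k (idx i) k) * eig k (idx i) x)"
      by (rule spectral_resolution_eigenvector[OF Bk.H res[OF jk(2)] Bk.eigenvector B])
    have "l2_inner M (E k B (f n)) (eig k (idx i)) = l2_inner M (f n) (E k B (eig k (idx i)))"
      by (intro proj_symmetric[OF Ek.proj[OF B]] fL Bk.basis_L2)
    also have "\<dots> = l2_inner M (f n) (\<lambda>x. indicator B (2 * pi * freq k (idx i) k) * eig k (idx i) x)"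
      by (intro l2_inner_cong_right eB fL Lk Bk.basis_L2 L2_cmult)
    also have "\<dots> = indicator B (2 * pi * freq k (idx i) k) * l2_inner M (f n) (eig k (idx i))"
      by (simp add: l2_inner_cmult_right indicator_def)
    also have "\<dots> = c * (if i0 = i then 1 else 0)"
    proof (cases "i0 = i")
      case True
      then show ?thesis using i0 fr by (simp add: B_def c_def)
    next
      case False
      have "indicator B (2 * pi * freq k (idx i) k) * l2_inner M (f n) (eig k (idx i)) = 0"
      proof (rule ccontr)
        assume nz: "indicator B (2 * pi * freq k (idx i) k) * l2_inner M (f n) (eig k (idx i)) \<noteq> 0"
        then have s: "\<And>r. r \<in> {1..d} \<Longrightarrow> r \<noteq> k \<Longrightarrow> n r = idx i r" using supp by auto
        then have "phase k n = phase k (idx i)" by (intro phase_cong arg_cong[where f = "v k"] omit_cong) auto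
        moreover have "freq k (idx i) k = freq k n k" using nz by (auto simp: B_def indicator_def split: if_splits)
        ultimately have "n k = idx i k" by (simp add: freq_def)
        have "restrict n {1..d} = restrict (idx i) {1..d}"
        proof (rule restrict_ext)
          show "n r = idx i r" if "r \<in> {1..d}" for r
            using s[OF that] \<open>n k = idx i k\<close> by (cases "r = k") auto
        qed
        moreover have "d \<ge> 1" using jk by auto
        moreover have "restrict (idx i) {1..d} = idx i"
          using bij_idx[OF \<open>d \<ge> 1\<close>] by (intro PiE_restrict) (auto simp: bij_betw_def)
        ultimately have "idx i0 = idx i" using i0(2) by simp
        then show False using False bij_idx[OF \<open>d \<ge> 1\<close>] by (auto simp: bij_betw_def inj_on_def)
      qed
      then show ?thesis using False by simp
    qed
    also have "\<dots> = l2_inner M (\<lambda>x. c * eig k n x) (eig k (idx i))"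
      by (simp add: l2_inner_cmult_left i0(1) Bk.orthonormal)
    finally show "l2_inner M (E k B (f n)) (eig k (idx i)) = l2_inner M (\<lambda>x. c * eig k n x) (eig k (idx i))" .
  qed
  then have "l2_inner M (E k B (f n)) (f n') = l2_inner M (\<lambda>x. c * eig k n x) (f n')"
    by (intro l2_inner_cong_left) (use Lk fL eigL in auto)
  then have "c * l2_inner M (eig k n) (f n') = 0" using zero by (simp add: l2_inner_cmult_left)
  \<comment> \<open>The frequencies differ at most in the variable \<open>k\<close>, and there by a
    non-integer.\<close>
  moreover have "c \<noteq> 0"
  proof
    assume "c = 0"
    then obtain r where r: "r \<in> {1..d}" "\<alpha> r + of_int (n r) - freq k n r \<in> \<int>" "\<alpha> r + of_int (n r) \<noteq> freq k n r"
      unfolding c_def f_def inner_eq_0_iff by blast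
    then have "r = k" by (auto simp: freq_def split: if_splits)
    then have "\<alpha> k - phase k n \<in> \<int>" using r(2) by (simp add: freq_def)
    then show False using nint Ints_minus[of "\<alpha> k - phase k n"] by simp
  qed
  \<comment> \<open>Passing from \<open>n\<close> to \<open>n'\<close> shifts the frequency at
    \<open>k\<close> by the integer \<open>l\<close>, so the difference remains a
    non-integer.\<close>
  moreover have "l2_inner M (eig k n) (f n') \<noteq> 0"
  proof
    assume "l2_inner M (eig k n) (f n') = 0"
    then obtain r where r: "r \<in> {1..d}" "freq k n r - (\<alpha> r + of_int (n' r)) \<in> \<int>" "freq k n r \<noteq> \<alpha> r + of_int (n' r)"
      unfolding f_def inner_eq_0_iff by blast
    then have "r = k" by (auto simp: freq_def n'_def split: if_splits)
    then have "phase k n + of_int (n k) - (\<alpha> k + of_int (n k + l)) + of_int l \<in> \<int>"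
      using r(2) by (intro Ints_add) (simp_all add: freq_def n'_def)
    then show False using nint by (simp add: algebra_simps)
  qed
  ultimately show False by simp
qed

text \<open>The resolutions are the explicit ones of the eigenbases. The pair \<open>j = k\<close>
  needs no separate treatment: the joint eigenvectors are then the eigenvectors of
  \<open>H j\<close>.\<close>

lemma strongly_commuting_of_cocycle:
  assumes cocycle: "\<And>j k n l. j \<in> {1..d} \<Longrightarrow> k \<in> {1..d} \<Longrightarrow> j \<noteq> k \<Longrightarrow>
    (v j (omit d j (n(k := n k + l))) - v j (omit d j n)) * (cis (2 * pi * \<alpha> k) - v k (omit d k n)) = 0"
  shows "strongly_commuting M {1..d} H"
  unfolding strongly_commuting_def
proof (intro exI conjI ballI)
  let ?E = "\<lambda>j. eigenbasis.spec M (\<lambda>i. eig j (idx i)) (\<lambda>i. 2 * pi * freq j (idx i) j)"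
  show "spectral_resolution M (H j) (?E j)" if "j \<in> {1..d}" for j
    by (rule eigenbasis.spectral_resolution_spec[OF basis[OF that]])
  fix j k A B f
  assume j: "j \<in> {1..d}" and k: "k \<in> {1..d}" and f: "f \<in> L2 M"
    and A: "A \<in> sets (borel :: real measure)" and B: "B \<in> sets (borel :: real measure)"
  have d: "d \<ge> 1" using j by auto
  interpret Bj: eigenbasis M "\<lambda>i. eig j (idx i)" "\<lambda>i. 2 * pi * freq j (idx i) j" "H j" by (rule basis[OF j])
  interpret Bk: eigenbasis M "\<lambda>i. eig k (idx i)" "\<lambda>i. 2 * pi * freq k (idx i) k" "H k" by (rule basis[OF k])
  \<comment> \<open>the frequencies of joint eigenvectors of \<open>H j\<close> and \<open>H k\<close>\<close>
  define w where "w j k n = (\<lambda>r. (if r = j then phase j n else if r = k then phase k n else \<alpha> r) + of_int (n r))"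
    for j k n
  have w_commute: "w j k = w k j" by (auto simp: w_def fun_eq_iff)
  \<comment> \<open>Every basis vector of \<open>H k\<close> that is not orthogonal to the joint
    vector has the same eigenvalue. A different phase at \<open>p\<close> would mean that v_k
    depends on n_j; the cocycle condition then gives the joint vector the frequency
    \<open>\<alpha> j + n j\<close> in the variable \<open>j\<close>, which forces
    \<open>n j = p j\<close> and hence equal phases.\<close>
  have joint: "2 * pi * freq k p k = 2 * pi * w j k n k"
    if j: "j \<in> {1..d}" and k: "k \<in> {1..d}" and nz: "l2_inner M (tensor_exp {1..d} (w j k n)) (eig k p) \<noteq> 0"
    for j k n p
  proof -
    have int: "w j k n r = freq k p r" if "r \<in> {1..d}" "w j k n r - freq k p r \<in> \<int>" for r
      using nz that unfolding inner_eq_0_iff by blast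
    have off: "n r = p r" if "r \<in> {1..d}" "r \<noteq> j" "r \<noteq> k" for r
      using int[of r] that by (auto simp: w_def freq_def)
    have "phase k p = phase k n"
    proof (rule ccontr)
      assume ne: "phase k p \<noteq> phase k n"
      have jk: "j \<noteq> k"
      proof
        assume "j = k"
        then have "omit d k p = omit d k n" using off by (intro omit_cong) auto
        then show False using ne by (simp add: phase_def)
      qed
      have "omit d k p = omit d k (n(j := n j + (p j - n j)))" using off by (intro omit_cong) auto
      then have "v k (omit d k (n(j := n j + (p j - n j)))) \<noteq> v k (omit d k n)" using ne by (auto simp: phase_def)
      then have "v j (omit d j n) = cis (2 * pi * \<alpha> j)"
        using cocycle[OF k j jk[symmetric], of n "p j - n j"] by auto
      then have "phase j n = \<alpha> j" by (rule phase_eq_\<alpha>[OF j])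
      then have "n j = p j" using int[of j] j jk by (auto simp: w_def freq_def)
      then have "p r = n r" if "r \<in> {1..d}" "r \<noteq> k" for r
        using off[of r] that by (cases "r = j") auto
      then have "omit d k p = omit d k n" by (intro omit_cong) auto
      then show False using ne by (simp add: phase_def)
    qed
    then show ?thesis using int[OF k] by (auto simp: w_def freq_def)
  qed
  show "ae_eq M (?E j A (?E k B f)) (?E k B (?E j A f))"
  proof (rule commuting_projections_of_total_eigenvectors[OF Bj.spec_orthogonal_projection
        Bk.spec_orthogonal_projection, where w = "\<lambda>n. tensor_exp {1..d} (w j k n)"])
    show "f \<in> L2 M" by (rule f)
    fix n
    show wL: "tensor_exp {1..d} (w j k n) \<in> L2 M" by (rule tensor_exp_L2) auto
    show "ae_eq M (?E k B (tensor_exp {1..d} (w j k n)))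
        (\<lambda>x. indicator B (2 * pi * w j k n k) * tensor_exp {1..d} (w j k n) x)"
      by (rule Bk.spectral_resolution_joint_eigenvector[OF Bk.spectral_resolution_spec B wL])
        (simp only: joint[OF j k])
    show "ae_eq M (?E j A (tensor_exp {1..d} (w j k n)))
        (\<lambda>x. indicator A (2 * pi * w j k n j) * tensor_exp {1..d} (w j k n) x)"
      using wL unfolding w_commute
      by (intro Bj.spectral_resolution_joint_eigenvector[OF Bj.spectral_resolution_spec A])
        (simp_all only: joint[OF k j])
  next
    fix g assume g: "g \<in> L2 M" and orth: "\<And>n. l2_inner M g (tensor_exp {1..d} (w j k n)) = 0"
    have gi: "integrable M g"
      using L2_integrable_mult_cnj[OF g L2_const[OF Bj.finite_M, of 1]] by simp
    show "ae_eq M g (\<lambda>_. 0)"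
    proof (rule Bj.total[OF g])
      fix i
      let ?n = "idx i"
      show "l2_inner M g (eig j ?n) = 0"
      \<comment> \<open>If the phase at \<open>k\<close> is not \<open>\<alpha> k\<close>, the phase
        of \<open>H j\<close> does not depend on n_k. Varying n_k then runs through a whole coset of
        frequencies in that variable, which is exchanged for the coset of
        \<open>\<alpha> k\<close>.\<close>
      proof (cases "j = k \<or> phase k ?n = \<alpha> k")
        case True
        then have "w j k ?n = freq j ?n" by (auto simp: w_def freq_def)
        then show ?thesis using orth[of ?n] by simp
      next
        case False
        have "phase j (?n(k := m)) = phase j ?n" for m
        proof -
          have "cis (2 * pi * \<alpha> k) \<noteq> v k (omit d k ?n)" using False phase_eq_\<alpha>[OF k] by metis
          then have "v j (omit d j (?n(k := m))) = v j (omit d j ?n)"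
            using cocycle[OF j k, of ?n "m - ?n k"] False by simp
          then show ?thesis by (rule phase_cong)
        qed
        moreover have "phase k (?n(k := m)) = phase k ?n" for m by (simp add: phase_def omit_upd)
        ultimately have "w j k (?n(k := m)) = (freq j ?n)(k := phase k ?n + of_int m)" for m
          using False by (auto simp: w_def freq_def fun_eq_iff)
        then have "l2_inner M g (tensor_exp {1..d} ((freq j ?n)(k := phase k ?n + of_int m))) = 0" for m
          using orth[of "?n(k := m)"] by simp
        then show ?thesis
          unfolding l2_inner_def by (intro integral_tensor_exp_swap[OF _ k gi]) auto
      qed
    qed
  qed
qed

end

text \<open>For nonzero angles the constant 1 would be wrong: with d = 2, v_2 constantly
  e(\<alpha>_2) and v_1 not constant, the extensions commute although 1 - v_2 is nonzero when
  \<alpha>_2 is. The second part is the case of zero angles, where the constant is 1.\<close>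

theorem theorem7p1:
  fixes d :: nat
    and H :: "nat \<Rightarrow> ((nat \<Rightarrow> real) \<Rightarrow> complex) rel"
    and \<alpha> :: "nat \<Rightarrow> real"
    and v :: "nat \<Rightarrow> (nat \<Rightarrow> int) \<Rightarrow> complex"
  assumes "2 \<le> d"
    and "\<And>j. j \<in> {1..d} \<Longrightarrow>
           self_adjoint_extension (cube_measure {1..d}) (minimal_partial d j) (H j)"
    and "quasi_commuting_with d H \<alpha> v"
  shows "(strongly_commuting (cube_measure {1..d}) {1..d} H \<longleftrightarrow>
      (\<forall>j k. 1 \<le> j \<and> j < k \<and> k \<le> d \<longrightarrow>
        (\<forall>(n :: nat \<Rightarrow> int) (l :: int) (m :: int). l \<noteq> 0 \<and> m \<noteq> 0 \<longrightarrow>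
          (v j (omit d j (n(k := n k + l))) - v j (omit d j n)) *
            (exp (\<i> * of_real (2 * pi * \<alpha> k)) - v k (omit d k n)) = 0 \<and>
          (v k (omit d k (n(j := n j + m))) - v k (omit d k n)) *
            (exp (\<i> * of_real (2 * pi * \<alpha> j)) - v j (omit d j n)) = 0)))
    \<and> ((\<forall>j\<in>{1..d}. \<alpha> j = 0) \<longrightarrow>
      (strongly_commuting (cube_measure {1..d}) {1..d} H \<longleftrightarrow>
      (\<forall>j k. 1 \<le> j \<and> j < k \<and> k \<le> d \<longrightarrow>
        (\<forall>(n :: nat \<Rightarrow> int) (l :: int) (m :: int). l \<noteq> 0 \<and> m \<noteq> 0 \<longrightarrow>
          (v j (omit d j (n(k := n k + l))) - v j (omit d j n)) * (1 - v k (omit d k n)) = 0 \<and>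
          (v k (omit d k (n(j := n j + m))) - v k (omit d k n)) * (1 - v j (omit d j n)) = 0))))"
proof -
  interpret quasi_commuting_family d H \<alpha> v
    using assms(2,3) by (rule quasi_commuting_family.intro)
  \<comment> \<open>One condition for each ordered pair; the two conditions for \<open>j < k\<close>
    are \<open>Q j k\<close> and \<open>Q k j\<close>, and a zero shift makes \<open>Q\<close>
    trivial.\<close>
  define Q where "Q j k n l \<longleftrightarrow>
    (v j (omit d j (n(k := n k + l))) - v j (omit d j n)) * (cis (2 * pi * \<alpha> k) - v k (omit d k n)) = 0"
    for j k n l
  have iff: "strongly_commuting M {1..d} H \<longleftrightarrow>
    (\<forall>j k. 1 \<le> j \<and> j < k \<and> k \<le> d \<longrightarrow> (\<forall>n l m. l \<noteq> 0 \<and> m \<noteq> 0 \<longrightarrow> Q j k n l \<and> Q k j n m))"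
  proof (intro iffI allI impI)
    fix j k n and l m :: int
    assume "strongly_commuting M {1..d} H" "1 \<le> j \<and> j < k \<and> k \<le> d"
    then show "Q j k n l \<and> Q k j n m"
      unfolding Q_def by (intro conjI cocycle_of_strongly_commuting) auto
  next
    assume *: "\<forall>j k. 1 \<le> j \<and> j < k \<and> k \<le> d \<longrightarrow> (\<forall>n l m. l \<noteq> 0 \<and> m \<noteq> 0 \<longrightarrow> Q j k n l \<and> Q k j n m)"
    show "strongly_commuting M {1..d} H"
    proof (rule strongly_commuting_of_cocycle, fold Q_def)
      fix j k n l assume jk: "j \<in> {1..d}" "k \<in> {1..d}" "j \<noteq> k"
      show "Q j k n l"
      proof (cases "l = 0")
        case True
        then show ?thesis by (simp add: Q_def)
      next
        case False
        show ?thesis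
        proof (cases "j < k")
          case True
          \<comment> \<open>The two shifts are quantified together; the one in the other condition
            can be any nonzero integer, here 1.\<close>
          then show ?thesis using *[rule_format, of j k l 1 n] jk False by auto
        next
          case False
          then show ?thesis using *[rule_format, of k j 1 l n] jk \<open>l \<noteq> 0\<close> by auto
        qed
      qed
    qed
  qed
  have gen: "exp (\<i> * of_real (2 * pi * \<alpha> k)) = cis (2 * pi * \<alpha> k)" for k
    by (simp add: cis_conv_exp)
  show ?thesis
  proof (intro conjI impI)
    show "strongly_commuting M {1..d} H \<longleftrightarrow>
      (\<forall>j k. 1 \<le> j \<and> j < k \<and> k \<le> d \<longrightarrow>
        (\<forall>(n :: nat \<Rightarrow> int) (l :: int) (m :: int). l \<noteq> 0 \<and> m \<noteq> 0 \<longrightarrow>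
          (v j (omit d j (n(k := n k + l))) - v j (omit d j n)) *
            (exp (\<i> * of_real (2 * pi * \<alpha> k)) - v k (omit d k n)) = 0 \<and>
          (v k (omit d k (n(j := n j + m))) - v k (omit d k n)) *
            (exp (\<i> * of_real (2 * pi * \<alpha> j)) - v j (omit d j n)) = 0))"
      unfolding gen by (rule iff[unfolded Q_def])
  next
    assume "\<forall>j\<in>{1..d}. \<alpha> j = 0"
    then have Q: "Q j k n l \<longleftrightarrow>
      (v j (omit d j (n(k := n k + l))) - v j (omit d j n)) * (1 - v k (omit d k n)) = 0"
      if "1 \<le> k" "k \<le> d" for j k n l
      using that by (simp add: Q_def)
    show "strongly_commuting M {1..d} H \<longleftrightarrow>
      (\<forall>j k. 1 \<le> j \<and> j < k \<and> k \<le> d \<longrightarrow>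
        (\<forall>(n :: nat \<Rightarrow> int) (l :: int) (m :: int). l \<noteq> 0 \<and> m \<noteq> 0 \<longrightarrow>
          (v j (omit d j (n(k := n k + l))) - v j (omit d j n)) * (1 - v k (omit d k n)) = 0 \<and>
          (v k (omit d k (n(j := n j + m))) - v k (omit d k n)) * (1 - v j (omit d j n)) = 0))"
      unfolding iff
    proof (intro iff_allI imp_cong refl)
      fix j k :: nat and n :: "nat \<Rightarrow> int" and l m :: int
      assume jk: "1 \<le> j \<and> j < k \<and> k \<le> d"
      then have "1 \<le> k" "k \<le> d" "1 \<le> j" "j \<le> d" by auto
      then show "Q j k n l \<and> Q k j n m \<longleftrightarrow>
          (v j (omit d j (n(k := n k + l))) - v j (omit d j n)) * (1 - v k (omit d k n)) = 0 \<and>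
          (v k (omit d k (n(j := n j + m))) - v k (omit d k n)) * (1 - v j (omit d j n)) = 0"
        by (simp only: Q)
    qed
  qed
qed

end
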